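(* Let $(\mathcal{G},\{\Phi_v\},\{l_v\})$ be a computational structure as in the context, and consider the KKT system $$\begin{bmatrix}\partial_V^2\mathcal{L} & (\partial_V\mathbf{h})^{\mathtt{T}}\\ \partial_V\mathbf{h} & 0\end{bmatrix}\begin{bmatrix}\delta\mathtt{X}_V\\ \lambda^+\end{bmatrix}=\begin{bmatrix}-\partial_V \hat f\\ -\mathbf{h}\end{bmatrix}$$ associated with the constrained problem at a nominal point $(\tilde{\mathtt{X}}_V,\tilde\lambda)$. Assume that the quadratic program $\min_{\delta}\ \tfrac12\delta^{\mathtt{T}}\,\partial_V^2\mathcal{L}\,\delta+(\partial_V\hat f)^{\mathtt{T}}\delta$ subject to $\partial_V\mathbf{h}\,\delta=-\mathbf{h}$ has a bounded solution (its minimum is attained). Then, given a tree-decomposition of $\mathcal{G}$ of width $\mathrm{tw}(\mathcal{G})$ with $m$ nodes, the KKT system can be solved in time $O(m\,\mathrm{tw}(\mathcal{G})^3)$.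
   Context: $\mathcal{G}$ is a finite directed acyclic graph with vertex set $V=V[\mathcal{G}]$; $\mathrm{pa}(v)$ denotes the set of parents of $v$. Each vertex $v$ carries a state $\mathtt{X}_v\in U_v$, with $U_v\subset\mathbb{R}^{n_v}$ open; the dimensions $n_v$ are regarded as bounded by a constant (e.g. $n_v=1$). For $A\subset V$, $\mathtt{X}_A$ is the labelled concatenation of the states of vertices in $A$. Input vertices are those with $\mathrm{pa}(v)=\emptyset$. For each non-input $v$ there is a twice continuously differentiable function $\Phi_v:\prod_{z\in\mathrm{pa}(v)}U_z\to U_v$, and for each $v\in V$ a twice continuously differentiable local objective $l_v:\prod_{z\in\{v\}\cup\mathrm{pa}(v)}U_z\to\mathbb{R}$. Constrained problem: minimize over all $\mathtt{X}_V$ the function $\hat f(\mathtt{X}_V)=\sum_{v\in V}l_v(\mathtt{X}_{\{v\}\cup\mathrm{pa}(v)})$, with all states treated as independent variables, subject to $\mathbf{h}_v(\mathtt{X}_{\{v\}\cup\mathrm{pa}(v)})=\Phi_v(\mathtt{X}_{\mathrm{pa}(v)})-\mathtt{X}_v=0$ for all non-input $v$. $\mathbf{h}$ is the concatenation of the $\mathbf{h}_v$. The Lagrangian is $\mathcal{L}(\mathtt{X}_V,\lambda)=\hat f(\mathtt{X}_V)+\sum_{v\ \text{non-input}}\lambda_v^{\mathtt{T}}\mathbf{h}_v$, with $\lambda_v\in\mathbb{R}^{n_v}$. $\partial_V,\partial_V^2$ are first and second derivatives with respect to all of $\mathtt{X}_V$; all quantities in the KKT system are evaluated at $(\tilde{\mathtt{X}}_V,\tilde\lambda)$,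 and the values of the first and second derivatives of each $l_v$ and $\Phi_v$ there are given. A tree-decomposition of a hypergraph $\mathcal{H}$ is a tree $\mathcal{T}$ with a map $\chi:V[\mathcal{T}]\to 2^{V[\mathcal{H}]}$ such that (i) $\bigcup_{i}\chi(i)=V[\mathcal{H}]$; (ii) every hyperedge $e$ satisfies $e\subset\chi(i)$ for some $i$; (iii) for every $u\in V[\mathcal{H}]$ the set $\{i:u\in\chi(i)\}$ induces a non-empty subtree of $\mathcal{T}$. Its width is $\max_i|\chi(i)|-1$, and the tree-width of $\mathcal{H}$ is the minimal width over all its tree-decompositions. Tree-decompositions and the tree-width $\mathrm{tw}(\mathcal{G})$ of the DAG $\mathcal{G}$ are those of the hypergraph on $V[\mathcal{G}]$ with hyperedges $\{v\}\cup\mathrm{pa}(v)$, $v\in V[\mathcal{G}]$ (equivalently, of the moralization of $\mathcal{G}$). Time is counted in exact real arithmetic operations (flops) and comparisons; in the $O(\cdot)$ bound the width is read as at least $1$. *)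

theory Defs
  imports "HOL-Analysis.Analysis"
begin

section \<open>Trees, tree-decompositions and tree-width\<close>

text \<open>
  An undirected simple graph on a vertex set \<open>I\<close> is given by a symmetric irreflexive relation \<open>F\<close>.
\<close>

definition tree :: "'a set \<Rightarrow> ('a \<times> 'a) set \<Rightarrow> bool" where
  "tree I F \<longleftrightarrow>
     finite I \<and> I \<noteq> {} \<and> F \<subseteq> I \<times> I \<and> sym F \<and> irrefl F \<and>
     (\<forall>i\<in>I. \<forall>j\<in>I. (i, j) \<in> F\<^sup>*) \<and>
     \<not> (\<exists>xs. length xs \<ge> 3 \<and> distinct xs \<and>
            successively (\<lambda>i j. (i, j) \<in> F) xs \<and> (last xs, hd xs) \<in> F)"

definition tree_decomposition ::
    "'v set \<Rightarrow> 'v set set \<Rightarrow> 'a set \<Rightarrow> ('a \<times> 'a) set \<Rightarrow> ('a \<Rightarrow> 'v set) \<Rightarrow> bool" where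
  "tree_decomposition W H I F bag \<longleftrightarrow>
     tree I F \<and>
     (\<Union>i\<in>I. bag i) = W \<and>
     (\<forall>e\<in>H. \<exists>i\<in>I. e \<subseteq> bag i) \<and>
     (\<forall>u\<in>W. let J = {i \<in> I. u \<in> bag i} in tree J (F \<inter> J \<times> J))"

text \<open>
  The subtraction is on \<open>nat\<close>; it truncates only when all bags are empty, that is, for a
  hypergraph without vertices.
\<close>

definition width :: "'a set \<Rightarrow> ('a \<Rightarrow> 'v set) \<Rightarrow> nat" where
  "width I bag = Max ((\<lambda>i. card (bag i)) ` I) - 1"

text \<open>Trees are finite, so taking their nodes in \<open>nat\<close> is no restriction.\<close>

definition treewidth :: "'v set \<Rightarrow> 'v set set \<Rightarrow> nat" where
  "treewidth W H =
     (LEAST w. \<exists>(I :: nat set) F bag. tree_decomposition W H I F bag \<and> width I bag = w)"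


section \<open>States and twice continuously differentiable functions\<close>

text \<open>
  A state of vertex \<open>v\<close> is an element of \<^term>\<open>Euclidean_space (n v)\<close>, the library's \<open>n v\<close>-dimensional
  space, whose points are functions \<open>nat \<Rightarrow> real\<close> vanishing from index \<open>n v\<close> on.
  The labelled concatenation of the states of the vertices in \<open>A\<close> is an element of
  \<^term>\<open>Pi\<^sub>E A U\<close>; accordingly \<^term>\<open>restrict X A\<close> is the concatenation over \<open>A\<close> of the states in \<open>X\<close>.
  The scalar coordinates of such a concatenation are indexed by \<open>coords n A\<close>.
\<close>

type_synonym state = "nat \<Rightarrow> nat \<Rightarrow> real"
type_synonym coord = "nat \<times> nat"

definition coords :: "(nat \<Rightarrow> nat) \<Rightarrow> nat set \<Rightarrow> coord set" where
  "coords n A = (SIGMA v:A. {..<n v})"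

definition state_space :: "(nat \<Rightarrow> nat) \<Rightarrow> (nat \<Rightarrow> (nat \<Rightarrow> real) set) \<Rightarrow> nat set \<Rightarrow> state topology" where
  "state_space n U A = product_topology (\<lambda>v. subtopology (Euclidean_space (n v)) (U v)) A"

definition upd :: "state \<Rightarrow> coord \<Rightarrow> real \<Rightarrow> state" where
  "upd X c t = X(fst c := (X (fst c))(snd c := t))"

definition coord_of :: "state \<Rightarrow> coord \<Rightarrow> real" where
  "coord_of X c = X (fst c) (snd c)"

definition partial :: "coord \<Rightarrow> (state \<Rightarrow> real) \<Rightarrow> state \<Rightarrow> real" where
  "partial c f X = deriv (\<lambda>t. f (upd X c t)) (coord_of X c)"

definition C1_on ::
    "(nat \<Rightarrow> nat) \<Rightarrow> (nat \<Rightarrow> (nat \<Rightarrow> real) set) \<Rightarrow> nat set \<Rightarrow> (state \<Rightarrow> real) \<Rightarrow> bool" where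
  "C1_on n U A f \<longleftrightarrow>
     continuous_map (state_space n U A) euclideanreal f \<and>
     (\<forall>c\<in>coords n A.
        (\<forall>X\<in>Pi\<^sub>E A U. (\<lambda>t. f (upd X c t)) differentiable at (coord_of X c)) \<and>
        continuous_map (state_space n U A) euclideanreal (partial c f))"

definition C2_on ::
    "(nat \<Rightarrow> nat) \<Rightarrow> (nat \<Rightarrow> (nat \<Rightarrow> real) set) \<Rightarrow> nat set \<Rightarrow> (state \<Rightarrow> real) \<Rightarrow> bool" where
  "C2_on n U A f \<longleftrightarrow> C1_on n U A f \<and> (\<forall>c\<in>coords n A. C1_on n U A (partial c f))"


section \<open>Computational structures\<close>

definition pa :: "(nat \<times> nat) set \<Rightarrow> nat \<Rightarrow> nat set" where
  "pa E v = {u. (u, v) \<in> E}"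

definition fam :: "(nat \<times> nat) set \<Rightarrow> nat \<Rightarrow> nat set" where
  "fam E v = {v} \<union> pa E v"

definition noninput :: "nat set \<Rightarrow> (nat \<times> nat) set \<Rightarrow> nat set" where
  "noninput V E = {v \<in> V. pa E v \<noteq> {}}"

definition hyperedges :: "nat set \<Rightarrow> (nat \<times> nat) set \<Rightarrow> nat set set" where
  "hyperedges V E = fam E ` V"

definition computational_structure ::
    "nat set \<Rightarrow> (nat \<times> nat) set \<Rightarrow> (nat \<Rightarrow> nat) \<Rightarrow> (nat \<Rightarrow> (nat \<Rightarrow> real) set) \<Rightarrow>
     (nat \<Rightarrow> state \<Rightarrow> nat \<Rightarrow> real) \<Rightarrow> (nat \<Rightarrow> state \<Rightarrow> real) \<Rightarrow> bool" where
  "computational_structure V E n U \<Phi> l \<longleftrightarrow>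
     finite V \<and> E \<subseteq> V \<times> V \<and> acyclic E \<and>
     (\<forall>v\<in>V. openin (Euclidean_space (n v)) (U v)) \<and>
     (\<forall>v\<in>noninput V E.
        (\<forall>X\<in>Pi\<^sub>E (pa E v) U. \<Phi> v X \<in> U v) \<and>
        (\<forall>i<n v. C2_on n U (pa E v) (\<lambda>X. \<Phi> v X i))) \<and>
     (\<forall>v\<in>V. C2_on n U (fam E v) (l v))"


section \<open>The constrained problem and its KKT system\<close>

definition fhat ::
    "nat set \<Rightarrow> (nat \<times> nat) set \<Rightarrow> (nat \<Rightarrow> state \<Rightarrow> real) \<Rightarrow> state \<Rightarrow> real" where
  "fhat V E l X = (\<Sum>v\<in>V. l v (restrict X (fam E v)))"

text \<open>Component \<open>i\<close> of the constraint of vertex \<open>v\<close>, with \<open>c = (v, i)\<close>.\<close>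

definition constr ::
    "(nat \<times> nat) set \<Rightarrow> (nat \<Rightarrow> state \<Rightarrow> nat \<Rightarrow> real) \<Rightarrow> coord \<Rightarrow> state \<Rightarrow> real" where
  "constr E \<Phi> c X = \<Phi> (fst c) (restrict X (pa E (fst c))) (snd c) - X (fst c) (snd c)"

definition Lagrangian ::
    "nat set \<Rightarrow> (nat \<times> nat) set \<Rightarrow> (nat \<Rightarrow> nat) \<Rightarrow> (nat \<Rightarrow> state \<Rightarrow> nat \<Rightarrow> real) \<Rightarrow>
     (nat \<Rightarrow> state \<Rightarrow> real) \<Rightarrow> state \<Rightarrow> state \<Rightarrow> real" where
  "Lagrangian V E n \<Phi> l \<mu> X =
     fhat V E l X + (\<Sum>v\<in>noninput V E. \<Sum>i<n v. \<mu> v i * constr E \<Phi> (v, i) X)"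

definition hess_L ::
    "nat set \<Rightarrow> (nat \<times> nat) set \<Rightarrow> (nat \<Rightarrow> nat) \<Rightarrow> (nat \<Rightarrow> state \<Rightarrow> nat \<Rightarrow> real) \<Rightarrow>
     (nat \<Rightarrow> state \<Rightarrow> real) \<Rightarrow> state \<Rightarrow> state \<Rightarrow> coord \<Rightarrow> coord \<Rightarrow> real" where
  "hess_L V E n \<Phi> l X \<mu> c d = partial c (partial d (Lagrangian V E n \<Phi> l \<mu>)) X"

definition solves_KKT ::
    "nat set \<Rightarrow> (nat \<times> nat) set \<Rightarrow> (nat \<Rightarrow> nat) \<Rightarrow> (nat \<Rightarrow> state \<Rightarrow> nat \<Rightarrow> real) \<Rightarrow>
     (nat \<Rightarrow> state \<Rightarrow> real) \<Rightarrow> state \<Rightarrow> state \<Rightarrow> (coord \<Rightarrow> real) \<Rightarrow> (coord \<Rightarrow> real) \<Rightarrow> bool" where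
  "solves_KKT V E n \<Phi> l X \<mu> \<delta> \<nu> \<longleftrightarrow>
     (\<forall>c\<in>coords n V.
        (\<Sum>d\<in>coords n V. hess_L V E n \<Phi> l X \<mu> c d * \<delta> d)
        + (\<Sum>k\<in>coords n (noninput V E). partial c (constr E \<Phi> k) X * \<nu> k)
        = - partial c (fhat V E l) X) \<and>
     (\<forall>k\<in>coords n (noninput V E).
        (\<Sum>d\<in>coords n V. partial d (constr E \<Phi> k) X * \<delta> d) = - constr E \<Phi> k X)"

definition QP_feasible ::
    "nat set \<Rightarrow> (nat \<times> nat) set \<Rightarrow> (nat \<Rightarrow> nat) \<Rightarrow> (nat \<Rightarrow> state \<Rightarrow> nat \<Rightarrow> real) \<Rightarrow>
     state \<Rightarrow> (coord \<Rightarrow> real) \<Rightarrow> bool" where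
  "QP_feasible V E n \<Phi> X \<delta> \<longleftrightarrow>
     (\<forall>k\<in>coords n (noninput V E).
        (\<Sum>d\<in>coords n V. partial d (constr E \<Phi> k) X * \<delta> d) = - constr E \<Phi> k X)"

definition QP_objective ::
    "nat set \<Rightarrow> (nat \<times> nat) set \<Rightarrow> (nat \<Rightarrow> nat) \<Rightarrow> (nat \<Rightarrow> state \<Rightarrow> nat \<Rightarrow> real) \<Rightarrow>
     (nat \<Rightarrow> state \<Rightarrow> real) \<Rightarrow> state \<Rightarrow> state \<Rightarrow> (coord \<Rightarrow> real) \<Rightarrow> real" where
  "QP_objective V E n \<Phi> l X \<mu> \<delta> =
     1/2 * (\<Sum>c\<in>coords n V. \<Sum>d\<in>coords n V. \<delta> c * hess_L V E n \<Phi> l X \<mu> c d * \<delta> d)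
     + (\<Sum>c\<in>coords n V. partial c (fhat V E l) X * \<delta> c)"

definition QP_attained ::
    "nat set \<Rightarrow> (nat \<times> nat) set \<Rightarrow> (nat \<Rightarrow> nat) \<Rightarrow> (nat \<Rightarrow> state \<Rightarrow> nat \<Rightarrow> real) \<Rightarrow>
     (nat \<Rightarrow> state \<Rightarrow> real) \<Rightarrow> state \<Rightarrow> state \<Rightarrow> bool" where
  "QP_attained V E n \<Phi> l X \<mu> \<longleftrightarrow>
     (\<exists>\<delta>. QP_feasible V E n \<Phi> X \<delta> \<and>
        (\<forall>\<delta>'. QP_feasible V E n \<Phi> X \<delta>' \<longrightarrow>
           QP_objective V E n \<Phi> l X \<mu> \<delta> \<le> QP_objective V E n \<Phi> l X \<mu> \<delta>'))"


section \<open>Model of computation\<close>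

text \<open>
  Programs over a memory of real cells. The only access to real data is through exact arithmetic,
  integer constants and order comparisons, and each such instruction costs one time unit.
  Addresses are fixed in the program text, loops are unrolled, and division by zero aborts.
\<close>

datatype arith = Add | Sub | Mul | Div

fun arith_op :: "arith \<Rightarrow> real \<Rightarrow> real \<Rightarrow> real" where
  "arith_op Add x y = x + y"
| "arith_op Sub x y = x - y"
| "arith_op Mul x y = x * y"
| "arith_op Div x y = x / y"

datatype 'c prog =
    Skip
  | Const 'c int
  | Arith arith 'c 'c 'c  \<comment> \<open>operation, destination, operands\<close>
  | Seq "'c prog" "'c prog"
  | If_less 'c 'c "'c prog" "'c prog"

fun run :: "'c prog \<Rightarrow> ('c \<Rightarrow> real) \<Rightarrow> (('c \<Rightarrow> real) \<times> nat) option" where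
  "run Skip s = Some (s, 0)"
| "run (Const r k) s = Some (s(r := of_int k), 1)"
| "run (Arith f r a b) s =
     (if f = Div \<and> s b = 0 then None else Some (s(r := arith_op f (s a) (s b)), 1))"
| "run (Seq p q) s =
     (case run p s of None \<Rightarrow> None
      | Some (s1, t1) \<Rightarrow>
          (case run q s1 of None \<Rightarrow> None | Some (s2, t2) \<Rightarrow> Some (s2, t1 + t2)))"
| "run (If_less a b p q) s =
     (case (if s a < s b then run p s else run q s) of None \<Rightarrow> None
      | Some (s1, t1) \<Rightarrow> Some (s1, t1 + 1))"

text \<open>
  Memory cells of a KKT solver: the numerical input (nominal point, nominal multipliers, and the
  local values, first and second derivatives at the nominal point), work cells, and output cells.
\<close>

datatype cell =
    In_X coord
  | In_lam coord
  | In_Phi coord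
  | In_dPhi coord coord
  | In_ddPhi coord coord coord
  | In_dl nat coord
  | In_ddl nat coord coord
  | Work nat
  | Out_delta coord
  | Out_lam coord

fun initial_store ::
    "nat set \<Rightarrow> (nat \<times> nat) set \<Rightarrow> (nat \<Rightarrow> nat) \<Rightarrow> (nat \<Rightarrow> state \<Rightarrow> nat \<Rightarrow> real) \<Rightarrow>
     (nat \<Rightarrow> state \<Rightarrow> real) \<Rightarrow> state \<Rightarrow> state \<Rightarrow> cell \<Rightarrow> real" where
  "initial_store V E n \<Phi> l X \<mu> (In_X c) =
     (if c \<in> coords n V then coord_of X c else 0)"
| "initial_store V E n \<Phi> l X \<mu> (In_lam k) =
     (if k \<in> coords n (noninput V E) then coord_of \<mu> k else 0)"
| "initial_store V E n \<Phi> l X \<mu> (In_Phi k) =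
     (if k \<in> coords n (noninput V E)
      then \<Phi> (fst k) (restrict X (pa E (fst k))) (snd k) else 0)"
| "initial_store V E n \<Phi> l X \<mu> (In_dPhi k c) =
     (if k \<in> coords n (noninput V E) \<and> c \<in> coords n (pa E (fst k))
      then partial c (\<lambda>Y. \<Phi> (fst k) Y (snd k)) (restrict X (pa E (fst k))) else 0)"
| "initial_store V E n \<Phi> l X \<mu> (In_ddPhi k c d) =
     (if k \<in> coords n (noninput V E) \<and> c \<in> coords n (pa E (fst k)) \<and> d \<in> coords n (pa E (fst k))
      then partial c (partial d (\<lambda>Y. \<Phi> (fst k) Y (snd k))) (restrict X (pa E (fst k))) else 0)"
| "initial_store V E n \<Phi> l X \<mu> (In_dl v c) =
     (if v \<in> V \<and> c \<in> coords n (fam E v)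
      then partial c (l v) (restrict X (fam E v)) else 0)"
| "initial_store V E n \<Phi> l X \<mu> (In_ddl v c d) =
     (if v \<in> V \<and> c \<in> coords n (fam E v) \<and> d \<in> coords n (fam E v)
      then partial c (partial d (l v)) (restrict X (fam E v)) else 0)"
| "initial_store V E n \<Phi> l X \<mu> (Work i) = 0"
| "initial_store V E n \<Phi> l X \<mu> (Out_delta c) = 0"
| "initial_store V E n \<Phi> l X \<mu> (Out_lam k) = 0"

text \<open>
  A solver receives the DAG, the dimensions and the tree-decomposition \<open>(I, F, bag)\<close>, and from these
  alone determines the program to be run; it has no access to real data.
\<close>

type_synonym solver =
  "nat set \<Rightarrow> (nat \<times> nat) set \<Rightarrow> (nat \<Rightarrow> nat) \<Rightarrow>
   nat set \<Rightarrow> (nat \<times> nat) set \<Rightarrow> (nat \<Rightarrow> nat set) \<Rightarrow> cell prog"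

definition solves_KKT_within ::
    "cell prog \<Rightarrow> nat \<Rightarrow> nat set \<Rightarrow> (nat \<times> nat) set \<Rightarrow> (nat \<Rightarrow> nat) \<Rightarrow>
     (nat \<Rightarrow> state \<Rightarrow> nat \<Rightarrow> real) \<Rightarrow> (nat \<Rightarrow> state \<Rightarrow> real) \<Rightarrow> state \<Rightarrow> state \<Rightarrow> bool" where
  "solves_KKT_within p T V E n \<Phi> l X \<mu> \<longleftrightarrow>
     (\<exists>s t. run p (initial_store V E n \<Phi> l X \<mu>) = Some (s, t) \<and> t \<le> T \<and>
            solves_KKT V E n \<Phi> l X \<mu> (\<lambda>c. s (Out_delta c)) (\<lambda>k. s (Out_lam k)))"

end

theory Submission
  imports Defs
begin

text \<open>
  The KKT system is consistent: at a minimiser of the quadratic program the gradient is orthogonal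
  to the kernel of \<open>\<partial>\<^sub>V h\<close>, hence in the row space, and the Hessian is symmetric by Schwarz.
  A stationarity equation couples a coordinate with all its neighbours, which need not lie in one
  bag. It is a sum of terms local to single nodes, all in the subtree of bags containing the
  coordinate, so the sum can be accumulated along that subtree; the partial sums are new unknowns and every equation becomes local
  to a node. To bound the number of partial sums meeting at a node, the tree is first made binary.
  The local system \<open>A x = b\<close> is solved through its normal equations. Their matrix is positive
  semidefinite and has its nonzero entries inside the clusters, so elimination from the leaves to
  the root creates no fill-in outside the clusters and needs no pivoting: a zero pivot comes with a
  zero row and is skipped. Each of the \<open>O(m w)\<close> eliminations costs \<open>O(w\<^sup>2)\<close>.
\<close>


section \<open>Straight-line programs\<close>

text \<open>Choosing pivots by their values would conflict with an order dictated by the tree, and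
  the KKT matrix is indefinite and may be singular. For a Gram matrix any order is safe: pivots stay
  nonnegative, and one sign test decides between dividing and skipping. The price is that normal
  equations return a true solution only of a consistent system. Solvability therefore travels
  through the whole argument: from the attained minimum to multipliers, from vanishing sums to
  messages, and into the elimination, whose hypothesis is some solution \<open>u\<close> in place of
  invertibility. The split into local rows has to come first. A stationarity row left whole would
  make the Gram matrix couple all neighbours of a coordinate with each other, whereas a row inside
  one cluster only couples unknowns of that cluster. With dimensions bounded by \<open>N\<close>, a
  node carries O(w) unknowns and O(w) rows. A coefficient may itself be a sum of O(w) input terms;
  it is evaluated once per row and stored, so that assembling the rows also stays within O(w^3) per
  node.\<close>

datatype exp =
    Var cell
  | Cst int
  | Bin arith exp exp
  | Pinv exp

fun ev :: "(cell \<Rightarrow> real) \<Rightarrow> exp \<Rightarrow> real" where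
  "ev s (Var c) = s c"
| "ev s (Cst k) = of_int k"
| "ev s (Bin f a b) = arith_op f (ev s a) (ev s b)"
| "ev s (Pinv a) = (if 0 < ev s a then 1 / ev s a else 0)"

fun esize :: "exp \<Rightarrow> nat" where
  "esize (Var c) = 1"
| "esize (Cst k) = 1"
| "esize (Bin f a b) = Suc (esize a + esize b)"
| "esize (Pinv a) = Suc (esize a)"

fun reads :: "exp \<Rightarrow> cell set" where
  "reads (Var c) = {c}"
| "reads (Cst k) = {}"
| "reads (Bin f a b) = reads a \<union> reads b"
| "reads (Pinv a) = reads a"

fun div_free :: "exp \<Rightarrow> bool" where
  "div_free (Bin f a b) \<longleftrightarrow> f \<noteq> Div \<and> div_free a \<and> div_free b"
| "div_free (Pinv a) \<longleftrightarrow> div_free a"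
| "div_free _ \<longleftrightarrow> True"

text \<open>Even work cells form an evaluation stack; the odd ones hold the data of the elimination
  (see \<open>wk\<close>), so evaluating an expression never damages them.\<close>

definition tmp :: "nat \<Rightarrow> cell" where "tmp d = Work (2 * d)"

definition temps :: "cell set" where "temps = range tmp"

lemma tmp_eq_iff [simp]: "tmp i = tmp j \<longleftrightarrow> i = j"
  by (simp add: tmp_def)

lemma tmp_in_temps [simp]: "tmp i \<in> temps"
  by (simp add: temps_def)

text \<open>\<open>d\<close> is the height of the stack: the value ends in \<open>tmp d\<close>, and
  only stack cells from there upward are written. Copying a cell is addition of zero.
  \<open>Pinv\<close> divides behind a sign test, so a zero pivot cannot abort the run.\<close>

fun compile :: "nat \<Rightarrow> exp \<Rightarrow> cell prog" where
  "compile d (Var c) = Seq (Const (tmp (Suc d)) 0) (Arith Add (tmp d) c (tmp (Suc d)))"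
| "compile d (Cst k) = Const (tmp d) k"
| "compile d (Bin f a b) =
     Seq (compile d a) (Seq (compile (Suc d) b) (Arith f (tmp d) (tmp d) (tmp (Suc d))))"
| "compile d (Pinv a) =
     Seq (compile d a) (Seq (Const (tmp (Suc d)) 0)
       (If_less (tmp (Suc d)) (tmp d)
          (Seq (Const (tmp (Suc d)) 1) (Arith Div (tmp d) (tmp (Suc d)) (tmp d)))
          (Const (tmp d) 0)))"

lemma ev_cong: "(\<And>c. c \<in> reads e \<Longrightarrow> s c = s' c) \<Longrightarrow> ev s e = ev s' e"
  by (induction e) auto

text \<open>The frame condition drives the induction: the second operand of \<open>Bin\<close> is
  evaluated one level higher and leaves the first result intact. The factor 4 comes from
  \<open>Pinv\<close>: a constant, the comparison and two instructions in the positive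
  branch.\<close>

lemma run_compile:
  assumes "div_free e" "reads e \<inter> temps = {}"
  shows "\<exists>s' t. run (compile d e) s = Some (s', t) \<and> t \<le> 4 * esize e \<and> s' (tmp d) = ev s e \<and>
           (\<forall>c. c \<notin> tmp ` {d..} \<longrightarrow> s' c = s c)"
  using assms
proof (induction e arbitrary: d s)
  case (Var c)
  then have "c \<noteq> tmp (Suc d)" by (auto simp: temps_def)
  then show ?case by (auto simp: image_iff)
next
  case (Cst k)
  then show ?case by (auto simp: image_iff)
next
  case (Bin f a b)
  have ra: "div_free a" "reads a \<inter> temps = {}" and rb: "div_free b" "reads b \<inter> temps = {}"
    using Bin.prems by auto
  obtain s1 t1 where 1: "run (compile d a) s = Some (s1, t1)" "t1 \<le> 4 * esize a"
    "s1 (tmp d) = ev s a" "\<forall>c. c \<notin> tmp ` {d..} \<longrightarrow> s1 c = s c"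
    using Bin.IH(1)[OF ra] by blast
  obtain s2 t2 where 2: "run (compile (Suc d) b) s1 = Some (s2, t2)" "t2 \<le> 4 * esize b"
    "s2 (tmp (Suc d)) = ev s1 b" "\<forall>c. c \<notin> tmp ` {Suc d..} \<longrightarrow> s2 c = s1 c"
    using Bin.IH(2)[OF rb] by blast
  have "ev s1 b = ev s b"
    using rb(2) 1(4) by (intro ev_cong) (metis disjoint_iff imageE tmp_in_temps)
  moreover have "s2 (tmp d) = s1 (tmp d)"
    using 2(4) by (auto simp: image_iff)
  moreover have "f \<noteq> Div" using Bin.prems by simp
  ultimately show ?case
    using 1 2 by (auto simp: image_iff)
next
  case (Pinv a)
  obtain s1 t1 where 1: "run (compile d a) s = Some (s1, t1)" "t1 \<le> 4 * esize a"
    "s1 (tmp d) = ev s a" "\<forall>c. c \<notin> tmp ` {d..} \<longrightarrow> s1 c = s c"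
    using Pinv.IH Pinv.prems by fastforce
  then show ?case
    by (auto simp: image_iff)
qed

section \<open>Sequences of assignments\<close>

type_synonym assignment = "cell \<times> exp"

fun exec :: "assignment list \<Rightarrow> (cell \<Rightarrow> real) \<Rightarrow> (cell \<Rightarrow> real)" where
  "exec [] s = s"
| "exec ((c, e) # as) s = exec as (s(c := ev s e))"

fun compile_list :: "assignment list \<Rightarrow> cell prog" where
  "compile_list [] = Skip"
| "compile_list ((c, e) # as) =
     Seq (Seq (compile 0 e) (Seq (Const (tmp 1) 0) (Arith Add c (tmp 0) (tmp 1)))) (compile_list as)"

text \<open>Per assignment: the factor 4 of \<open>run_compile\<close>, and 2 instructions copying
  the result from \<open>tmp 0\<close> to its target.\<close>

definition cost :: "assignment list \<Rightarrow> nat" where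
  "cost as = (\<Sum>a\<leftarrow>as. 4 * esize (snd a) + 2)"

definition admissible :: "assignment list \<Rightarrow> bool" where
  "admissible as \<longleftrightarrow>
     (\<forall>(c, e) \<in> set as. c \<notin> temps \<and> div_free e \<and> reads e \<inter> temps = {})"

lemma cost_simps [simp]:
  "cost [] = 0" "cost (a # as) = 4 * esize (snd a) + 2 + cost as" "cost (as @ bs) = cost as + cost bs"
  by (simp_all add: cost_def)

lemma cost_concat: "cost (concat xss) = sum_list (map cost xss)"
  by (induction xss) auto

lemma cost_le:
  assumes "\<And>a. a \<in> set as \<Longrightarrow> esize (snd a) \<le> k"
  shows "cost as \<le> length as * (4 * k + 2)"
  using assms
proof (induction as)
  case (Cons a as)
  then have "esize (snd a) \<le> k" "cost as \<le> length as * (4 * k + 2)" by auto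
  then show ?case by simp
qed simp

lemma admissible_simps [simp]:
  "admissible []"
  "admissible (a # as) \<longleftrightarrow>
     fst a \<notin> temps \<and> div_free (snd a) \<and> reads (snd a) \<inter> temps = {} \<and> admissible as"
  "admissible (as @ bs) \<longleftrightarrow> admissible as \<and> admissible bs"
  by (auto simp: admissible_def)

lemma admissible_concat: "admissible (concat xss) \<longleftrightarrow> (\<forall>xs\<in>set xss. admissible xs)"
  by (induction xss) auto

lemma exec_append [simp]: "exec (as @ bs) s = exec bs (exec as s)"
  by (induction as arbitrary: s) auto

lemma exec_other: "c \<notin> fst ` set as \<Longrightarrow> exec as s c = s c"
proof (induction as arbitrary: s)
  case (Cons a as)
  then show ?case by (cases a) auto
qed simp

lemma run_compile_list:
  assumes "admissible as" "\<And>c. c \<notin> temps \<Longrightarrow> s c = s0 c"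
  shows "\<exists>s' t. run (compile_list as) s = Some (s', t) \<and> t \<le> cost as \<and>
           (\<forall>c. c \<notin> temps \<longrightarrow> s' c = exec as s0 c)"
  using assms
proof (induction as arbitrary: s s0)
  case Nil
  then show ?case by simp
next
  case (Cons a as)
  obtain c e where a: "a = (c, e)" by (cases a)
  have adm: "c \<notin> temps" "div_free e" "reads e \<inter> temps = {}" "admissible as"
    using Cons.prems(1) by (auto simp: a)
  obtain s1 t1 where 1: "run (compile 0 e) s = Some (s1, t1)" "t1 \<le> 4 * esize e"
    "s1 (tmp 0) = ev s e" "\<forall>c. c \<notin> tmp ` {0..} \<longrightarrow> s1 c = s c"
    using run_compile[OF adm(2,3)] by blast
  have off: "s1 c' = s0 c'" if "c' \<notin> temps" for c'
    using 1(4) Cons.prems(2)[OF that] that by (auto simp: temps_def)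
  have e: "ev s e = ev s0 e"
    using adm(3) Cons.prems(2) by (intro ev_cong) auto
  define s2 where "s2 = s1(tmp 1 := 0, c := ev s0 e)"
  have "s2 c' = (s0(c := ev s0 e)) c'" if "c' \<notin> temps" for c'
    using off[OF that] that by (auto simp: s2_def)
  from Cons.IH[OF adm(4), of s2, OF this]
  obtain s3 t3 where 3: "run (compile_list as) s2 = Some (s3, t3)" "t3 \<le> cost as"
    "\<forall>c'. c' \<notin> temps \<longrightarrow> s3 c' = exec as (s0(c := ev s0 e)) c'"
    by blast
  have "run (Seq (compile 0 e) (Seq (Const (tmp 1) 0) (Arith Add c (tmp 0) (tmp 1)))) s
      = Some (s2, t1 + 2)"
    using 1(1,3) e by (simp add: s2_def)
  then show ?case
    using 1(2) 3 by (simp add: a)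
qed

text \<open>No target is read by the expression of another assignment, so running the list one by
  one has the effect of a simultaneous assignment. An expression may read its own target, which
  covers updates in place.\<close>

lemma exec_par:
  assumes "distinct xs" "inj_on g (set xs)"
    and "\<And>i j. i \<in> set xs \<Longrightarrow> j \<in> set xs \<Longrightarrow> g j \<in> reads (e i) \<Longrightarrow> i = j"
    and "i \<in> set xs"
  shows "exec (map (\<lambda>i. (g i, e i)) xs) s (g i) = ev s (e i)"
  using assms
proof (induction xs arbitrary: s)
  case (Cons x xs)
  show ?case
  proof (cases "i = x")
    case True
    have "g x \<notin> g ` set xs"
      using Cons.prems(1,2) by auto
    then show ?thesis
      using True by (simp add: exec_other image_image)
  next
    case False
    then have i: "i \<in> set xs" using Cons.prems(4) by simp
    have "exec (map (\<lambda>i. (g i, e i)) xs) (s(g x := ev s (e x))) (g i) = ev (s(g x := ev s (e x))) (e i)"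
      using Cons.prems i by (intro Cons.IH) auto
    also have "\<dots> = ev s (e i)"
      using Cons.prems(3)[OF Cons.prems(4), of x] False by (intro ev_cong) auto
    finally show ?thesis by simp
  qed
qed simp

fun esum :: "exp list \<Rightarrow> exp" where
  "esum [] = Cst 0"
| "esum (e # es) = Bin Add e (esum es)"

lemma ev_esum [simp]: "ev s (esum es) = sum_list (map (ev s) es)"
  by (induction es) auto

lemma reads_esum [simp]: "reads (esum es) = \<Union> (reads ` set es)"
  by (induction es) auto

lemma div_free_esum [simp]: "div_free (esum es) \<longleftrightarrow> (\<forall>e\<in>set es. div_free e)"
  by (induction es) auto

lemma esize_esum: "(\<And>e. e \<in> set es \<Longrightarrow> esize e \<le> k) \<Longrightarrow> esize (esum es) \<le> length es * (k + 1) + 1"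
proof (induction es)
  case (Cons e es)
  then have "esize e \<le> k" "esize (esum es) \<le> length es * (k + 1) + 1" by auto
  then show ?case by simp
qed simp


section \<open>Elimination for semidefinite systems\<close>

datatype 'x slot = Mat 'x 'x | Rhs 'x | Sol 'x | Row 'x | RowRhs

instance slot :: (countable) countable
  by countable_datatype

text \<open>Countability supplies the addresses: slots indexed by any countable type of unknowns are
  spread over the odd work cells.\<close>

definition wk :: "'x::countable slot \<Rightarrow> cell" where
  "wk a = Work (2 * to_nat a + 1)"

lemma wk_eq_iff [simp]: "wk a = wk b \<longleftrightarrow> a = b"
  by (simp add: wk_def)

lemma wk_notin_temps [simp]: "wk a \<notin> temps"
proof
  assume "wk a \<in> temps"
  then obtain d where "2 * to_nat a + 1 = 2 * d"
    by (auto simp: wk_def temps_def tmp_def)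
  then show False by presburger
qed

text \<open>Moore-Penrose inverse of a nonnegative scalar; semidefiniteness excludes negative
  pivots.\<close>

definition pinv :: "real \<Rightarrow> real" where
  "pinv a = (if 0 < a then 1 / a else 0)"

section \<open>Positive semidefinite matrices\<close>

definition psd :: "'x set \<Rightarrow> ('x \<Rightarrow> 'x \<Rightarrow> real) \<Rightarrow> bool" where
  "psd X M \<longleftrightarrow> (\<forall>z. 0 \<le> (\<Sum>y\<in>X. \<Sum>w\<in>X. z y * M y w * z w))"

lemma psd_diag_nonneg:
  assumes "finite X" "psd X M" "x \<in> X"
  shows "0 \<le> M x x"
proof -
  have "0 \<le> (\<Sum>y\<in>X. \<Sum>w\<in>X. of_bool (y = x) * M y w * of_bool (w = x))"
    using assms(2) by (simp add: psd_def)
  also have "\<dots> = (\<Sum>y\<in>X. of_bool (y = x) * M y x)"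
    using assms(1,3) by (intro sum.cong refl) (simp add: sum.If_cases of_bool_def if_distrib cong: if_cong)
  also have "\<dots> = M x x"
    using assms(1,3) by (simp add: of_bool_def if_distrib if_distribR cong: if_cong)
  finally show ?thesis .
qed

lemma quad_insert:
  fixes M :: "'x \<Rightarrow> 'x \<Rightarrow> real"
  assumes "finite X" "x \<notin> X" "\<And>y. y \<in> X \<Longrightarrow> M y x = M x y"
  shows "(\<Sum>y\<in>insert x X. \<Sum>w\<in>insert x X. z y * M y w * z w) =
    M x x * (z x)\<^sup>2 + 2 * z x * (\<Sum>w\<in>X. M x w * z w) + (\<Sum>y\<in>X. \<Sum>w\<in>X. z y * M y w * z w)"
proof -
  have "(\<Sum>y\<in>X. z y * M y x * z x) = z x * (\<Sum>w\<in>X. M x w * z w)"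
    unfolding sum_distrib_left using assms(3) by (intro sum.cong) (auto simp: mult_ac)
  moreover have "(\<Sum>w\<in>X. z x * M x w * z w) = z x * (\<Sum>w\<in>X. M x w * z w)"
    unfolding sum_distrib_left by (intro sum.cong) (auto simp: mult_ac)
  ultimately show ?thesis
    using assms(1,2) by (simp add: sum.distrib power2_eq_square algebra_simps)
qed

text \<open>With the diagonal entry zero, the quadratic form is affine in \<open>z x\<close>; a
  nonzero slope \<open>2 * M x y\<close> would drive it below zero.\<close>

lemma psd_zero_diag:
  fixes M :: "'x \<Rightarrow> 'x \<Rightarrow> real"
  assumes "finite X" "x \<notin> X" "psd (insert x X) M" "\<And>y. y \<in> X \<Longrightarrow> M y x = M x y"
    and "M x x = 0" "y \<in> X"
  shows "M x y = 0"
proof (rule ccontr)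
  assume nz: "M x y \<noteq> 0"
  \<comment> \<open>Solves \<open>2 * a * M x y + M y y = -1\<close>.\<close>
  define a where "a = - (1 + M y y) / (2 * M x y)"
  define z where "z = (\<lambda>w. if w = x then a else if w = y then 1 else (0::real))"
  have 1: "(\<Sum>w\<in>X. M x w * z w) = M x y"
  proof -
    have "(\<Sum>w\<in>X. M x w * z w) = (\<Sum>w\<in>X. if w = y then M x y else 0)"
      using assms(2) by (intro sum.cong) (auto simp: z_def)
    then show ?thesis using assms(1,6) by simp
  qed
  have 2: "(\<Sum>v\<in>X. \<Sum>w\<in>X. z v * M v w * z w) = M y y"
  proof -
    have "(\<Sum>w\<in>X. z v * M v w * z w) = (if v = y then M y y else 0)" if "v \<in> X" for v
    proof -
      have "(\<Sum>w\<in>X. z v * M v w * z w) = (\<Sum>w\<in>X. if w = y then z v * M v y else 0)"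
        using assms(2) by (intro sum.cong) (auto simp: z_def)
      then show ?thesis using assms(1,2,6) that by (auto simp: z_def)
    qed
    then have "(\<Sum>v\<in>X. \<Sum>w\<in>X. z v * M v w * z w) = (\<Sum>v\<in>X. if v = y then M y y else 0)"
      by (intro sum.cong) auto
    then show ?thesis using assms(1,6) by simp
  qed
  have "0 \<le> (\<Sum>v\<in>insert x X. \<Sum>w\<in>insert x X. z v * M v w * z w)"
    using assms(3) by (simp add: psd_def)
  also have "\<dots> = 2 * z x * M x y + M y y"
    using quad_insert[of X x M z] assms 1 2 by simp
  also have "\<dots> = -1"
    using nz by (simp add: z_def a_def field_simps)
  finally show False by simp
qed

text \<open>The new form at \<open>z\<close> is the old form at \<open>z\<close> extended by the
  value at \<open>x\<close> that minimises it, hence nonnegative. For a zero pivot this value is 0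
  and nothing is subtracted.\<close>

lemma psd_schur:
  fixes M :: "'x \<Rightarrow> 'x \<Rightarrow> real"
  assumes "finite X" "x \<notin> X" "psd (insert x X) M" "\<And>y. y \<in> X \<Longrightarrow> M y x = M x y"
  shows "psd X (\<lambda>y w. M y w - M y x * (pinv (M x x) * M x w))"
  unfolding psd_def
proof
  fix z :: "'x \<Rightarrow> real"
  define p where "p = pinv (M x x)"
  define r where "r = (\<Sum>w\<in>X. M x w * z w)"
  define z' where "z' = z(x := - p * r)"
  have r': "(\<Sum>w\<in>X. M x w * z' w) = r"
    unfolding r_def using assms(2) by (intro sum.cong) (auto simp: z'_def)
  have q': "(\<Sum>y\<in>X. \<Sum>w\<in>X. z' y * M y w * z' w) = (\<Sum>y\<in>X. \<Sum>w\<in>X. z y * M y w * z w)"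
    using assms(2) by (intro sum.cong) (auto simp: z'_def)
  \<comment> \<open>The one identity of the pseudoinverse that is used; it covers positive and zero
    pivots alike.\<close>
  have p: "M x x * p\<^sup>2 = p"
    by (auto simp: p_def pinv_def power2_eq_square)
  have "0 \<le> (\<Sum>y\<in>insert x X. \<Sum>w\<in>insert x X. z' y * M y w * z' w)"
    using assms(3) unfolding psd_def by blast
  also have "\<dots> = M x x * (- p * r)\<^sup>2 + 2 * (- p * r) * r + (\<Sum>y\<in>X. \<Sum>w\<in>X. z y * M y w * z w)"
    using quad_insert[of X x M z'] assms r' q' by (simp add: z'_def)
  also have "M x x * (- p * r)\<^sup>2 = p * r\<^sup>2"
    using p by (metis mult.assoc power2_minus power_mult_distrib mult_minus_left)
  also have "(p * r\<^sup>2 + 2 * (- p * r) * r + (\<Sum>y\<in>X. \<Sum>w\<in>X. z y * M y w * z w)) =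
    (\<Sum>y\<in>X. \<Sum>w\<in>X. z y * M y w * z w) - p * r * r"
    by (simp add: power2_eq_square)
  also have "p * r * r = (\<Sum>y\<in>X. \<Sum>w\<in>X. z y * (M y x * (p * M x w)) * z w)"
  proof -
    have "(\<Sum>y\<in>X. \<Sum>w\<in>X. z y * (M y x * (p * M x w)) * z w)
        = (\<Sum>y\<in>X. (M x y * z y) * (p * r))"
      unfolding r_def sum_distrib_left using assms(4) by (intro sum.cong) (auto simp: mult_ac)
    also have "\<dots> = r * (p * r)"
      unfolding r_def sum_distrib_right ..
    finally show ?thesis by (simp add: mult_ac)
  qed
  finally show "0 \<le> (\<Sum>y\<in>X. \<Sum>w\<in>X. z y * (M y w - M y x * (pinv (M x x) * M x w)) * z w)"
    by (simp add: sum_subtractf p_def algebra_simps)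
qed

section \<open>Elimination and back substitution as lists of assignments\<close>

abbreviation wv :: "'x::countable slot \<Rightarrow> exp" where
  "wv a \<equiv> Var (wk a)"

definition eliminate :: "'x::countable \<Rightarrow> 'x list \<Rightarrow> assignment list" where
  "eliminate x S =
     map (\<lambda>i. (wk (Mat (fst i) (snd i)), Bin Sub (wv (Mat (fst i) (snd i)))
        (Bin Mul (wv (Mat (fst i) x)) (Bin Mul (Pinv (wv (Mat x x))) (wv (Mat x (snd i)))))))
       (List.product S S) @
     map (\<lambda>y. (wk (Rhs y), Bin Sub (wv (Rhs y))
        (Bin Mul (wv (Mat y x)) (Bin Mul (Pinv (wv (Mat x x))) (wv (Rhs x)))))) S"

definition backsub :: "'x::countable \<Rightarrow> 'x list \<Rightarrow> assignment list" where
  "backsub x S = [(wk (Sol x), Bin Mul (Pinv (wv (Mat x x)))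
     (Bin Sub (wv (Rhs x)) (esum (map (\<lambda>y. Bin Mul (wv (Mat x y)) (wv (Sol y))) S))))]"

text \<open>Back substitution for \<open>x\<close> comes after the recursive call, so a single
  recursion performs the forward sweep on its way in and the backward sweep on its way out.\<close>

fun gauss :: "('x::countable \<Rightarrow> 'x \<Rightarrow> bool) \<Rightarrow> 'x list \<Rightarrow> assignment list" where
  "gauss Nb [] = []"
| "gauss Nb (x # xs) = eliminate x (filter (Nb x) xs) @ gauss Nb xs @ backsub x (filter (Nb x) xs)"

text \<open>
  \<open>G\<close> is a chordal graph containing the sparsity pattern and the list is a perfect elimination
  ordering of it, so that no fill-in occurs outside \<open>G\<close>.
\<close>

fun peo :: "('x \<Rightarrow> 'x \<Rightarrow> bool) \<Rightarrow> ('x \<Rightarrow> 'x \<Rightarrow> bool) \<Rightarrow> 'x list \<Rightarrow> bool" where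
  "peo G Nb [] \<longleftrightarrow> True"
| "peo G Nb (x # xs) \<longleftrightarrow>
     (\<forall>y\<in>set xs. G x y \<longrightarrow> Nb x y) \<and>
     (\<forall>y\<in>set xs. \<forall>z\<in>set xs. Nb x y \<and> Nb x z \<longrightarrow> G y z) \<and> peo G Nb xs"

lemma admissible_eliminate [simp]: "admissible (eliminate x S)"
  by (auto simp: eliminate_def admissible_def)

lemma admissible_backsub [simp]: "admissible (backsub x S)"
  by (auto simp: backsub_def admissible_def)

lemma admissible_gauss [simp]: "admissible (gauss Nb xs)"
  by (induction xs) auto

lemma exec_eliminate:
  fixes x y z :: "'x::countable"
  assumes "distinct S" "x \<notin> set S"
  shows "exec (eliminate x S) s (wk (Mat y z)) =
      (if y \<in> set S \<and> z \<in> set S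
       then s (wk (Mat y z)) - s (wk (Mat y x)) * (pinv (s (wk (Mat x x))) * s (wk (Mat x z)))
       else s (wk (Mat y z)))" (is ?A)
    and "exec (eliminate x S) s (wk (Rhs y)) =
      (if y \<in> set S
       then s (wk (Rhs y)) - s (wk (Mat y x)) * (pinv (s (wk (Mat x x))) * s (wk (Rhs x)))
       else s (wk (Rhs y)))" (is ?B)
proof -
  let ?m = "map (\<lambda>i. (wk (Mat (fst i) (snd i)), Bin Sub (wv (Mat (fst i) (snd i)))
        (Bin Mul (wv (Mat (fst i) x)) (Bin Mul (Pinv (wv (Mat x x))) (wv (Mat x (snd i)))))))
       (List.product S S)"
  let ?r = "map (\<lambda>y. (wk (Rhs y), Bin Sub (wv (Rhs y))
        (Bin Mul (wv (Mat y x)) (Bin Mul (Pinv (wv (Mat x x))) (wv (Rhs x)))))) S"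
  have m: "exec ?m s (wk (Mat y z)) =
      s (wk (Mat y z)) - s (wk (Mat y x)) * (pinv (s (wk (Mat x x))) * s (wk (Mat x z)))"
    if "y \<in> set S" "z \<in> set S" for y z
  proof -
    have "exec ?m s (wk (Mat (fst (y, z)) (snd (y, z)))) =
      ev s (Bin Sub (wv (Mat (fst (y, z)) (snd (y, z))))
        (Bin Mul (wv (Mat (fst (y, z)) x)) (Bin Mul (Pinv (wv (Mat x x))) (wv (Mat x (snd (y, z)))))))"
    proof (rule exec_par)
      show "distinct (List.product S S)" using assms by (simp add: distinct_product)
      show "inj_on (\<lambda>i. wk (Mat (fst i) (snd i))) (set (List.product S S))"
        by (auto simp: inj_on_def)
      show "(y, z) \<in> set (List.product S S)" using that by simp
      fix i j assume ij: "i \<in> set (List.product S S)" "j \<in> set (List.product S S)"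
        "wk (Mat (fst j) (snd j)) \<in> reads (Bin Sub (wv (Mat (fst i) (snd i)))
          (Bin Mul (wv (Mat (fst i) x)) (Bin Mul (Pinv (wv (Mat x x))) (wv (Mat x (snd i))))))"
      \<comment> \<open>Besides its own target an update reads only the pivot row and column, which
        are never written because \<open>x\<close> is not in \<open>S\<close>.\<close>
      then have "fst j \<noteq> x" "snd j \<noteq> x" using assms(2) by auto
      then show "i = j" using ij(3) by (auto simp: prod_eq_iff)
    qed
    then show ?thesis by (simp add: pinv_def)
  qed
  have m': "exec ?m s (wk a) = s (wk a)" if "\<And>y z. y \<in> set S \<Longrightarrow> z \<in> set S \<Longrightarrow> a \<noteq> Mat y z" for a :: "'x slot"
    using that by (intro exec_other) force
  have r: "exec ?r s' (wk (Rhs y)) =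
      s' (wk (Rhs y)) - s' (wk (Mat y x)) * (pinv (s' (wk (Mat x x))) * s' (wk (Rhs x)))"
    if "y \<in> set S" for y s'
  proof -
    have "exec ?r s' (wk (Rhs y)) = ev s' (Bin Sub (wv (Rhs y))
        (Bin Mul (wv (Mat y x)) (Bin Mul (Pinv (wv (Mat x x))) (wv (Rhs x)))))"
    proof (rule exec_par)
      fix i j assume ij: "i \<in> set S" "j \<in> set S" "wk (Rhs j) \<in> reads (Bin Sub (wv (Rhs i))
        (Bin Mul (wv (Mat i x)) (Bin Mul (Pinv (wv (Mat x x))) (wv (Rhs x)))))"
      then have "j \<noteq> x" using assms(2) by auto
      then show "i = j" using ij(3) by auto
    qed (use assms that in \<open>auto simp: inj_on_def\<close>)
    then show ?thesis by (simp add: pinv_def)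
  qed
  have r': "exec ?r s' (wk a) = s' (wk a)" if "\<And>y. y \<in> set S \<Longrightarrow> a \<noteq> Rhs y" for a :: "'x slot" and s'
    using that by (intro exec_other) force
  show ?A
    using m[of y z] m'[of "Mat y z"] by (auto simp: eliminate_def r')
  show ?B
  proof -
    have "exec ?m s (wk (Mat y x)) = s (wk (Mat y x))" "exec ?m s (wk (Mat x x)) = s (wk (Mat x x))"
      "exec ?m s (wk (Rhs x)) = s (wk (Rhs x))" "exec ?m s (wk (Rhs y)) = s (wk (Rhs y))"
      using assms(2) by (auto intro!: m')
    then show ?thesis
      using r[of y "exec ?m s"] r'[of "Rhs y" "exec ?m s"] by (cases "y \<in> set S") (auto simp: eliminate_def)
  qed
qed

text \<open>Shows that row and right-hand side of an eliminated \<open>x\<close> survive the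
  recursive call until its back substitution.\<close>

lemma gauss_frame:
  fixes xs :: "'x::countable list"
  shows
  "c \<in> fst ` set (gauss Nb xs) \<Longrightarrow>
   \<exists>y\<in>set xs. c = wk (Rhs y) \<or> c = wk (Sol y) \<or> (\<exists>z\<in>set xs. c = wk (Mat y z))"
proof (induction xs)
  case (Cons x xs)
  from Cons.prems consider "c \<in> fst ` set (eliminate x (filter (Nb x) xs))" | "c \<in> fst ` set (gauss Nb xs)"
    | "c \<in> fst ` set (backsub x (filter (Nb x) xs))" by auto
  then show ?case
  proof cases
    case 1
    then show ?thesis by (auto simp: eliminate_def)
  next
    case 2
    then show ?thesis using Cons.IH by auto
  next
    case 3
    then show ?thesis by (auto simp: backsub_def)
  qed
qed simp

lemma sum_filter_eq:
  fixes f :: "'x \<Rightarrow> real"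
  assumes "distinct xs" "\<And>y. y \<in> set xs \<Longrightarrow> \<not> P y \<Longrightarrow> f y = 0"
  shows "(\<Sum>y\<leftarrow>filter P xs. f y) = (\<Sum>y\<in>set xs. f y)"
proof -
  have "(\<Sum>y\<leftarrow>filter P xs. f y) = (\<Sum>y\<in>set (filter P xs). f y)"
    using assms(1) by (intro sum_list_distinct_conv_sum_set) auto
  also have "\<dots> = (\<Sum>y\<in>set xs. f y)"
    using assms by (intro sum.mono_neutral_left) auto
  finally show ?thesis .
qed

text \<open>Induction along the elimination order: the Schur complement is again semidefinite, its
  pattern stays in \<open>G\<close>, and \<open>u\<close> still solves the reduced system. The
  computed solution may differ from \<open>u\<close>, which only certifies consistency.\<close>

lemma gauss_correct:
  fixes xs :: "'x::countable list"
  assumes "distinct xs" "peo G Nb xs"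
    and "\<And>y z. y \<in> set xs \<Longrightarrow> z \<in> set xs \<Longrightarrow> s (wk (Mat y z)) = s (wk (Mat z y))"
    and "psd (set xs) (\<lambda>y z. s (wk (Mat y z)))"
    and "\<And>y z. y \<in> set xs \<Longrightarrow> z \<in> set xs \<Longrightarrow> s (wk (Mat y z)) \<noteq> 0 \<Longrightarrow> y \<noteq> z \<Longrightarrow> G y z"
    and "\<And>y. y \<in> set xs \<Longrightarrow> (\<Sum>z\<in>set xs. s (wk (Mat y z)) * u z) = s (wk (Rhs y))"
    and "y \<in> set xs"
  shows "(\<Sum>z\<in>set xs. s (wk (Mat y z)) * exec (gauss Nb xs) s (wk (Sol z))) = s (wk (Rhs y))"
  using assms
proof (induction xs arbitrary: s y)
  case (Cons x xs)
  define S where "S = filter (Nb x) xs"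
  define M where "M = (\<lambda>y z :: 'x. s (wk (Mat y z)))"
  define b where "b = (\<lambda>y :: 'x. s (wk (Rhs y)))"
  define p where "p = pinv (M x x)"
  define s1 where "s1 = exec (eliminate x S) s"
  define s2 where "s2 = exec (gauss Nb xs) s1"
  define v where "v = (\<lambda>y :: 'x. s2 (wk (Sol y)))"
  define r where "r = (\<Sum>z\<in>set xs. M x z * v z)"
  have x: "x \<notin> set xs" and dist: "distinct xs" using Cons.prems(1) by auto
  have S: "distinct S" "x \<notin> set S" using x dist by (auto simp: S_def)
  have sym: "M y z = M z y" if "y \<in> set (x # xs)" "z \<in> set (x # xs)" for y z
    using Cons.prems(3) that unfolding M_def by blast
  have zero: "M x y = 0" if "y \<in> set xs" "y \<notin> set S" for y
    using Cons.prems(2) Cons.prems(5)[of x y] that x by (auto simp: S_def M_def)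
  have zero': "M y x = 0" if "y \<in> set xs" "y \<notin> set S" for y
    using zero[OF that] sym[of x y] that by auto
  have psd: "psd (insert x (set xs)) M"
    using Cons.prems(4) by (simp add: M_def)
  have nonneg: "0 \<le> M x x"
    by (rule psd_diag_nonneg[OF _ psd]) auto
  have diag: "M x y = 0" if "M x x = 0" "y \<in> set xs" for y
    by (rule psd_zero_diag[OF _ x psd _ that]) (auto intro: sym)
  \<comment> \<open>Either the pivot is inverted or its column vanishes; this one equation replaces
    the case distinction when \<open>x\<close> is eliminated.\<close>
  have diag': "M y x * (p * M x x - 1) = 0" if "y \<in> set xs" for y
    using diag[OF _ that] sym[of x y] that nonneg
    by (cases "M x x = 0") (auto simp: p_def pinv_def)
  have cons: "M y x * u x + (\<Sum>z\<in>set xs. M y z * u z) = b y" if "y \<in> set (x # xs)" for y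
    using Cons.prems(6)[OF that] x by (simp add: M_def b_def)
  have M1: "s1 (wk (Mat y z)) = M y z - M y x * (p * M x z)" if "y \<in> set xs" "z \<in> set xs" for y z
    using zero[of z] zero'[of y] that
    by (auto simp: s1_def exec_eliminate[OF S] M_def p_def)
  have Mx: "s1 (wk (Mat x z)) = M x z" for z
    using S by (auto simp: s1_def exec_eliminate[OF S] M_def)
  have b1: "s1 (wk (Rhs y)) = b y - M y x * (p * b x)" if "y \<in> set xs" for y
    using zero'[of y] that
    by (auto simp: s1_def exec_eliminate[OF S] M_def p_def b_def)
  have bx: "s1 (wk (Rhs x)) = b x"
    using S by (auto simp: s1_def exec_eliminate[OF S] b_def)
  have IH: "(\<Sum>z\<in>set xs. s1 (wk (Mat y z)) * v z) = s1 (wk (Rhs y))" if "y \<in> set xs" for y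
    unfolding v_def s2_def
  proof (rule Cons.IH[OF dist _ _ _ _ _ that])
    show "peo G Nb xs" using Cons.prems(2) by simp
    show "s1 (wk (Mat y z)) = s1 (wk (Mat z y))" if "y \<in> set xs" "z \<in> set xs" for y z
      using that M1 sym by (simp add: mult_ac)
    have "psd (set xs) (\<lambda>y w. M y w - M y x * (pinv (M x x) * M x w))"
      by (rule psd_schur[OF _ x psd]) (auto intro: sym)
    then show "psd (set xs) (\<lambda>y z. s1 (wk (Mat y z)))"
      unfolding psd_def p_def[symmetric] by (simp add: M1)
    show "G y z" if "y \<in> set xs" "z \<in> set xs" "s1 (wk (Mat y z)) \<noteq> 0" "y \<noteq> z" for y z
    proof (cases "M y z = 0")
      case True
      \<comment> \<open>A new entry arises only between two later neighbours of \<open>x\<close>,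
        and these are adjacent in \<open>G\<close> by the elimination ordering.\<close>
      then have "M y x \<noteq> 0" "M x z \<noteq> 0"
        using that M1 by auto
      then have "y \<in> set S" "z \<in> set S"
        using zero zero' that by blast+
      then show ?thesis
        using Cons.prems(2) that by (auto simp: S_def)
    next
      case False
      then show ?thesis
        using Cons.prems(5)[of y z] that by (simp add: M_def)
    qed
    show "(\<Sum>z\<in>set xs. s1 (wk (Mat y z)) * u z) = s1 (wk (Rhs y))" if "y \<in> set xs" for y
    proof -
      have "(\<Sum>z\<in>set xs. s1 (wk (Mat y z)) * u z)
          = (\<Sum>z\<in>set xs. M y z * u z - M y x * p * (M x z * u z))"
        using that by (intro sum.cong) (auto simp: M1 algebra_simps)
      also have "\<dots> = (\<Sum>z\<in>set xs. M y z * u z) - M y x * p * (\<Sum>z\<in>set xs. M x z * u z)"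
        by (simp add: sum_subtractf sum_distrib_left)
      also have "\<dots> = (b y - M y x * u x) - M y x * p * (b x - M x x * u x)"
      proof -
        have "(\<Sum>z\<in>set xs. M y z * u z) = b y - M y x * u x"
          "(\<Sum>z\<in>set xs. M x z * u z) = b x - M x x * u x"
          using cons[of y] cons[of x] that by simp_all
        then show ?thesis by simp
      qed
      also have "\<dots> = b y - M y x * (p * b x) + M y x * (p * M x x - 1) * u x"
        by (simp add: algebra_simps)
      also have "\<dots> = s1 (wk (Rhs y))"
        using diag'[OF that] b1[OF that] by simp
      finally show ?thesis .
    qed
  qed
  have s2: "s2 (wk (Mat x z)) = M x z" "s2 (wk (Rhs x)) = b x" for z
  proof -
    have "a \<notin> fst ` set (gauss Nb xs)" if "a = wk (Mat x z) \<or> a = wk (Rhs x)" for a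
    proof
      assume "a \<in> fst ` set (gauss Nb xs)"
      from gauss_frame[OF this] show False using x that by auto
    qed
    then have "wk (Mat x z) \<notin> fst ` set (gauss Nb xs)" "wk (Rhs x) \<notin> fst ` set (gauss Nb xs)"
      by blast+
    then show "s2 (wk (Mat x z)) = M x z" "s2 (wk (Rhs x)) = b x"
      by (simp_all add: s2_def exec_other Mx bx)
  qed
  define s3 where "s3 = exec (gauss Nb (x # xs)) s"
  have s3: "s3 = s2(wk (Sol x) := p * (b x - r))"
  proof -
    have "(\<Sum>y\<leftarrow>S. M x y * v y) = r"
      unfolding S_def r_def using zero dist by (intro sum_filter_eq) (auto simp: S_def)
    then have "(\<Sum>y\<leftarrow>S. M x y * s2 (wk (Sol y))) = r"
      by (simp add: v_def)
    moreover have "s3 = exec (backsub x S) s2"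
      by (simp add: s3_def S_def[symmetric] s1_def[symmetric] s2_def[symmetric])
    ultimately show ?thesis
      by (simp add: backsub_def s2 p_def pinv_def o_def)
  qed
  have sol: "s3 (wk (Sol z)) = v z" if "z \<in> set xs" for z
    using that x by (auto simp: s3 v_def)
  have "(\<Sum>z\<in>set (x # xs). M y z * s3 (wk (Sol z))) = M y x * (p * (b x - r)) + (\<Sum>z\<in>set xs. M y z * v z)"
    using x sol by (simp add: s3)
  also have "\<dots> = b y"
  proof (cases "y = x")
    case True
    \<comment> \<open>A zero pivot has a zero row, and consistency then forces a zero right-hand
      side, so setting the unknown to 0 is correct.\<close>
    have "M x x = 0 \<Longrightarrow> r = 0 \<and> b x = 0"
      using diag cons[of x] by (simp add: r_def)
    then show ?thesis
      using True nonneg by (cases "M x x = 0") (auto simp: p_def pinv_def r_def[symmetric])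
  next
    case False
    then have y: "y \<in> set xs" using Cons.prems(7) by simp
    have "(\<Sum>z\<in>set xs. M y z * v z)
        = (\<Sum>z\<in>set xs. s1 (wk (Mat y z)) * v z + M y x * p * (M x z * v z))"
      using y by (intro sum.cong) (auto simp: M1 algebra_simps)
    also have "\<dots> = b y - M y x * (p * b x) + M y x * p * r"
      using IH[OF y] b1[OF y] by (simp add: sum.distrib sum_distrib_left r_def)
    finally show ?thesis by (simp add: algebra_simps)
  qed
  finally show ?case
    by (simp add: M_def b_def s3_def)
qed simp

text \<open>Each of the at most \<open>K * K + K\<close> updates costs 34 and the back substitution
  \<open>16 * K + 26\<close>; bounding \<open>K\<close> and 1 by \<open>K ^ 2\<close> gives 68 + 16
  + 26 = 110.\<close>

lemma cost_gauss:
  assumes "distinct xs" "\<And>x. x \<in> set xs \<Longrightarrow> card {y \<in> set xs. Nb x y} \<le> K" "1 \<le> K"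
  shows "cost (gauss Nb xs) \<le> length xs * (110 * K ^ 2)"
  using assms(1,2)
proof (induction xs)
  case (Cons x xs)
  define S where "S = filter (Nb x) xs"
  have "length S = card (set S)"
    using Cons.prems(1) by (metis S_def distinct_card distinct_filter distinct.simps(2))
  also have "\<dots> \<le> card {y \<in> set (x # xs). Nb x y}"
    by (intro card_mono) (auto simp: S_def)
  also have "\<dots> \<le> K" using Cons.prems(2)[of x] by simp
  finally have S: "length S \<le> K" .
  have "cost (eliminate x S) \<le> length (eliminate x S) * (4 * 8 + 2)"
    by (rule cost_le) (auto simp: eliminate_def)
  also have "\<dots> = (length S * length S + length S) * 34"
    by (simp add: eliminate_def)
  also have "\<dots> \<le> (K * K + K) * 34"
    using S by (intro mult_right_mono add_mono mult_mono) auto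
  finally have 1: "cost (eliminate x S) \<le> (K * K + K) * 34" .
  have "esize (esum (map (\<lambda>y. Bin Mul (wv (Mat x y)) (wv (Sol y))) S)) \<le> length S * (3 + 1) + 1"
    by (rule order_trans[OF esize_esum[where k = 3]]) auto
  then have 2: "cost (backsub x S) \<le> 16 * K + 26"
    using S by (simp add: backsub_def)
  have "card {y \<in> set xs. Nb z y} \<le> K" if "z \<in> set xs" for z
    using Cons.prems(2)[of z] that card_mono[of "{y \<in> set (x # xs). Nb z y}" "{y \<in> set xs. Nb z y}"]
    by (auto intro: order_trans)
  then have 3: "cost (gauss Nb xs) \<le> length xs * (110 * K ^ 2)"
    using Cons by simp
  have "(a + K) * 34 + (16 * K + 26) \<le> 110 * a" if "K \<le> a" "1 \<le> a" for a
    using that by simp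
  from this[of "K * K"] have "(K * K + K) * 34 + (16 * K + 26) \<le> 110 * K ^ 2"
    using assms(3) by (simp add: power2_eq_square)
  then show ?case
    using 1 2 3 by (simp add: S_def[symmetric])
qed simp


section \<open>Sparse least squares on a cluster tree\<close>

text \<open>Such expressions keep their value while the system is assembled and solved, since
  nothing but work memory is overwritten before the solution is copied out.\<close>

definition input_exp :: "exp \<Rightarrow> bool" where
  "input_exp e \<longleftrightarrow> div_free e \<and> reads e \<inter> range Work = {}"

lemma temps_subset_Work: "temps \<subseteq> range Work"
  by (auto simp: temps_def tmp_def)

lemma wk_in_Work [simp]: "wk a \<in> range Work"
  by (simp add: wk_def)

lemma ev_input_cong:
  assumes "input_exp e" "\<And>c. c \<notin> range Work \<Longrightarrow> s c = s' c"
  shows "ev s e = ev s' e"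
  using assms by (intro ev_cong) (auto simp: input_exp_def)

text \<open>Cluster, coefficients on the cluster (read as zero elsewhere), right-hand side.\<close>

type_synonym 'x row = "'x list \<times> ('x \<Rightarrow> exp) \<times> exp"

definition row_coeff :: "(cell \<Rightarrow> real) \<Rightarrow> 'x row \<Rightarrow> 'x \<Rightarrow> real" where
  "row_coeff s r x = (if x \<in> set (fst r) then ev s (fst (snd r) x) else 0)"

definition row_rhs :: "(cell \<Rightarrow> real) \<Rightarrow> 'x row \<Rightarrow> real" where
  "row_rhs s r = ev s (snd (snd r))"

definition input_row :: "'x row \<Rightarrow> bool" where
  "input_row r \<longleftrightarrow> distinct (fst r) \<and> (\<forall>x\<in>set (fst r). input_exp (fst (snd r) x)) \<and> input_exp (snd (snd r))"

text \<open>Buffering the row means that every coefficient is evaluated once; \<open>row_add\<close>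
  multiplies stored values. Otherwise a coefficient of size O(w) would be recomputed for each
  product, at O(w^4) per node.\<close>

definition row_load :: "'x::countable row \<Rightarrow> assignment list" where
  "row_load r = map (\<lambda>y. (wk (Row y), fst (snd r) y)) (fst r) @ [(wk (RowRhs :: 'x slot), snd (snd r))]"

definition row_add :: "'x::countable list \<Rightarrow> assignment list" where
  "row_add C =
     map (\<lambda>i. (wk (Mat (fst i) (snd i)),
        Bin Add (wv (Mat (fst i) (snd i))) (Bin Mul (wv (Row (fst i))) (wv (Row (snd i))))))
       (List.product C C) @
     map (\<lambda>y. (wk (Rhs y), Bin Add (wv (Rhs y)) (Bin Mul (wv (Row y)) (wv (RowRhs :: 'x slot))))) C"

definition row_block :: "'x::countable row \<Rightarrow> assignment list" where
  "row_block r = row_load r @ row_add (fst r)"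

lemma row_block_targets: "c \<in> fst ` set (row_block r) \<Longrightarrow> c \<in> range Work"
  by (auto simp: row_block_def row_load_def row_add_def)

lemma input_exp_admissible: "input_exp e \<Longrightarrow> div_free e \<and> reads e \<inter> temps = {}"
  using temps_subset_Work by (auto simp: input_exp_def)

lemma admissible_row_block [simp]: "input_row r \<Longrightarrow> admissible (row_block r)"
  using input_exp_admissible
  by (auto simp: row_block_def row_load_def row_add_def admissible_def input_row_def)

lemma exec_row_load:
  fixes r :: "'x::countable row"
  assumes "input_row r"
  shows "y \<in> set (fst r) \<Longrightarrow> exec (row_load r) s (wk (Row y)) = row_coeff s r y"
    and "exec (row_load r) s (wk (RowRhs :: 'x slot)) = row_rhs s r"
    and "\<And>a :: 'x slot. (\<And>y. a \<noteq> Row y) \<Longrightarrow> a \<noteq> RowRhs \<Longrightarrow> exec (row_load r) s (wk a) = s (wk a)"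
proof -
  let ?m = "map (\<lambda>y. (wk (Row y), fst (snd r) y)) (fst r)"
  have in1: "input_exp (fst (snd r) y)" if "y \<in> set (fst r)" for y
    using assms that by (simp add: input_row_def)
  have m: "exec ?m s (wk (Row y)) = ev s (fst (snd r) y)" if "y \<in> set (fst r)" for y
  proof (rule exec_par)
    show "distinct (fst r)" using assms by (simp add: input_row_def)
    show "inj_on (\<lambda>y. wk (Row y)) (set (fst r))" by (auto simp: inj_on_def)
    fix i j :: 'x assume "i \<in> set (fst r)" "wk (Row j) \<in> reads (fst (snd r) i)"
    then show "i = j" using in1[of i] wk_in_Work unfolding input_exp_def by blast
  qed fact
  show "exec (row_load r) s (wk (Row y)) = row_coeff s r y" if "y \<in> set (fst r)"
    using m[OF that] that by (simp add: row_load_def row_coeff_def)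
  have "exec ?m s c = s c" if "c \<notin> range Work" for c
    using that by (intro exec_other) auto
  moreover have "input_exp (snd (snd r))" using assms by (simp add: input_row_def)
  ultimately have "ev (exec ?m s) (snd (snd r)) = ev s (snd (snd r))"
    by (intro ev_input_cong) auto
  then show "exec (row_load r) s (wk (RowRhs :: 'x slot)) = row_rhs s r"
    by (simp add: row_load_def row_rhs_def)
  show "exec (row_load r) s (wk a) = s (wk a)" if "\<And>y. a \<noteq> Row y" "a \<noteq> RowRhs" for a :: "'x slot"
    using that by (intro exec_other) (auto simp: row_load_def)
qed

lemma exec_row_add:
  fixes y z :: "'x::countable"
  assumes "distinct C"
  shows "exec (row_add C) s (wk (Mat y z)) = s (wk (Mat y z)) +
      (if y \<in> set C \<and> z \<in> set C then s (wk (Row y)) * s (wk (Row z)) else 0)" (is ?A)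
    and "exec (row_add C) s (wk (Rhs y)) = s (wk (Rhs y)) +
      (if y \<in> set C then s (wk (Row y)) * s (wk (RowRhs :: 'x slot)) else 0)" (is ?B)
proof -
  let ?e = "\<lambda>i. Bin Add (wv (Mat (fst i) (snd i))) (Bin Mul (wv (Row (fst i))) (wv (Row (snd i))))"
  let ?e' = "\<lambda>y :: 'x. Bin Add (wv (Rhs y)) (Bin Mul (wv (Row y)) (wv (RowRhs :: 'x slot)))"
  let ?m = "map (\<lambda>i. (wk (Mat (fst i) (snd i)), ?e i)) (List.product C C)"
  let ?r = "map (\<lambda>y. (wk (Rhs y), ?e' y)) C"
  have m: "exec ?m s (wk (Mat y z)) = s (wk (Mat y z)) + s (wk (Row y)) * s (wk (Row z))"
    if "y \<in> set C" "z \<in> set C"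
  proof -
    have "exec ?m s (wk (Mat (fst (y, z)) (snd (y, z)))) = ev s (?e (y, z))"
    proof (rule exec_par)
      show "distinct (List.product C C)" using assms by (simp add: distinct_product)
      show "inj_on (\<lambda>i. wk (Mat (fst i) (snd i))) (set (List.product C C))"
        by (auto simp: inj_on_def)
      show "(y, z) \<in> set (List.product C C)" using that by simp
    qed (auto simp: prod_eq_iff)
    then show ?thesis by simp
  qed
  have m': "exec ?m s (wk a) = s (wk a)" if "\<And>y z. y \<in> set C \<Longrightarrow> z \<in> set C \<Longrightarrow> a \<noteq> Mat y z" for a :: "'x slot"
    using that by (intro exec_other) force
  have r: "exec ?r s' (wk (Rhs y)) = s' (wk (Rhs y)) + s' (wk (Row y)) * s' (wk (RowRhs :: 'x slot))"
    if "y \<in> set C" for s'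
  proof -
    have "exec ?r s' (wk (Rhs y)) = ev s' (?e' y)"
      by (rule exec_par) (use assms that in \<open>auto simp: inj_on_def\<close>)
    then show ?thesis by simp
  qed
  have r': "exec ?r s' (wk a) = s' (wk a)" if "\<And>y. y \<in> set C \<Longrightarrow> a \<noteq> Rhs y" for a :: "'x slot" and s'
    using that by (intro exec_other) force
  show ?A
    using m m'[of "Mat y z"] r'[of "Mat y z" "exec ?m s"]
    by (cases "y \<in> set C \<and> z \<in> set C") (auto simp: row_add_def)
  have "exec ?m s (wk (Row y)) = s (wk (Row y))" "exec ?m s (wk (Rhs y)) = s (wk (Rhs y))"
    "exec ?m s (wk (RowRhs :: 'x slot)) = s (wk (RowRhs :: 'x slot))"
    by (auto intro!: m')
  then show ?B
    using r[of "exec ?m s"] r'[of "Rhs y" "exec ?m s"]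
    by (cases "y \<in> set C") (auto simp: row_add_def)
qed

lemma exec_row_block:
  fixes r :: "'x::countable row"
  assumes "input_row r"
  shows "exec (row_block r) s (wk (Mat y z)) = s (wk (Mat y z)) + row_coeff s r y * row_coeff s r z"
    and "exec (row_block r) s (wk (Rhs y)) = s (wk (Rhs y)) + row_coeff s r y * row_rhs s r"
  using assms exec_row_load[OF assms]
  by (auto simp: row_block_def exec_row_add input_row_def row_coeff_def)

text \<open>Blocks write work cells and coefficients read input cells, so every block sees the
  coefficients of the initial store and the rank-one contributions simply add up.\<close>

lemma exec_row_blocks:
  fixes rs :: "'x::countable row list"
  assumes "\<And>r. r \<in> set rs \<Longrightarrow> input_row r"
  shows "exec (concat (map row_block rs)) s (wk (Mat y z)) =
      s (wk (Mat y z)) + (\<Sum>r\<leftarrow>rs. row_coeff s r y * row_coeff s r z)"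
    and "exec (concat (map row_block rs)) s (wk (Rhs y)) =
      s (wk (Rhs y)) + (\<Sum>r\<leftarrow>rs. row_coeff s r y * row_rhs s r)"
proof -
  have "exec (concat (map row_block rs)) s (wk (Mat y z)) =
      s (wk (Mat y z)) + (\<Sum>r\<leftarrow>rs. row_coeff s r y * row_coeff s r z) \<and>
    exec (concat (map row_block rs)) s (wk (Rhs y)) =
      s (wk (Rhs y)) + (\<Sum>r\<leftarrow>rs. row_coeff s r y * row_rhs s r)"
    using assms
  proof (induction rs arbitrary: s)
    case (Cons r rs)
    define s1 where "s1 = exec (row_block r) s"
    have "s1 c = s c" if "c \<notin> range Work" for c
      unfolding s1_def using row_block_targets that by (intro exec_other) blast
    then have e: "ev s1 e = ev s e" if "input_exp e" for e
      using that by (intro ev_input_cong) auto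
    have "row_coeff s1 r' x = row_coeff s r' x" "row_rhs s1 r' = row_rhs s r'" if "r' \<in> set rs" for r' x
      using Cons.prems[of r'] that e by (auto simp: row_coeff_def row_rhs_def input_row_def)
    then have "(\<Sum>r\<leftarrow>rs. row_coeff s1 r y * row_coeff s1 r z) = (\<Sum>r\<leftarrow>rs. row_coeff s r y * row_coeff s r z)"
      "(\<Sum>r\<leftarrow>rs. row_coeff s1 r y * row_rhs s1 r) = (\<Sum>r\<leftarrow>rs. row_coeff s r y * row_rhs s r)"
      by (auto intro!: arg_cong[where f = sum_list] map_cong)
    then show ?case
      using Cons.IH[of s1] Cons.prems exec_row_block[of r s]
      by (simp add: s1_def[symmetric])
  qed simp
  then show "exec (concat (map row_block rs)) s (wk (Mat y z)) =
      s (wk (Mat y z)) + (\<Sum>r\<leftarrow>rs. row_coeff s r y * row_coeff s r z)"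
    and "exec (concat (map row_block rs)) s (wk (Rhs y)) =
      s (wk (Rhs y)) + (\<Sum>r\<leftarrow>rs. row_coeff s r y * row_rhs s r)" by auto
qed

lemma cost_row_block:
  assumes "length (fst r) \<le> K" "\<And>x. x \<in> set (fst r) \<Longrightarrow> esize (fst (snd r) x) \<le> L" "esize (snd (snd r)) \<le> L"
    and "1 \<le> K"
  shows "cost (row_block r) \<le> 2 * K * (4 * L + 2) + 44 * K ^ 2"
proof -
  have "cost (row_load r) \<le> length (row_load r) * (4 * L + 2)"
    using assms by (intro cost_le) (auto simp: row_load_def)
  \<comment> \<open>\<open>K\<close> coefficients and one right-hand side; \<open>K + 1\<close> is
    at most \<open>2 * K\<close>.\<close>
  also have "\<dots> \<le> (2 * K) * (4 * L + 2)"
    using assms by (intro mult_right_mono) (auto simp: row_load_def)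
  finally have 1: "cost (row_load r) \<le> 2 * K * (4 * L + 2)" .
  have "cost (row_add (fst r)) \<le> length (row_add (fst r)) * (4 * 5 + 2)"
    by (intro cost_le) (auto simp: row_add_def)
  also have "\<dots> = (length (fst r) * length (fst r) + length (fst r)) * 22"
    by (simp add: row_add_def)
  also have "\<dots> \<le> (K * K + K * K) * 22"
  proof -
    have "length (fst r) * length (fst r) \<le> K * K" using assms(1) by (intro mult_le_mono)
    moreover have "K \<le> K * K" using assms(4) by simp
    then have "length (fst r) \<le> K * K" using assms(1) by linarith
    ultimately show ?thesis by (intro mult_right_mono add_mono) auto
  qed
  finally show ?thesis using 1 by (simp add: row_block_def power2_eq_square)
qed

section \<open>Normal equations\<close>

lemma sum_list_nonneg_eq_0:
  fixes f :: "'a \<Rightarrow> real"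
  assumes "(\<Sum>x\<leftarrow>xs. f x) = 0" "\<And>x. x \<in> set xs \<Longrightarrow> 0 \<le> f x" "x \<in> set xs"
  shows "f x = 0"
  using assms
proof (induction xs)
  case (Cons y ys)
  have "0 \<le> (\<Sum>x\<leftarrow>ys. f x)" "0 \<le> f y"
    using Cons.prems(2) by (auto intro!: sum_list_nonneg)
  then have "f y = 0" "(\<Sum>x\<leftarrow>ys. f x) = 0"
    using Cons.prems(1) by (simp_all add: add_nonneg_eq_0_iff)
  then show ?case using Cons by auto
qed simp

lemma sum_sum_list_swap:
  "(\<Sum>x\<in>X. \<Sum>r\<leftarrow>rs. f x r) = (\<Sum>r\<leftarrow>rs. \<Sum>x\<in>X. f x r)" for f :: "'a \<Rightarrow> 'b \<Rightarrow> real"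
  by (induction rs) (simp_all add: sum.distrib)

text \<open>The defect of \<open>v\<close> is orthogonal to all columns of \<open>a\<close> by the
  normal equations, and it is itself a combination of these columns because \<open>u\<close> solves
  the system exactly. So its sum of squares is zero.\<close>

lemma normal_equations:
  fixes a :: "'r \<Rightarrow> 'x \<Rightarrow> real"
  assumes "finite X"
    and u: "\<And>r. r \<in> set rs \<Longrightarrow> (\<Sum>x\<in>X. a r x * u x) = \<beta> r"
    and v: "\<And>y. y \<in> X \<Longrightarrow> (\<Sum>z\<in>X. (\<Sum>r\<leftarrow>rs. a r y * a r z) * v z) = (\<Sum>r\<leftarrow>rs. a r y * \<beta> r)"
    and "r \<in> set rs"
  shows "(\<Sum>x\<in>X. a r x * v x) = \<beta> r"
proof -
  define d where "d r = (\<Sum>x\<in>X. a r x * v x) - \<beta> r" for r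
  have 1: "(\<Sum>r\<leftarrow>rs. a r y * d r) = 0" if "y \<in> X" for y
  proof -
    have "(\<Sum>z\<in>X. (\<Sum>r\<leftarrow>rs. a r y * a r z) * v z) = (\<Sum>r\<leftarrow>rs. a r y * (\<Sum>z\<in>X. a r z * v z))"
      by (simp add: sum_list_mult_const[symmetric] sum_sum_list_swap sum_distrib_left mult.assoc)
    then have "(\<Sum>r\<leftarrow>rs. a r y * (\<Sum>z\<in>X. a r z * v z)) - (\<Sum>r\<leftarrow>rs. a r y * \<beta> r) = 0"
      using v[OF that] by simp
    then show ?thesis
      by (simp add: d_def right_diff_distrib sum_list_subtractf)
  qed
  have "(\<Sum>r\<leftarrow>rs. (d r)\<^sup>2) = (\<Sum>r\<leftarrow>rs. \<Sum>y\<in>X. a r y * d r * (v y - u y))"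
  proof (intro arg_cong[where f = sum_list] map_cong refl)
    fix r assume "r \<in> set rs"
    then have "d r = (\<Sum>x\<in>X. a r x * (v x - u x))"
      using u[of r] by (simp add: d_def right_diff_distrib sum_subtractf)
    then have "(d r)\<^sup>2 = d r * (\<Sum>x\<in>X. a r x * (v x - u x))"
      by (simp add: power2_eq_square)
    then show "(d r)\<^sup>2 = (\<Sum>y\<in>X. a r y * d r * (v y - u y))"
      by (simp add: sum_distrib_left mult_ac)
  qed
  also have "\<dots> = (\<Sum>y\<in>X. (\<Sum>r\<leftarrow>rs. a r y * d r) * (v y - u y))"
    by (simp only: sum_list_mult_const[symmetric] sum_sum_list_swap)
  also have "\<dots> = 0" using 1 by simp
  finally have "(d r)\<^sup>2 = 0"
    using assms(4) by (intro sum_list_nonneg_eq_0[of "\<lambda>r. (d r)\<^sup>2"]) auto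
  then show ?thesis by (simp add: d_def)
qed

lemma psd_gram:
  fixes a :: "'r \<Rightarrow> 'x \<Rightarrow> real"
  shows "psd X (\<lambda>y z. \<Sum>r\<leftarrow>rs. a r y * a r z)"
  unfolding psd_def
proof
  fix z :: "'x \<Rightarrow> real"
  have "(\<Sum>y\<in>X. \<Sum>w\<in>X. z y * (\<Sum>r\<leftarrow>rs. a r y * a r w) * z w)
      = (\<Sum>r\<leftarrow>rs. \<Sum>y\<in>X. \<Sum>w\<in>X. (z y * a r y) * (a r w * z w))"
    by (simp add: sum_list_const_mult[symmetric] sum_list_mult_const[symmetric] sum_sum_list_swap mult_ac)
  also have "\<dots> = (\<Sum>r\<leftarrow>rs. (\<Sum>y\<in>X. a r y * z y)\<^sup>2)"
    by (simp add: power2_eq_square sum_product mult_ac)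
  also have "0 \<le> \<dots>" by (intro sum_list_nonneg) auto
  finally show "0 \<le> (\<Sum>y\<in>X. \<Sum>w\<in>X. z y * (\<Sum>r\<leftarrow>rs. a r y * a r w) * z w)" .
qed

text \<open>The hypothesis on \<open>apex\<close> is the running intersection property in rooted
  form: a node that is not the apex of \<open>x\<close> passes \<open>x\<close> to its parent. Two
  unknowns in a common cluster can be followed upward together to the apex with the larger index, so
  the later neighbours of \<open>x\<close> all lie in the cluster of its apex.\<close>

lemma peo_clusters:
  fixes C :: "nat \<Rightarrow> 'x set"
  assumes q: "\<And>t. t < m \<Longrightarrow> 0 < t \<Longrightarrow> q t < t"
    and apex: "\<And>t x. t < m \<Longrightarrow> x \<in> C t \<Longrightarrow> t = apex x \<or> 0 < t \<and> x \<in> C (q t)"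
    and "sorted_wrt (\<lambda>x y. apex y \<le> apex x) xs" "set xs \<subseteq> (\<Union>t<m. C t)"
  shows "peo (\<lambda>x y. \<exists>t<m. x \<in> C t \<and> y \<in> C t) (\<lambda>x y. y \<in> C (apex x)) xs"
  using assms(3,4)
proof (induction xs)
  case (Cons x xs)
  have le: "apex x \<le> t \<and> apex x < m \<and> x \<in> C (apex x)" if "t < m" "x \<in> C t" for t x
    using that
  proof (induction t rule: less_induct)
    case (less t)
    show ?case
    proof (cases "t = apex x")
      case False
      then have "0 < t" "x \<in> C (q t)" using apex[OF less.prems] by auto
      then show ?thesis using less.IH[of "q t"] q[of t] less.prems by force
    qed (use less.prems in auto)
  qed
  have nb: "y \<in> C (apex x)" if "t < m" "x \<in> C t" "y \<in> C t" "apex y \<le> apex x" for t y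
    using that(1-3)
  proof (induction t rule: less_induct)
    case (less t)
    show ?case
    proof (cases "t = apex x")
      case False
      then have "0 < t" "x \<in> C (q t)" using apex[of t x] less.prems by auto
      \<comment> \<open>The apex of \<open>y\<close> is no larger, so \<open>t\<close> is the apex
        of neither and both move on to \<open>q t\<close>.\<close>
      moreover have "apex x < t" using False le[of t x] less.prems by auto
      then have "t \<noteq> apex y" using that(4) by simp
      then have "y \<in> C (q t)" using apex[of t y] less.prems by auto
      ultimately show ?thesis using less.IH[of "q t"] q[of t] less.prems by force
    qed (use less.prems in auto)
  qed
  obtain t where "t < m" "x \<in> C t" using Cons.prems(2) by auto
  then have "apex x < m" using le by blast
  then show ?case
    using Cons nb by auto
qed simp

text \<open>There are at most \<open>m * K\<close> rows and \<open>m * K\<close> unknowns. In the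
  bound, 154 is 44 for accumulating the products of a row plus 110 for eliminating an unknown. Work
  memory has to start at zero because the Gram matrix is accumulated in place.\<close>

lemma sparse_solver:
  fixes C :: "nat \<Rightarrow> 'x::countable set" and rws :: "nat \<Rightarrow> (('x \<Rightarrow> exp) \<times> exp) list"
  assumes q: "\<And>t. t < m \<Longrightarrow> 0 < t \<Longrightarrow> q t < t"
    and apex: "\<And>t x. t < m \<Longrightarrow> x \<in> C t \<Longrightarrow> t = apex x \<or> 0 < t \<and> x \<in> C (q t)"
    and C: "\<And>t. t < m \<Longrightarrow> finite (C t) \<and> card (C t) \<le> K" and K: "1 \<le> K"
    and len: "\<And>t. t < m \<Longrightarrow> length (rws t) \<le> K"
    and inp: "\<And>t a \<beta> x. t < m \<Longrightarrow> (a, \<beta>) \<in> set (rws t) \<Longrightarrow> x \<in> C t \<Longrightarrow> input_exp (a x) \<and> esize (a x) \<le> L"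
    and inp': "\<And>t a \<beta>. t < m \<Longrightarrow> (a, \<beta>) \<in> set (rws t) \<Longrightarrow> input_exp \<beta> \<and> esize \<beta> \<le> L"
  shows "\<exists>as. admissible as \<and> cost as \<le> m * (2 * K\<^sup>2 * (4 * L + 2) + 154 * K ^ 3) \<and>
    (\<forall>s. (\<forall>i. s (Work i) = 0) \<longrightarrow>
      (\<exists>u. \<forall>t<m. \<forall>(a, \<beta>)\<in>set (rws t). (\<Sum>x\<in>C t. ev s (a x) * u x) = ev s \<beta>) \<longrightarrow>
      (\<forall>t<m. \<forall>(a, \<beta>)\<in>set (rws t). (\<Sum>x\<in>C t. ev s (a x) * exec as s (wk (Sol x))) = ev s \<beta>))"
proof -
  define X where "X = (\<Union>t<m. C t)"
  have finX: "finite X" using C by (auto simp: X_def)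
  have "\<forall>t<m. \<exists>l. set l = C t \<and> distinct l" using C finite_distinct_list by metis
  then obtain Cl where Cl: "\<And>t. t < m \<Longrightarrow> set (Cl t) = C t \<and> distinct (Cl t)" by metis
  obtain l where l: "set l = X" "distinct l" using finX finite_distinct_list by metis
  \<comment> \<open>Apexes with larger index come first, which eliminates the leaves before the
    root.\<close>
  define xs where "xs = rev (sort_key apex l)"
  have xs: "set xs = X" "distinct xs" using l by (auto simp: xs_def)
  have "sorted_wrt (\<lambda>x y. apex x \<le> apex y) (sort_key apex l)"
    by (metis sorted_map sorted_sort_key)
  then have sorted: "sorted_wrt (\<lambda>x y. apex y \<le> apex x) xs"
    by (simp add: xs_def sorted_wrt_rev)
  define Nb where "Nb = (\<lambda>x y. y \<in> C (apex x))"
  define G where "G = (\<lambda>x y. \<exists>t<m. x \<in> C t \<and> y \<in> C t)"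
  have peo: "peo G Nb xs"
    unfolding G_def Nb_def by (rule peo_clusters[OF q apex sorted]) (auto simp: xs X_def)
  define rs where "rs = concat (map (\<lambda>t. map (\<lambda>r. (Cl t, r)) (rws t)) [0..<m])"
  have rs: "r \<in> set rs \<longleftrightarrow> (\<exists>t<m. \<exists>p\<in>set (rws t). r = (Cl t, p))" for r
    by (auto simp: rs_def)
  have input: "input_row r" if "r \<in> set rs" for r
    using that inp inp' Cl by (auto simp: rs input_row_def)
  define as where "as = concat (map row_block rs) @ gauss Nb xs"
  have adm: "admissible as" using input by (auto simp: as_def admissible_concat)
  have cost: "cost as \<le> m * (2 * K\<^sup>2 * (4 * L + 2) + 154 * K ^ 3)"
  proof -
    have "cost (concat (map row_block rs)) = (\<Sum>r\<leftarrow>rs. cost (row_block r))"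
      by (simp add: cost_concat o_def)
    also have "\<dots> \<le> (\<Sum>r\<leftarrow>rs. 2 * K * (4 * L + 2) + 44 * K ^ 2)"
    proof (intro sum_list_mono cost_row_block[OF _ _ _ K])
      fix r assume "r \<in> set rs"
      then obtain t p where t: "t < m" "p \<in> set (rws t)" "r = (Cl t, p)" by (auto simp: rs)
      show "length (fst r) \<le> K" using Cl[OF t(1)] C[OF t(1)] t(3) by (metis distinct_card fst_conv)
      show "esize (fst (snd r) x) \<le> L" if "x \<in> set (fst r)" for x
        using inp[OF t(1), of "fst p" "snd p" x] t that Cl[OF t(1)] by simp
      show "esize (snd (snd r)) \<le> L"
        using inp'[OF t(1), of "fst p" "snd p"] t by simp
    qed
    also have "\<dots> = length rs * (2 * K * (4 * L + 2) + 44 * K ^ 2)"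
      by (simp add: sum_list_triv)
    also have "length rs \<le> m * K"
    proof -
      have "length rs = (\<Sum>t<m. length (rws t))"
        by (simp add: rs_def length_concat o_def interv_sum_list_conv_sum_set_nat atLeast0LessThan)
      also have "\<dots> \<le> (\<Sum>t<m. K)" using len by (intro sum_mono) auto
      finally show ?thesis by simp
    qed
    then have "length rs * (2 * K * (4 * L + 2) + 44 * K ^ 2) \<le> m * K * (2 * K * (4 * L + 2) + 44 * K ^ 2)"
      by (rule mult_right_mono) simp
    finally have 1: "cost (concat (map row_block rs)) \<le> m * K * (2 * K * (4 * L + 2) + 44 * K ^ 2)" .
    have apex_less: "apex x < m" if "x \<in> X" for x
    proof -
      obtain t where "t < m" "x \<in> C t" using \<open>x \<in> X\<close> by (auto simp: X_def)
      then show ?thesis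
      proof (induction t rule: less_induct)
        case (less t)
        then show ?case using apex[of t x] q[of t] by (metis less_trans)
      qed
    qed
    have "card {y \<in> set xs. Nb x y} \<le> K" if "x \<in> set xs" for x
    proof -
      have "card {y \<in> set xs. Nb x y} \<le> card (C (apex x))"
        using C apex_less that xs by (intro card_mono) (auto simp: Nb_def)
      then show ?thesis using C[of "apex x"] apex_less that xs by simp
    qed
    then have "cost (gauss Nb xs) \<le> length xs * (110 * K ^ 2)"
      using xs K by (intro cost_gauss) auto
    also have "length xs \<le> m * K"
    proof -
      have "length xs = card X" using xs by (metis distinct_card)
      also have "\<dots> \<le> (\<Sum>t<m. card (C t))" unfolding X_def by (intro card_UN_le) auto
      also have "\<dots> \<le> (\<Sum>t<m. K)" using C by (intro sum_mono) auto
      finally show ?thesis by simp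
    qed
    then have "length xs * (110 * K ^ 2) \<le> m * K * (110 * K ^ 2)" by (rule mult_right_mono) simp
    finally show ?thesis using 1
      by (simp add: as_def algebra_simps power2_eq_square power3_eq_cube)
  qed
  have sol: "(\<Sum>x\<in>C t. ev s (a x) * exec as s (wk (Sol x))) = ev s \<beta>"
    if s: "\<forall>i. s (Work i) = 0"
      and u: "\<forall>t<m. \<forall>(a, \<beta>)\<in>set (rws t). (\<Sum>x\<in>C t. ev s (a x) * u x) = ev s \<beta>"
      and t: "t < m" "(a, \<beta>) \<in> set (rws t)" for s u t a \<beta>
  proof -
    define s1 where "s1 = exec (concat (map row_block rs)) s"
    define A :: "'x row \<Rightarrow> 'x \<Rightarrow> real" where "A = row_coeff s"
    define b :: "'x row \<Rightarrow> real" where "b = row_rhs s"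
    have M: "s1 (wk (Mat y z)) = (\<Sum>r\<leftarrow>rs. A r y * A r z)" for y z
      using exec_row_blocks(1)[of rs s y z] input s by (simp add: s1_def A_def wk_def)
    have R: "s1 (wk (Rhs y)) = (\<Sum>r\<leftarrow>rs. A r y * b r)" for y
      using exec_row_blocks(2)[of rs s y] input s by (simp add: s1_def A_def b_def wk_def)
    have local: "(\<Sum>x\<in>X. A (Cl t, (a, \<beta>)) x * w x) = (\<Sum>x\<in>C t. ev s (a x) * w x)"
      if "t < m" for t a \<beta> w
    proof -
      have "(\<Sum>x\<in>X. A (Cl t, (a, \<beta>)) x * w x) = (\<Sum>x\<in>C t. A (Cl t, (a, \<beta>)) x * w x)"
        using that finX Cl[OF that] by (intro sum.mono_neutral_right) (auto simp: X_def A_def row_coeff_def)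
      also have "\<dots> = (\<Sum>x\<in>C t. ev s (a x) * w x)"
        using Cl[OF that] by (intro sum.cong) (auto simp: A_def row_coeff_def)
      finally show ?thesis .
    qed
    have u': "(\<Sum>x\<in>X. A r x * u x) = b r" if r: "r \<in> set rs" for r
    proof -
      obtain t a \<beta> where "t < m" "(a, \<beta>) \<in> set (rws t)" "r = (Cl t, (a, \<beta>))"
        using r by (auto simp: rs)
      then show ?thesis using u local by (auto simp: b_def row_rhs_def)
    qed
    define v :: "'x \<Rightarrow> real" where "v x = exec (gauss Nb xs) s1 (wk (Sol x))" for x
    have "(\<Sum>z\<in>set xs. s1 (wk (Mat y z)) * v z) = s1 (wk (Rhs y))" if "y \<in> set xs" for y
      unfolding v_def
    proof (rule gauss_correct[OF xs(2) peo])
      show "s1 (wk (Mat y z)) = s1 (wk (Mat z y))" for y z :: 'x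
        by (simp add: M mult.commute)
      show "psd (set xs) (\<lambda>y z. s1 (wk (Mat y z)))"
        unfolding M by (rule psd_gram)
      show "G y z" if "s1 (wk (Mat y z)) \<noteq> 0" for y z :: 'x
      proof (rule ccontr)
        assume "\<not> G y z"
        \<comment> \<open>A product is nonzero only if both unknowns lie in the cluster of the row,
          and this is adjacency in \<open>G\<close>.\<close>
        then have "A r y * A r z = 0" if "r \<in> set rs" for r
          using that Cl by (auto simp: rs G_def A_def row_coeff_def)
        then have "(\<Sum>r\<leftarrow>rs. A r y * A r z) = (\<Sum>r\<leftarrow>rs. 0)"
          by (intro arg_cong[where f = sum_list] map_cong refl)
        then have "(\<Sum>r\<leftarrow>rs. A r y * A r z) = 0" by simp
        then show False using that M by simp
      qed
      show "(\<Sum>z\<in>set xs. s1 (wk (Mat y z)) * u z) = s1 (wk (Rhs y))" if "y \<in> set xs" for y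
      proof -
        have "(\<Sum>z\<in>X. s1 (wk (Mat y z)) * u z) = (\<Sum>r\<leftarrow>rs. A r y * (\<Sum>z\<in>X. A r z * u z))"
          by (simp add: M sum_list_mult_const[symmetric] sum_sum_list_swap sum_distrib_left mult.assoc)
        also have "\<dots> = (\<Sum>r\<leftarrow>rs. A r y * b r)"
          using u' by (simp cong: map_cong)
        finally show ?thesis by (simp add: R xs)
      qed
    qed fact
    then have "(\<Sum>x\<in>X. A (Cl t, (a, \<beta>)) x * v x) = b (Cl t, (a, \<beta>))"
      using t by (intro normal_equations[OF finX u']) (auto simp: M R xs rs)
    then show ?thesis
      using local[OF t(1)] by (simp add: b_def row_rhs_def v_def s1_def as_def)
  qed
  show ?thesis
  proof (intro exI[of _ as] conjI allI impI adm cost)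
    fix s t
    assume "\<forall>i. s (Work i) = 0" "t < m"
      and "\<exists>u. \<forall>t<m. \<forall>(a, \<beta>)\<in>set (rws t). (\<Sum>x\<in>C t. ev s (a x) * u x) = ev s \<beta>"
    then show "\<forall>(a, \<beta>)\<in>set (rws t). (\<Sum>x\<in>C t. ev s (a x) * exec as s (wk (Sol x))) = ev s \<beta>"
      using sol by (elim exE) (intro ballI case_prodI2; simp)
  qed
qed


section \<open>Rooted binary tree-decompositions\<close>

lemma rtrancl_distinct_path:
  assumes "(a, b) \<in> R\<^sup>*"
  shows "\<exists>xs. xs \<noteq> [] \<and> distinct xs \<and> hd xs = a \<and> last xs = b \<and> successively (\<lambda>i j. (i, j) \<in> R) xs"
  using assms
proof (induction rule: rtrancl_induct)
  case base
  show ?case by (intro exI[of _ "[a]"]) simp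
next
  case (step y z)
  then obtain xs where xs: "xs \<noteq> []" "distinct xs" "hd xs = a" "last xs = y"
    "successively (\<lambda>i j. (i, j) \<in> R) xs" by blast
  show ?case
  proof (cases "z \<in> set xs")
    case True
    \<comment> \<open>Loop erasure: the walk is cut at the earlier visit of its new endpoint.
      Acyclicity only speaks of cycles with distinct vertices, so paths must be simple.\<close>
    then obtain us vs where "xs = us @ z # vs" by (metis split_list)
    then show ?thesis
      using xs by (intro exI[of _ "us @ [z]"]) (auto simp: successively_append_iff hd_append)
  next
    case False
    then show ?thesis
      using xs step.hyps by (intro exI[of _ "xs @ [z]"]) (auto simp: successively_append_iff)
  qed
qed

lemma rtrancl_crossing:
  assumes "(a, b) \<in> R\<^sup>*" "a \<in> S" "b \<notin> S"
  shows "\<exists>x y. x \<in> S \<and> y \<notin> S \<and> (x, y) \<in> R"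
  using assms by (induction rule: rtrancl_induct) blast+

lemma successively_field:
  assumes "successively (\<lambda>i j. (i, j) \<in> R) xs" "length xs \<ge> 2"
  shows "set xs \<subseteq> Field R"
  using assms
proof (induction xs)
  case (Cons x xs)
  show ?case
  proof (cases xs)
    case (Cons y ys)
    then show ?thesis
      using Cons.IH Cons.prems by (cases ys) (auto simp: Field_def)
  qed (use Cons.prems in auto)
qed simp

text \<open>Connectedness gives an edge leaving the set enumerated so far; its outer end is
  appended.\<close>

lemma tree_enumeration:
  assumes "tree I F" "1 \<le> k" "k \<le> card I"
  shows "\<exists>xs. length xs = k \<and> distinct xs \<and> set xs \<subseteq> I \<and>
    (\<forall>t<k. 0 < t \<longrightarrow> (\<exists>s<t. (xs ! s, xs ! t) \<in> F))"
  using assms(2,3)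
proof (induction k rule: dec_induct)
  case base
  obtain a where "a \<in> I" using assms(1) by (auto simp: tree_def)
  then show ?case by (intro exI[of _ "[a]"]) auto
next
  case (step k)
  then obtain xs where xs: "length xs = k" "distinct xs" "set xs \<subseteq> I"
    "\<forall>t<k. 0 < t \<longrightarrow> (\<exists>s<t. (xs ! s, xs ! t) \<in> F)" by auto
  have "card (set xs) < card I" using xs step by (simp add: distinct_card)
  then obtain b where b: "b \<in> I" "b \<notin> set xs"
    using xs(3) by (metis less_irrefl subset_antisym subsetI)
  have h: "hd xs \<in> set xs" using xs(1) step(1) by (cases xs) auto
  then have "(hd xs, b) \<in> F\<^sup>*" using assms(1) xs(3) b(1) by (auto simp: tree_def)
  then obtain x y where xy: "x \<in> set xs" "y \<notin> set xs" "(x, y) \<in> F"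
    using rtrancl_crossing[of "hd xs" b F "set xs"] h b(2) by blast
  have y: "y \<in> I" using assms(1) xy(3) by (auto simp: tree_def)
  obtain s where "s < k" "xs ! s = x" using xy(1) xs(1) by (auto simp: in_set_conv_nth)
  have "\<exists>s<t. ((xs @ [y]) ! s, (xs @ [y]) ! t) \<in> F" if tk: "t < Suc k" "0 < t" for t
  proof (cases "t < k")
    case True
    then obtain r where "r < t" "(xs ! r, xs ! t) \<in> F" using xs(4) tk(2) by metis
    then show ?thesis using xs(1) True by (intro exI[of _ r]) (simp add: nth_append)
  next
    case False
    then have "t = k" using tk(1) by simp
    then have "(xs @ [y]) ! t = y" "(xs @ [y]) ! s = x"
      using xs(1) \<open>s < k\<close> \<open>xs ! s = x\<close> by (simp_all add: nth_append)
    then show ?thesis using xy(3) \<open>s < k\<close> \<open>t = k\<close> by (intro exI[of _ s]) simp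
  qed
  moreover have "length (xs @ [y]) = Suc k" "distinct (xs @ [y])" "set (xs @ [y]) \<subseteq> I"
    using xs(1-3) xy(2) y by auto
  ultimately show ?case by blast
qed

text \<open>The parent exists by connectedness and is unique by acyclicity: two earlier neighbours
  of a node are joined by a path among the earlier nodes, which the node would close to a
  cycle.\<close>

lemma rooted_tree:
  assumes "tree I F"
  shows "\<exists>(f :: nat \<Rightarrow> 'a) p. bij_betw f {..<card I} I \<and>
    (\<forall>t<card I. 0 < t \<longrightarrow> p t < t) \<and>
    (\<forall>t<card I. \<forall>s<t. (f s, f t) \<in> F \<longleftrightarrow> s = p t)"
proof -
  define m where "m = card I"
  have fin: "finite I" "I \<noteq> {}" and FI: "F \<subseteq> I \<times> I" and symF: "sym F"
    and acyc: "\<And>xs. length xs \<ge> 3 \<Longrightarrow> distinct xs \<Longrightarrow> successively (\<lambda>i j. (i, j) \<in> F) xs \<Longrightarrow>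
      (last xs, hd xs) \<notin> F"
    using assms by (auto simp: tree_def)
  have "1 \<le> m" using fin by (simp add: m_def Suc_le_eq card_gt_0_iff)
  then obtain xs where xs: "length xs = m" "distinct xs" "set xs \<subseteq> I"
    "\<forall>t<m. 0 < t \<longrightarrow> (\<exists>s<t. (xs ! s, xs ! t) \<in> F)"
    using tree_enumeration[OF assms, of m] by (auto simp: m_def)
  have setxs: "set xs = I"
    using xs fin by (metis card_subset_eq distinct_card m_def)
  \<comment> \<open>Connectedness inside the prefix, not merely in the tree, is what keeps the later
    path away from \<open>xs ! t\<close>.\<close>
  have conn: "(xs ! s, xs ! 0) \<in> (F \<inter> set (take t xs) \<times> set (take t xs))\<^sup>*" (is "_ \<in> (?R t)\<^sup>*")
    if st: "s < t" and tm: "t \<le> m" for s t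
    using st
  proof (induction s rule: less_induct)
    case (less s)
    have mem: "xs ! i \<in> set (take t xs)" if "i < t" for i
      using that tm xs(1) by (auto simp: in_set_conv_nth intro!: exI[of _ i])
    show ?case
    proof (cases "s = 0")
      case False
      then obtain r where r: "r < s" "(xs ! r, xs ! s) \<in> F"
        using xs(4) less.prems tm by (metis gr0I less_le_trans)
      then have "(xs ! s, xs ! r) \<in> ?R t"
        using symF mem less.prems by (auto dest: symD)
      then show ?thesis
        using less.IH[of r] r less.prems by (meson converse_rtrancl_into_rtrancl less_trans)
    qed simp
  qed
  have uniq: "s = s'" if "t < m" "s < t" "s' < t" "(xs ! s, xs ! t) \<in> F" "(xs ! s', xs ! t) \<in> F" for s s' t
  proof (rule ccontr)
    assume "s \<noteq> s'"
    let ?R = "F \<inter> set (take t xs) \<times> set (take t xs)"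
    have "sym ?R" using symF by (auto simp: sym_def)
    then have "(xs ! s, xs ! s') \<in> ?R\<^sup>*"
      using conn[of s t] conn[of s' t] that by (meson less_imp_le rtrancl_trans sym_rtrancl symD)
    then obtain ys where ys: "ys \<noteq> []" "distinct ys" "hd ys = xs ! s" "last ys = xs ! s'"
      "successively (\<lambda>i j. (i, j) \<in> ?R) ys"
      using rtrancl_distinct_path by metis
    have "xs ! s \<noteq> xs ! s'"
      using \<open>s \<noteq> s'\<close> xs that by (simp add: nth_eq_iff_index_eq)
    \<comment> \<open>Together with \<open>xs ! t\<close> the path has at least the three vertices
      that a cycle requires.\<close>
    then have len: "length ys \<ge> 2"
      using ys(1,3,4) by (cases ys; cases "tl ys") auto
    then have "set ys \<subseteq> Field ?R" using ys(5) successively_field by metis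
    then have "set ys \<subseteq> set (take t xs)" by (auto simp: Field_def)
    moreover have "xs ! t \<notin> set (take t xs)"
      using xs that(1) by (auto simp: in_set_conv_nth nth_eq_iff_index_eq)
    ultimately have "distinct (ys @ [xs ! t])" using ys(2) by auto
    moreover have "successively (\<lambda>i j. (i, j) \<in> F) ys"
      using ys(5) by (rule successively_mono) auto
    then have "successively (\<lambda>i j. (i, j) \<in> F) (ys @ [xs ! t])"
      using that(5) ys(1,4) by (auto simp: successively_append_iff)
    moreover have "(last (ys @ [xs ! t]), hd (ys @ [xs ! t])) \<in> F"
      using ys(1,3) that(4) symF by (auto dest: symD)
    ultimately show False
      using acyc[of "ys @ [xs ! t]"] len by auto
  qed
  define p where "p t = (SOME s. s < t \<and> (xs ! s, xs ! t) \<in> F)" for t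
  have p: "p t < t \<and> (xs ! p t, xs ! t) \<in> F" if "t < m" "0 < t" for t
    unfolding p_def by (rule someI_ex) (use xs(4) that in blast)
  have "bij_betw (\<lambda>t. xs ! t) {..<m} I"
    using xs setxs by (intro bij_betw_nth) auto
  moreover have "\<forall>t<m. \<forall>s<t. (xs ! s, xs ! t) \<in> F \<longleftrightarrow> s = p t"
    using p uniq by (metis gr_implies_not0 neq0_conv)
  ultimately show ?thesis
    using p unfolding m_def by blast
qed

text \<open>Start at a topmost node \<open>a\<close> of \<open>J\<close> and walk inside
  \<open>J\<close>: \<open>a\<close> remains an ancestor of every node reached, since a step upward
  cannot leave from \<open>a\<close>. Ancestors have smaller index, so two topmost nodes bound each
  other.\<close>

lemma rooted_top_unique:
  fixes m :: nat
  assumes "\<And>t. t < m \<Longrightarrow> 0 < t \<Longrightarrow> p t < t" "J \<subseteq> {..<m}"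
    and "\<And>s t. s \<in> J \<Longrightarrow> t \<in> J \<Longrightarrow>
      (s, t) \<in> {(s, t). s \<in> J \<and> t \<in> J \<and> (s < t \<and> s = p t \<or> t < s \<and> t = p s)}\<^sup>*"
    and "a \<in> J" "b \<in> J" "a = 0 \<or> p a \<notin> J" "b = 0 \<or> p b \<notin> J"
  shows "a = b"
proof -
  define R where "R = {(s, t). s \<in> J \<and> t \<in> J \<and> (s < t \<and> s = p t \<or> t < s \<and> t = p s)}"
  define Q where "Q = {(t, p t) | t. t < m \<and> 0 < t}"
  have Q: "t \<le> s" if "(s, t) \<in> Q\<^sup>*" for s t
    using that by (induction rule: rtrancl_induct) (auto simp: Q_def intro: order_trans[OF less_imp_le[OF assms(1)]])
  have "a \<le> b" if "a \<in> J" "b \<in> J" "a = 0 \<or> p a \<notin> J" for a b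
  proof -
    have "(a, b) \<in> R\<^sup>*" using assms(3) that by (simp add: R_def)
    then have "(b, a) \<in> Q\<^sup>*"
    proof (induction rule: rtrancl_induct)
      case (step y z)
      show ?case
      proof (cases "y < z")
        case True
        then have "(z, y) \<in> Q" using step.hyps(2) assms(2) by (auto simp: R_def Q_def)
        then show ?thesis using step.IH by (meson converse_rtrancl_into_rtrancl)
      next
        case False
        then have z: "z < y" "z = p y" "z \<in> J" using step.hyps(2) by (auto simp: R_def)
        then have "y \<noteq> a" using that(3) by auto
        then obtain w where "(y, w) \<in> Q" "(w, a) \<in> Q\<^sup>*"
          using step.IH by (metis converse_rtranclE)
        then show ?thesis using z by (auto simp: Q_def)
      qed
    qed simp
    then show ?thesis by (rule Q)
  qed
  from this[of a b] this[of b a] assms(4-7) show ?thesis by simp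
qed

text \<open>
  Replacing the children of a node by a chain of siblings makes the rooted tree binary; the bag of
  the parent is carried along the chain.
\<close>

lemma binary_tree_decomposition:
  assumes td: "tree_decomposition W H I F bag" and "finite W"
  defines "m \<equiv> card I"
  shows "\<exists>q D. (\<forall>t<m. 0 < t \<longrightarrow> q t < t) \<and>
    (\<forall>t<m. card {s. s < m \<and> 0 < s \<and> q s = t} \<le> 2) \<and>
    (\<forall>t<m. D t \<subseteq> W \<and> card (D t) \<le> 2 * (width I bag + 1)) \<and>
    (\<forall>e\<in>H. \<exists>t<m. e \<subseteq> D t) \<and>
    (\<forall>u\<in>W. \<exists>!t. t < m \<and> u \<in> D t \<and> \<not> (0 < t \<and> u \<in> D (q t)))"
proof -
  have tree: "tree I F" and un: "(\<Union>i\<in>I. bag i) = W"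
    and H: "\<forall>e\<in>H. \<exists>i\<in>I. e \<subseteq> bag i"
    and sub: "\<And>u. u \<in> W \<Longrightarrow> tree {i \<in> I. u \<in> bag i} (F \<inter> {i \<in> I. u \<in> bag i} \<times> {i \<in> I. u \<in> bag i})"
    using td by (auto simp: tree_decomposition_def Let_def)
  have finI: "finite I" and symF: "sym F" and irreflF: "irrefl F"
    using tree by (simp_all add: tree_def)
  obtain f :: "nat \<Rightarrow> 'b" and p where f: "bij_betw f {..<m} I"
    and p: "\<And>t. t < m \<Longrightarrow> 0 < t \<Longrightarrow> p t < t"
    and edge: "\<And>s t. t < m \<Longrightarrow> s < t \<Longrightarrow> (f s, f t) \<in> F \<longleftrightarrow> s = p t"
    using rooted_tree[OF tree] unfolding m_def by metis
  define b where "b t = bag (f t)" for t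
  define sib where "sib t = {s. 0 < s \<and> s < t \<and> p s = p t}" for t
  \<comment> \<open>Indices exceed those of parents, so the maximum is the nearest older sibling if
    there is one, and the parent otherwise.\<close>
  define q where "q t = Max (insert (p t) (sib t))" for t
  define D where "D t = b t \<union> (if t = 0 then {} else b (p t))" for t
  have finsib: "finite (sib t)" for t by (simp add: sib_def)
  have q: "q t = p t \<or> q t \<in> sib t" for t
    using Max_in[of "insert (p t) (sib t)"] finsib by (auto simp: q_def)
  have qless: "q t < t" if "t < m" "0 < t" for t
    using q[of t] p[OF that] by (auto simp: sib_def)
  have fI: "f t \<in> I" if "t < m" for t using f that by (auto simp: bij_betw_def)
  have bW: "b t \<subseteq> W" if "t < m" for t using un fI[OF that] by (auto simp: b_def)
  have bcard: "card (b t) \<le> width I bag + 1" if "t < m" for t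
  proof -
    have "card (b t) \<le> Max ((\<lambda>i. card (bag i)) ` I)"
      using finI fI[OF that] by (intro Max_ge) (auto simp: b_def)
    then show ?thesis by (simp add: width_def)
  qed
  \<comment> \<open>A child \<open>s\<close> of \<open>t\<close> in the new tree is its first child
    or next sibling in the old one, that is \<open>p s = t\<close> or \<open>p s = p t\<close>; each
    case occurs at most once.\<close>
  have 1: "card {s. s < m \<and> 0 < s \<and> q s = t} \<le> 2" for t
  proof -
    have inj: "s = s'" if "s < m" "0 < s" "q s = t" "s' < m" "0 < s'" "q s' = t" "p s = p s'" for s s'
    proof -
      have *: "\<not> s < s'" if "s < m" "0 < s" "q s = t" "s' < m" "0 < s'" "q s' = t" "p s = p s'" for s s'
      proof
        assume "s < s'"
        then have "s \<in> sib s'" using that by (simp add: sib_def)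
        then have "s \<le> q s'" using finsib by (simp add: q_def)
        then show False using qless[of s] that by simp
      qed
      show ?thesis using *[of s s'] *[of s' s] that by (metis linorder_neqE_nat)
    qed
    let ?A = "{s. s < m \<and> 0 < s \<and> q s = t}"
    have "inj_on p ?A" using inj by (auto simp: inj_on_def)
    moreover have "p ` ?A \<subseteq> {t, p t}"
    proof
      fix x assume "x \<in> p ` ?A"
      then obtain s where "x = p s" "q s = t" by auto
      then show "x \<in> {t, p t}" using q[of s] by (auto simp: sib_def)
    qed
    ultimately have "card ?A \<le> card {t, p t}"
      by (intro card_inj_on_le) auto
    also have "\<dots> \<le> 2" by (simp add: card_insert_if)
    finally show ?thesis .
  qed
  have 2: "D t \<subseteq> W \<and> card (D t) \<le> 2 * (width I bag + 1)" if "t < m" for t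
  proof (cases "t = 0")
    case True
    then show ?thesis using bW[OF that] bcard[OF that] by (simp add: D_def)
  next
    case False
    then have pt: "p t < m" using p[OF that] that by simp
    have "card (D t) \<le> card (b t) + card (b (p t))"
      using False by (simp add: D_def card_Un_le)
    then show ?thesis using False bW[OF that] bW[OF pt] bcard[OF that] bcard[OF pt] by (auto simp: D_def)
  qed
  have 3: "\<exists>t<m. e \<subseteq> D t" if "e \<in> H" for e
  proof -
    obtain i where "i \<in> I" "e \<subseteq> bag i" using H \<open>e \<in> H\<close> by blast
    moreover then obtain t where "t < m" "f t = i" using f by (auto simp: bij_betw_def)
    ultimately show ?thesis by (intro exI[of _ t]) (auto simp: D_def b_def)
  qed
  have 4: "\<exists>!t. t < m \<and> u \<in> D t \<and> \<not> (0 < t \<and> u \<in> D (q t))" if u: "u \<in> W" for u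
  proof -
    define J where "J = {t. t < m \<and> u \<in> b t}"
    let ?K = "{i \<in> I. u \<in> bag i}"
    have fJ: "f ` J = ?K" using f by (auto simp: J_def b_def bij_betw_def)
    have injf: "inj_on f {..<m}" using f by (simp add: bij_betw_def)
    define R where "R = {(s, t). s \<in> J \<and> t \<in> J \<and> (s < t \<and> s = p t \<or> t < s \<and> t = p s)}"
    have conn: "(s, t) \<in> R\<^sup>*" if "s \<in> J" "t \<in> J" for s t
    proof -
      have "(f s, f t) \<in> (F \<inter> ?K \<times> ?K)\<^sup>*"
      proof -
        have "\<forall>i\<in>?K. \<forall>j\<in>?K. (i, j) \<in> (F \<inter> ?K \<times> ?K)\<^sup>*"
          using sub[OF u] unfolding tree_def by blast
        then show ?thesis using that fJ by blast
      qed
      moreover have "\<exists>t\<in>J. f t = y \<and> (s, t) \<in> R\<^sup>*" if "(f s, y) \<in> (F \<inter> ?K \<times> ?K)\<^sup>*" for y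
        using that
      proof (induction rule: rtrancl_induct)
        case base
        then show ?case using \<open>s \<in> J\<close> by blast
      next
        case (step y z)
        then obtain t where t: "t \<in> J" "f t = y" "(s, t) \<in> R\<^sup>*" by blast
        have "z \<in> f ` J" using step.hyps(2) unfolding fJ by blast
        then obtain r where r: "r \<in> J" "f r = z" by blast
        have "(f t, f r) \<in> F" "(f r, f t) \<in> F"
          using step.hyps(2) t(2) r(2) symF by (auto dest: symD)
        moreover have "t \<noteq> r" using \<open>(f t, f r) \<in> F\<close> irreflF by (auto simp: irrefl_def)
        ultimately have "(t, r) \<in> R"
          using edge[of r t] edge[of t r] t(1) r(1) unfolding R_def J_def by (cases "t < r") auto
        with t(3) have "(s, r) \<in> R\<^sup>*" by (rule rtrancl_into_rtrancl)
        then show ?case using r by blast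
      qed
      ultimately obtain t' where "t' \<in> J" "f t' = f t" "(s, t') \<in> R\<^sup>*" by blast
      then show ?thesis using injf that by (auto simp: J_def inj_on_def)
    qed
    have uniq: "s = t" if "s \<in> J" "t \<in> J" "s = 0 \<or> p s \<notin> J" "t = 0 \<or> p t \<notin> J" for s t
      by (rule rooted_top_unique[where m = m and p = p and J = J])
        (use p conn that in \<open>auto simp: J_def R_def\<close>)
    \<comment> \<open>The parent's bag is contained in \<open>D (q t)\<close> whether
      \<open>q t\<close> is the parent or a sibling. Hence an apex of \<open>u\<close> for
      \<open>D\<close> is a topmost node of \<open>u\<close> in the original decomposition, where it
      is unique.\<close>
    have top: "t \<in> J \<and> (t = 0 \<or> p t \<notin> J)" if t: "t < m" "u \<in> D t" "\<not> (0 < t \<and> u \<in> D (q t))" for t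
    proof (cases "t = 0")
      case True
      then show ?thesis using t by (simp add: J_def D_def)
    next
      case False
      have "b (p t) \<subseteq> D (q t)"
        using q[of t] False by (auto simp: D_def sib_def)
      then show ?thesis using t False by (auto simp: J_def D_def)
    qed
    have "\<exists>i\<in>I. u \<in> bag i" using un u by blast
    then have "?K \<noteq> {}" by blast
    then obtain t0 where "t0 \<in> J" unfolding fJ[symmetric] by blast
    then have ex: "\<exists>t. t < m \<and> u \<in> D t"
      unfolding J_def D_def by blast
    \<comment> \<open>The least node containing \<open>u\<close> is an apex because \<open>q\<close>
      decreases indices.\<close>
    define t where "t = (LEAST t. t < m \<and> u \<in> D t)"
    have t: "t < m" "u \<in> D t" using LeastI_ex[OF ex] by (auto simp: t_def)
    have "\<not> (0 < t \<and> u \<in> D (q t))"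
    proof
      assume "0 < t \<and> u \<in> D (q t)"
      then show False
        using qless[of t] t not_less_Least[of "q t" "\<lambda>t. t < m \<and> u \<in> D t"] by (auto simp: t_def)
    qed
    then show ?thesis using t top uniq by blast
  qed
  show ?thesis
    using qless 1 2 3 4 by (intro exI[of _ q] exI[of _ D]) blast
qed


section \<open>Second derivatives\<close>

text \<open>Schwarz: the second difference over a small square is expressed by two applications of
  the mean value theorem in either order, giving values of both mixed derivatives near the base
  point.\<close>

lemma mixed_derivatives_commute:
  fixes \<phi> :: "real \<Rightarrow> real \<Rightarrow> real"
  assumes "open S" "(a, b) \<in> S"
    and s: "\<And>s t. (s, t) \<in> S \<Longrightarrow> ((\<lambda>s. \<phi> s t) has_real_derivative \<phi>s s t) (at s)"
    and t: "\<And>s t. (s, t) \<in> S \<Longrightarrow> (\<phi> s has_real_derivative \<phi>t s t) (at t)"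
    and st: "\<And>s t. (s, t) \<in> S \<Longrightarrow> ((\<lambda>s. \<phi>t s t) has_real_derivative \<phi>st s t) (at s)"
    and ts: "\<And>s t. (s, t) \<in> S \<Longrightarrow> (\<phi>s s has_real_derivative \<phi>ts s t) (at t)"
    and cont: "continuous_on S (\<lambda>(s, t). \<phi>st s t)" "continuous_on S (\<lambda>(s, t). \<phi>ts s t)"
  shows "\<phi>st a b = \<phi>ts a b"
proof (rule ccontr)
  assume neq: "\<phi>st a b \<noteq> \<phi>ts a b"
  define e where "e = \<bar>\<phi>st a b - \<phi>ts a b\<bar> / 2"
  have e: "e > 0" using neq by (simp add: e_def)
  obtain r0 where r0: "r0 > 0" "ball (a, b) r0 \<subseteq> S"
    using assms(1,2) by (auto simp: open_contains_ball)
  obtain r1 where r1: "r1 > 0" "\<And>p. p \<in> S \<Longrightarrow> dist p (a, b) < r1 \<Longrightarrow>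
      dist (case p of (s, t) \<Rightarrow> \<phi>st s t) (\<phi>st a b) < e"
    using cont(1) assms(2) e unfolding continuous_on_iff by fastforce
  obtain r2 where r2: "r2 > 0" "\<And>p. p \<in> S \<Longrightarrow> dist p (a, b) < r2 \<Longrightarrow>
      dist (case p of (s, t) \<Rightarrow> \<phi>ts s t) (\<phi>ts a b) < e"
    using cont(2) assms(2) e unfolding continuous_on_iff by fastforce
  \<comment> \<open>A third, since points of the square of side \<open>h\<close> are within
    \<open>2 * h\<close> of the corner.\<close>
  define h where "h = Min {r0, r1, r2} / 3"
  have h: "h > 0" using r0(1) r1(1) r2(1) by (simp add: h_def)
  have box: "dist (s, t) (a, b) < r0 \<and> dist (s, t) (a, b) < r1 \<and> dist (s, t) (a, b) < r2 \<and> (s, t) \<in> S"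
    if "a \<le> s" "s \<le> a + h" "b \<le> t" "t \<le> b + h" for s t
  proof -
    have "dist (s, t) (a, b) \<le> dist s a + dist t b"
      unfolding dist_Pair_Pair by (rule sqrt_sum_squares_le_sum) auto
    also have "\<dots> \<le> 2 * h" using that by (simp add: dist_real_def)
    also have "2 * h < Min {r0, r1, r2}" using h unfolding h_def by linarith
    finally have "dist (s, t) (a, b) < Min {r0, r1, r2}" .
    then have *: "dist (s, t) (a, b) < r0" "dist (s, t) (a, b) < r1" "dist (s, t) (a, b) < r2" by auto
    then have "(s, t) \<in> ball (a, b) r0" by (simp add: dist_commute)
    then show ?thesis using * r0(2) by blast
  qed
  define \<Delta> where "\<Delta> = \<phi> (a + h) (b + h) - \<phi> (a + h) b - (\<phi> a (b + h) - \<phi> a b)"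
  obtain \<xi> \<eta> where 1: "a < \<xi>" "\<xi> < a + h" "b < \<eta>" "\<eta> < b + h" "\<Delta> = h * (h * \<phi>ts \<xi> \<eta>)"
  proof -
    have "\<exists>z>a. z < a + h \<and> (\<phi> (a + h) (b + h) - \<phi> (a + h) b) - (\<phi> a (b + h) - \<phi> a b)
        = (a + h - a) * (\<phi>s z (b + h) - \<phi>s z b)"
      by (rule MVT2) (use h box in \<open>auto intro!: DERIV_diff s\<close>)
    then obtain \<xi> where \<xi>: "a < \<xi>" "\<xi> < a + h" "\<Delta> = h * (\<phi>s \<xi> (b + h) - \<phi>s \<xi> b)"
      by (auto simp: \<Delta>_def)
    have "\<exists>z>b. z < b + h \<and> \<phi>s \<xi> (b + h) - \<phi>s \<xi> b = (b + h - b) * \<phi>ts \<xi> z"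
      by (rule MVT2) (use h box \<xi> in \<open>auto intro!: ts\<close>)
    then obtain \<eta> where "b < \<eta>" "\<eta> < b + h" "\<phi>s \<xi> (b + h) - \<phi>s \<xi> b = h * \<phi>ts \<xi> \<eta>"
      by auto
    then show thesis using \<xi> by (intro that[of \<xi> \<eta>]) auto
  qed
  obtain \<xi>' \<eta>' where 2: "a < \<xi>'" "\<xi>' < a + h" "b < \<eta>'" "\<eta>' < b + h" "\<Delta> = h * (h * \<phi>st \<xi>' \<eta>')"
  proof -
    have "\<exists>z>b. z < b + h \<and> (\<phi> (a + h) (b + h) - \<phi> a (b + h)) - (\<phi> (a + h) b - \<phi> a b)
        = (b + h - b) * (\<phi>t (a + h) z - \<phi>t a z)"
      by (rule MVT2) (use h box in \<open>auto intro!: DERIV_diff t\<close>)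
    then obtain \<eta> where \<eta>: "b < \<eta>" "\<eta> < b + h" "\<Delta> = h * (\<phi>t (a + h) \<eta> - \<phi>t a \<eta>)"
      by (auto simp: \<Delta>_def algebra_simps)
    have "\<exists>z>a. z < a + h \<and> \<phi>t (a + h) \<eta> - \<phi>t a \<eta> = (a + h - a) * \<phi>st z \<eta>"
      by (rule MVT2) (use h box \<eta> in \<open>auto intro!: st\<close>)
    then obtain \<xi> where "a < \<xi>" "\<xi> < a + h" "\<phi>t (a + h) \<eta> - \<phi>t a \<eta> = h * \<phi>st \<xi> \<eta>"
      by auto
    then show thesis using \<eta> by (intro that[of \<xi> \<eta>]) auto
  qed
  have eq: "\<phi>ts \<xi> \<eta> = \<phi>st \<xi>' \<eta>'" using 1(5) 2(5) h by simp
  have "\<bar>\<phi>ts \<xi> \<eta> - \<phi>ts a b\<bar> < e"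
    using r2(2)[of "(\<xi>, \<eta>)"] box[of \<xi> \<eta>] 1 by (auto simp: dist_real_def)
  moreover have "\<bar>\<phi>st \<xi>' \<eta>' - \<phi>st a b\<bar> < e"
    using r1(2)[of "(\<xi>', \<eta>')"] box[of \<xi>' \<eta>'] 2 by (auto simp: dist_real_def)
  ultimately show False using eq by (simp add: e_def abs_if split: if_splits)
qed

lemma coord_of_upd [simp]: "coord_of (upd X c t) c = t"
  by (simp add: coord_of_def upd_def)

lemma upd_upd [simp]: "upd (upd X c s) c t = upd X c t"
  by (auto simp: upd_def)

lemma upd_commute: "c \<noteq> d \<Longrightarrow> upd (upd X c s) d t = upd (upd X d t) c s"
  by (cases c; cases d) (auto simp: upd_def fun_eq_iff)

lemma upd_coord_of [simp]: "upd X c (coord_of X c) = X"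
  by (simp add: upd_def coord_of_def)

lemma restrict_upd: "restrict (upd X c t) A = (if fst c \<in> A then upd (restrict X A) c t else restrict X A)"
  by (auto simp: upd_def restrict_def fun_eq_iff)

lemma state_slice:
  assumes U: "\<And>v. v \<in> A \<Longrightarrow> openin (Euclidean_space (n v)) (U v)"
    and Y: "Y \<in> Pi\<^sub>E A U" and c: "c \<in> coords n A" and d: "d \<in> coords n A"
  defines "F \<equiv> \<lambda>p. upd (upd Y c (fst p)) d (snd p)"
  shows "open {p. F p \<in> Pi\<^sub>E A U}" (is "open ?S")
    and "continuous_map (top_of_set {p. F p \<in> Pi\<^sub>E A U}) (state_space n U A) F"
proof -
  have fc: "fst c \<in> A" "snd c < n (fst c)" "fst d \<in> A" "snd d < n (fst d)"
    using c d by (auto simp: coords_def)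
  have Yz: "Y v i = 0" if "v \<in> A" "n v \<le> i" for v i
    using U[OF that(1)] Y that by (fastforce dest: openin_subset simp: topspace_Euclidean_space PiE_iff)
  have cont: "continuous_map euclidean (Euclidean_space (n v)) (\<lambda>p. F p v)" if v: "v \<in> A" for v
    unfolding Euclidean_space_def continuous_map_in_subtopology continuous_map_componentwise_UNIV
  proof (intro conjI allI)
    fix k
    have "(\<lambda>p. F p v k) = (if d = (v, k) then snd else if c = (v, k) then fst else (\<lambda>_. Y v k))"
      by (cases c; cases d) (auto simp: F_def upd_def fun_eq_iff)
    moreover have "continuous_on UNIV \<dots>"
      by (auto intro!: continuous_intros simp: continuous_on_fst continuous_on_snd)
    ultimately show "continuous_map euclidean euclideanreal (\<lambda>p. F p v k)"
      by simp
  next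
    show "(\<lambda>p. F p v) \<in> topspace euclidean \<rightarrow> {x. \<forall>i\<ge>n v. x i = 0}"
      using Yz[OF v] fc by (auto simp: F_def upd_def)
  qed
  have ext: "F p \<in> extensional A" for p
    using Y fc by (auto simp: F_def upd_def PiE_def extensional_def)
  have S: "?S = (\<lambda>p. F p (fst c)) -` U (fst c) \<inter> (\<lambda>p. F p (fst d)) -` U (fst d)" (is "_ = ?T")
  proof
    show "?S \<subseteq> ?T" using fc by (auto simp: PiE_iff)
    show "?T \<subseteq> ?S"
    proof
      fix p assume p: "p \<in> ?T"
      have "F p v \<in> U v" if "v \<in> A" for v
        using p Y that by (cases "v = fst c \<or> v = fst d") (auto simp: F_def upd_def PiE_iff)
      then show "p \<in> ?S" using ext by (auto simp: PiE_iff)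
    qed
  qed
  have "open ((\<lambda>p. F p v) -` U v)" if "v \<in> A" for v
    using openin_continuous_map_preimage[OF cont[OF that] U[OF that]] by (simp add: vimage_def)
  then show "open ?S" unfolding S using fc by (intro open_Int) auto
  show "continuous_map (top_of_set ?S) (state_space n U A) F"
    unfolding state_space_def continuous_map_componentwise
  proof (intro conjI ballI)
    show "F ` topspace (top_of_set ?S) \<subseteq> extensional A" using ext by auto
    fix v assume v: "v \<in> A"
    show "continuous_map (top_of_set ?S) (subtopology (Euclidean_space (n v)) (U v)) (\<lambda>p. F p v)"
      using cont[OF v] v
      by (auto simp: continuous_map_in_subtopology PiE_iff intro: continuous_map_from_subtopology)
  qed
qed

lemma eventually_upd_in:
  assumes "\<And>v. v \<in> A \<Longrightarrow> openin (Euclidean_space (n v)) (U v)" "Y \<in> Pi\<^sub>E A U" "c \<in> coords n A"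
  shows "\<forall>\<^sub>F t in nhds (coord_of Y c). upd Y c t \<in> Pi\<^sub>E A U"
proof -
  let ?S = "{p. upd (upd Y c (fst p)) c (snd p) \<in> Pi\<^sub>E A U}"
  have "open ?S" using state_slice(1)[OF assms assms(3)] by simp
  moreover have "continuous_on UNIV (\<lambda>t :: real. (0 :: real, t))"
    by (intro continuous_intros)
  ultimately have "open ((\<lambda>t. (0, t)) -` ?S)"
    by (rule open_vimage)
  moreover have "(\<lambda>t. (0, t)) -` ?S = {t. upd Y c t \<in> Pi\<^sub>E A U}"
    by auto
  ultimately have "open {t. upd Y c t \<in> Pi\<^sub>E A U}" by (simp only:)
  then show ?thesis
    unfolding eventually_nhds using assms(2) by (intro exI[of _ "{t. upd Y c t \<in> Pi\<^sub>E A U}"]) simp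
qed

lemma C1_on_deriv:
  assumes "C1_on n U A f" "c \<in> coords n A" "Y \<in> Pi\<^sub>E A U"
  shows "((\<lambda>t. f (upd Y c t)) has_real_derivative partial c f Y) (at (coord_of Y c))"
  using assms unfolding C1_on_def partial_def
  by (intro DERIV_deriv_iff_real_differentiable[THEN iffD2]) auto

lemma C2_on_symmetric:
  assumes U: "\<And>v. v \<in> A \<Longrightarrow> openin (Euclidean_space (n v)) (U v)"
    and f: "C2_on n U A f" and Y: "Y \<in> Pi\<^sub>E A U" and c: "c \<in> coords n A" and d: "d \<in> coords n A"
  shows "partial c (partial d f) Y = partial d (partial c f) Y"
proof (cases "c = d")
  case False
  define F where "F = (\<lambda>p. upd (upd Y c (fst p)) d (snd p))"
  define S where "S = {p. F p \<in> Pi\<^sub>E A U}"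
  have oS: "open S" and cont: "continuous_map (top_of_set S) (state_space n U A) F"
    using state_slice[OF U Y c d] by (simp_all add: S_def F_def)
  have C1: "C1_on n U A f" "C1_on n U A (partial c f)" "C1_on n U A (partial d f)"
    using f c d by (auto simp: C2_on_def)
  have dd: "((\<lambda>t. g (F (s, t))) has_real_derivative partial d g (F (s, t))) (at t)"
    if "C1_on n U A g" "(s, t) \<in> S" for g s t
    using C1_on_deriv[OF that(1) d, of "F (s, t)"] that(2) by (simp add: S_def F_def)
  have dc: "((\<lambda>s. g (F (s, t))) has_real_derivative partial c g (F (s, t))) (at s)"
    if "C1_on n U A g" "(s, t) \<in> S" for g s t
    using C1_on_deriv[OF that(1) c, of "F (s, t)"] that(2) False
    by (simp add: S_def F_def upd_commute[OF False])
  have cont': "continuous_on S (\<lambda>(s, t). g (F (s, t)))"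
    if "continuous_map (state_space n U A) euclideanreal g" for g
    using continuous_map_compose[OF cont that] by (simp add: o_def split_def)
  have "partial c (partial d f) (F (coord_of Y c, coord_of Y d))
      = partial d (partial c f) (F (coord_of Y c, coord_of Y d))"
  proof (rule mixed_derivatives_commute[OF oS, where \<phi> = "\<lambda>s t. f (F (s, t))"
        and \<phi>s = "\<lambda>s t. partial c f (F (s, t))" and \<phi>t = "\<lambda>s t. partial d f (F (s, t))"
        and \<phi>st = "\<lambda>s t. partial c (partial d f) (F (s, t))"
        and \<phi>ts = "\<lambda>s t. partial d (partial c f) (F (s, t))"])
    show "(coord_of Y c, coord_of Y d) \<in> S"
      using Y by (simp add: S_def F_def)
    show "continuous_on S (\<lambda>(s, t). partial c (partial d f) (F (s, t)))"
      "continuous_on S (\<lambda>(s, t). partial d (partial c f) (F (s, t)))"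
      using C1 c d unfolding C1_on_def by (blast intro: cont')+
  qed (use dd dc C1 in blast)+
  then show ?thesis by (simp add: F_def)
qed simp


section \<open>Solvability and local form of the KKT system\<close>

text \<open>Fredholm alternative, by induction on the constraints. If the new functional vanishes on
  the common kernel of the old ones it gets multiplier 0. Otherwise it is nonzero at some
  \<open>z0\<close> in that kernel, and its multiplier is chosen to make the remainder vanish at
  \<open>z0\<close>.\<close>

lemma row_space:
  fixes a :: "'k \<Rightarrow> 'd \<Rightarrow> real"
  assumes "finite K" "finite D"
    and "\<And>z. (\<And>k. k \<in> K \<Longrightarrow> (\<Sum>d\<in>D. a k d * z d) = 0) \<Longrightarrow> (\<Sum>d\<in>D. r d * z d) = 0"
  shows "\<exists>\<nu>. \<forall>d\<in>D. r d = (\<Sum>k\<in>K. a k d * \<nu> k)"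
  using assms(1,3)
proof (induction K arbitrary: r rule: finite_induct)
  case empty
  have "r d = 0" if "d \<in> D" for d
    using empty[of "\<lambda>e. of_bool (e = d)"] assms(2) that
    by (simp add: of_bool_def if_distrib cong: if_cong)
  then show ?case by simp
next
  case (insert k K)
  show ?case
  proof (cases "\<exists>z. (\<forall>j\<in>K. (\<Sum>d\<in>D. a j d * z d) = 0) \<and> (\<Sum>d\<in>D. a k d * z d) \<noteq> 0")
    case False
    then have "\<exists>\<nu>. \<forall>d\<in>D. r d = (\<Sum>k\<in>K. a k d * \<nu> k)"
      using insert.prems by (intro insert.IH) blast
    then obtain \<nu> where "\<forall>d\<in>D. r d = (\<Sum>k\<in>K. a k d * \<nu> k)" by blast
    moreover have "(\<Sum>j\<in>K. a j d * (\<nu>(k := 0)) j) = (\<Sum>j\<in>K. a j d * \<nu> j)" for d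
      using insert.hyps by (intro sum.cong) auto
    ultimately show ?thesis
      using insert.hyps by (intro exI[of _ "\<nu>(k := 0)"]) simp
  next
    case True
    then obtain z0 where z0: "\<And>j. j \<in> K \<Longrightarrow> (\<Sum>d\<in>D. a j d * z0 d) = 0"
      "(\<Sum>d\<in>D. a k d * z0 d) \<noteq> 0" by blast
    define c where "c = (\<Sum>d\<in>D. a k d * z0 d)"
    define \<rho> where "\<rho> = (\<Sum>d\<in>D. r d * z0 d) / c"
    have "\<exists>\<nu>. \<forall>d\<in>D. r d - \<rho> * a k d = (\<Sum>k\<in>K. a k d * \<nu> k)"
    proof (rule insert.IH)
      fix z assume z: "\<And>j. j \<in> K \<Longrightarrow> (\<Sum>d\<in>D. a j d * z d) = 0"
      \<comment> \<open>Moves \<open>z\<close> along \<open>z0\<close> into the kernel of the new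
        functional as well.\<close>
      define \<tau> where "\<tau> = (\<Sum>d\<in>D. a k d * z d) / c"
      have lin: "(\<Sum>d\<in>D. b d * (z d - \<tau> * z0 d)) = (\<Sum>d\<in>D. b d * z d) - \<tau> * (\<Sum>d\<in>D. b d * z0 d)" for b :: "'d \<Rightarrow> real"
        by (simp add: right_diff_distrib sum_subtractf sum_distrib_left mult_ac)
      have "(\<Sum>d\<in>D. a j d * (z d - \<tau> * z0 d)) = 0" if "j \<in> insert k K" for j
        using that z z0 unfolding lin by (auto simp: \<tau>_def c_def)
      then have "(\<Sum>d\<in>D. r d * (z d - \<tau> * z0 d)) = 0"
        by (rule insert.prems)
      then have "(\<Sum>d\<in>D. r d * z d) = \<tau> * (\<Sum>d\<in>D. r d * z0 d)"
        by (simp add: lin)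
      also have "\<dots> = \<rho> * (\<Sum>d\<in>D. a k d * z d)"
        by (simp add: \<tau>_def \<rho>_def)
      finally have "(\<Sum>d\<in>D. r d * z d) - \<rho> * (\<Sum>d\<in>D. a k d * z d) = 0" by simp
      moreover have "(\<Sum>d\<in>D. (r d - \<rho> * a k d) * z d)
          = (\<Sum>d\<in>D. r d * z d) - \<rho> * (\<Sum>d\<in>D. a k d * z d)"
        by (simp add: left_diff_distrib sum_subtractf sum_distrib_left mult.assoc)
      ultimately show "(\<Sum>d\<in>D. (r d - \<rho> * a k d) * z d) = 0" by simp
    qed
    then obtain \<nu> where \<nu>: "\<And>d. d \<in> D \<Longrightarrow> r d - \<rho> * a k d = (\<Sum>k\<in>K. a k d * \<nu> k)" by blast
    have "(\<Sum>j\<in>K. a j d * (\<nu>(k := \<rho>)) j) = (\<Sum>j\<in>K. a j d * \<nu> j)" for d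
      using insert.hyps by (intro sum.cong) auto
    then have "r d = (\<Sum>j\<in>insert k K. a j d * (\<nu>(k := \<rho>)) j)" if "d \<in> D" for d
      using insert.hyps \<nu>[OF that] by (simp add: algebra_simps)
    then show ?thesis by blast
  qed
qed

lemma quadratic_nonneg_imp:
  fixes a b :: real
  assumes "\<And>t. 0 \<le> t * a + t\<^sup>2 * b"
  shows "a = 0"
proof (rule ccontr)
  assume "a \<noteq> 0"
  \<comment> \<open>Any positive number above \<open>b\<close> serves: at \<open>t = - a / c\<close>
    the value is \<open>(a / c)^2 * (b - c)\<close>.\<close>
  define c where "c = 1 + \<bar>b\<bar>"
  have c: "c > 0" "b - c < 0" by (auto simp: c_def)
  have "(- a / c) * a + (- a / c)\<^sup>2 * b = (a / c)\<^sup>2 * (b - c)"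
    using c(1) by (simp add: power2_eq_square field_simps)
  also have "\<dots> < 0" using c \<open>a \<noteq> 0\<close> by (intro mult_pos_neg) auto
  finally show False using assms[of "- a / c"] by simp
qed

text \<open>Moving from a minimiser along a kernel direction changes the objective by a nonnegative
  polynomial of degree at most two in \<open>t\<close> without constant term, so its linear
  coefficient vanishes.\<close>

lemma QP_attained_imp_KKT:
  assumes "finite V"
    and sym: "\<And>c d. c \<in> coords n V \<Longrightarrow> d \<in> coords n V \<Longrightarrow>
      hess_L V E n \<Phi> l X \<mu> c d = hess_L V E n \<Phi> l X \<mu> d c"
    and "QP_attained V E n \<Phi> l X \<mu>"
  shows "\<exists>\<delta> \<nu>. solves_KKT V E n \<Phi> l X \<mu> \<delta> \<nu>"
proof -
  define D where "D = coords n V"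
  define K where "K = coords n (noninput V E)"
  define H where "H = hess_L V E n \<Phi> l X \<mu>"
  define g where "g c = partial c (fhat V E l) X" for c
  define A where "A k d = partial d (constr E \<Phi> k) X" for k d
  have fin: "finite D" "finite K"
    using assms(1) by (auto simp: D_def K_def coords_def noninput_def)
  obtain \<delta> where feas: "QP_feasible V E n \<Phi> X \<delta>"
    and opt: "\<And>\<delta>'. QP_feasible V E n \<Phi> X \<delta>' \<Longrightarrow>
      QP_objective V E n \<Phi> l X \<mu> \<delta> \<le> QP_objective V E n \<Phi> l X \<mu> \<delta>'"
    using assms(3) by (auto simp: QP_attained_def)
  define r where "r c = - (\<Sum>d\<in>D. H c d * \<delta> d) - g c" for c
  have "(\<Sum>d\<in>D. r d * z d) = 0" if z: "\<And>k. k \<in> K \<Longrightarrow> (\<Sum>d\<in>D. A k d * z d) = 0" for z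
  proof -
    define B where "B x y = (\<Sum>c\<in>D. \<Sum>d\<in>D. x c * H c d * y d)" for x y :: "coord \<Rightarrow> real"
    \<comment> \<open>Symmetry identifies the two cross terms, so the gradient is \<open>H\<close>
      applied to \<delta> plus \<open>g\<close>, as in the KKT system.\<close>
    have Bsym: "B x y = B y x" for x y
      unfolding B_def by (subst sum.swap) (auto intro!: sum.cong simp: sym D_def H_def)
    have Badd: "B (\<lambda>c. x c + t * y c) w = B x w + t * B y w" for x y w t
      by (simp add: B_def sum.distrib sum_distrib_left algebra_simps)
    have B2: "B (\<lambda>c. \<delta> c + t * z c) (\<lambda>c. \<delta> c + t * z c) = B \<delta> \<delta> + 2 * t * B z \<delta> + t\<^sup>2 * B z z" for t
      using Badd Bsym by (simp add: power2_eq_square algebra_simps)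
    have feas': "QP_feasible V E n \<Phi> X (\<lambda>c. \<delta> c + t * z c)" for t
      using feas z unfolding QP_feasible_def D_def[symmetric] K_def[symmetric] A_def[symmetric]
      by (simp add: algebra_simps sum.distrib sum_distrib_left[symmetric])
    have "0 \<le> t * (B z \<delta> + (\<Sum>c\<in>D. g c * z c)) + t\<^sup>2 * (B z z / 2)" for t
    proof -
      have "QP_objective V E n \<Phi> l X \<mu> x = B x x / 2 + (\<Sum>c\<in>D. g c * x c)" for x
        by (simp add: QP_objective_def B_def D_def H_def g_def)
      moreover have "(\<Sum>c\<in>D. g c * (\<delta> c + t * z c)) = (\<Sum>c\<in>D. g c * \<delta> c) + t * (\<Sum>c\<in>D. g c * z c)"
        by (simp add: algebra_simps sum.distrib sum_distrib_left)
      ultimately show ?thesis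
        using opt[OF feas', of t] by (simp add: B2 algebra_simps add_divide_distrib)
    qed
    then have "B z \<delta> + (\<Sum>c\<in>D. g c * z c) = 0"
      by (rule quadratic_nonneg_imp)
    moreover have "(\<Sum>d\<in>D. r d * z d) = - (B z \<delta> + (\<Sum>c\<in>D. g c * z c))"
    proof -
      have "B z \<delta> = (\<Sum>c\<in>D. (\<Sum>d\<in>D. H c d * \<delta> d) * z c)"
        unfolding B_def sum_distrib_right by (intro sum.cong) (auto simp: mult_ac)
      then show ?thesis
        by (simp add: r_def left_diff_distrib sum_subtractf sum_negf)
    qed
    ultimately show ?thesis by simp
  qed
  then have "\<exists>\<nu>. \<forall>d\<in>D. r d = (\<Sum>k\<in>K. A k d * \<nu> k)"
    by (rule row_space[OF fin(2,1)])
  then obtain \<nu> where \<nu>: "\<And>d. d \<in> D \<Longrightarrow> r d = (\<Sum>k\<in>K. A k d * \<nu> k)"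
    by blast
  have "(\<Sum>d\<in>D. H c d * \<delta> d) + (\<Sum>k\<in>K. A k c * \<nu> k) = - g c" if "c \<in> D" for c
    using \<nu>[OF that] by (simp add: r_def)
  then show ?thesis
    using feas
    unfolding solves_KKT_def QP_feasible_def D_def[symmetric] K_def[symmetric] A_def[symmetric]
      H_def[symmetric] g_def[symmetric] by blast
qed

section \<open>Derivatives of the problem expressed by the input cells\<close>

locale kkt_data =
  fixes V E n U \<Phi> l X and \<mu> :: state
  assumes cs: "computational_structure V E n U \<Phi> l"
    and X: "X \<in> Pi\<^sub>E V U"
begin

abbreviation "st \<equiv> initial_store V E n \<Phi> l X \<mu>"

lemma finV: "finite V" using cs by (simp add: computational_structure_def)

lemma pa_subset: "pa E v \<subseteq> V"
  using cs by (auto simp: computational_structure_def pa_def)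

lemma fam_subset: "v \<in> V \<Longrightarrow> fam E v \<subseteq> V"
  using pa_subset by (auto simp: fam_def)

lemma noninput_subset: "noninput V E \<subseteq> V" by (auto simp: noninput_def)

lemma openU: "v \<in> V \<Longrightarrow> openin (Euclidean_space (n v)) (U v)"
  using cs by (simp add: computational_structure_def)

lemma C2_l: "v \<in> V \<Longrightarrow> C2_on n U (fam E v) (l v)"
  using cs by (simp add: computational_structure_def)

lemma C2_Phi: "v \<in> noninput V E \<Longrightarrow> i < n v \<Longrightarrow> C2_on n U (pa E v) (\<lambda>Y. \<Phi> v Y i)"
  using cs by (simp add: computational_structure_def)

lemma restrict_in: "A \<subseteq> V \<Longrightarrow> Y \<in> Pi\<^sub>E V U \<Longrightarrow> restrict Y A \<in> Pi\<^sub>E A U"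
  by (auto simp: PiE_iff)

text \<open>Derivative with respect to a global coordinate of a function that sees only the states
  in \<open>A\<close>. The default 0 agrees with the input cells, which are 0 off the coordinates of
  their function.\<close>

definition loc :: "nat set \<Rightarrow> (state \<Rightarrow> real) \<Rightarrow> coord \<Rightarrow> state \<Rightarrow> real" where
  "loc A f c Y = (if c \<in> coords n A then partial c f (restrict Y A) else 0)"

lemma local_deriv:
  assumes "C1_on n U A f" "A \<subseteq> V" "Y \<in> Pi\<^sub>E V U" "c \<in> coords n V"
  shows "((\<lambda>t. f (restrict (upd Y c t) A)) has_real_derivative loc A f c Y) (at (coord_of Y c))"
proof (cases "fst c \<in> A")
  case True
  then have "c \<in> coords n A" using assms(4) by (auto simp: coords_def)
  moreover have "coord_of (restrict Y A) c = coord_of Y c" using True by (simp add: coord_of_def)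
  ultimately show ?thesis
    using C1_on_deriv[OF assms(1) _ restrict_in[OF assms(2,3)], of c] True
    by (simp add: restrict_upd loc_def)
next
  case False
  then have "c \<notin> coords n A" by (auto simp: coords_def)
  then show ?thesis using False by (simp add: restrict_upd loc_def)
qed

lemma local_deriv2:
  assumes "C2_on n U A f" "A \<subseteq> V" "Y \<in> Pi\<^sub>E V U" "c \<in> coords n V"
  shows "((\<lambda>t. loc A f d (upd Y c t)) has_real_derivative
      (if d \<in> coords n A then loc A (partial d f) c Y else 0)) (at (coord_of Y c))"
proof (cases "d \<in> coords n A")
  case True
  then have "C1_on n U A (partial d f)" using assms(1) by (auto simp: C2_on_def)
  from local_deriv[OF this assms(2-4)] show ?thesis using True by (simp add: loc_def[of _ _ d])
qed (simp add: loc_def)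

lemma constr_deriv:
  assumes "k \<in> coords n (noninput V E)" "Y \<in> Pi\<^sub>E V U" "c \<in> coords n V"
  shows "((\<lambda>t. constr E \<Phi> k (upd Y c t)) has_real_derivative
     loc (pa E (fst k)) (\<lambda>Z. \<Phi> (fst k) Z (snd k)) c Y - of_bool (c = k)) (at (coord_of Y c))"
proof -
  have "C1_on n U (pa E (fst k)) (\<lambda>Z. \<Phi> (fst k) Z (snd k))"
    using C2_Phi[of "fst k" "snd k"] assms(1) by (auto simp: C2_on_def coords_def)
  note 1 = local_deriv[OF this pa_subset assms(2,3)]
  have "(upd Y c t) (fst k) (snd k) = (if c = k then t else Y (fst k) (snd k))" for t
    by (cases c; cases k) (auto simp: upd_def)
  then have "((\<lambda>t. (upd Y c t) (fst k) (snd k)) has_real_derivative of_bool (c = k)) (at (coord_of Y c))"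
    by (cases "c = k") (auto intro!: derivative_eq_intros)
  with 1 show ?thesis unfolding constr_def by (rule DERIV_diff)
qed

lemma fhat_deriv:
  assumes "Y \<in> Pi\<^sub>E V U" "c \<in> coords n V"
  shows "((\<lambda>t. fhat V E l (upd Y c t)) has_real_derivative (\<Sum>v\<in>V. loc (fam E v) (l v) c Y)) (at (coord_of Y c))"
  unfolding fhat_def
  using C2_l fam_subset assms by (intro DERIV_sum local_deriv) (auto simp: C2_on_def)

lemma partial_fhat:
  assumes "c \<in> coords n V"
  shows "partial c (fhat V E l) X = (\<Sum>v\<in>V. st (In_dl v c))"
  unfolding partial_def DERIV_imp_deriv[OF fhat_deriv[OF X assms]]
  by (intro sum.cong) (auto simp: loc_def)

lemma partial_constr:
  assumes "k \<in> coords n (noninput V E)" "c \<in> coords n V"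
  shows "partial c (constr E \<Phi> k) X = st (In_dPhi k c) - of_bool (c = k)"
  unfolding partial_def DERIV_imp_deriv[OF constr_deriv[OF assms(1) X assms(2)]]
  using assms(1) by (auto simp: loc_def)

lemma constr_st:
  assumes "k \<in> coords n (noninput V E)"
  shows "constr E \<Phi> k X = st (In_Phi k) - st (In_X k)"
  using assms noninput_subset by (auto simp: constr_def coord_of_def coords_def)

definition dL :: "coord \<Rightarrow> state \<Rightarrow> real" where
  "dL c Y = (\<Sum>v\<in>V. loc (fam E v) (l v) c Y) +
     (\<Sum>v\<in>noninput V E. \<Sum>i<n v. \<mu> v i * (loc (pa E v) (\<lambda>Z. \<Phi> v Z i) c Y - of_bool (c = (v, i))))"

text \<open>Stated at every state and not just at the nominal point, since the result is
  differentiated once more.\<close>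

lemma partial_L:
  assumes "Y \<in> Pi\<^sub>E V U" "c \<in> coords n V"
  shows "partial c (Lagrangian V E n \<Phi> l \<mu>) Y = dL c Y"
proof -
  have "((\<lambda>t. Lagrangian V E n \<Phi> l \<mu> (upd Y c t)) has_real_derivative dL c Y) (at (coord_of Y c))"
    unfolding Lagrangian_def dL_def
  proof (intro DERIV_add fhat_deriv assms DERIV_sum DERIV_cmult)
    fix v i assume "v \<in> noninput V E" "i \<in> {..<n v}"
    then show "((\<lambda>t. constr E \<Phi> (v, i) (upd Y c t)) has_real_derivative
       loc (pa E v) (\<lambda>Z. \<Phi> v Z i) c Y - of_bool (c = (v, i))) (at (coord_of Y c))"
      using constr_deriv[of "(v, i)", OF _ assms] by (simp add: coords_def)
  qed
  then show ?thesis unfolding partial_def by (rule DERIV_imp_deriv)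
qed

lemma dL_deriv:
  assumes "c \<in> coords n V"
  shows "((\<lambda>t. dL d (upd X c t)) has_real_derivative
     (\<Sum>v\<in>V. if d \<in> coords n (fam E v) then loc (fam E v) (partial d (l v)) c X else 0) +
     (\<Sum>v\<in>noninput V E. \<Sum>i<n v. \<mu> v i *
        (if d \<in> coords n (pa E v) then loc (pa E v) (partial d (\<lambda>Z. \<Phi> v Z i)) c X else 0)))
     (at (coord_of X c))"
  unfolding dL_def
proof (intro DERIV_add DERIV_sum DERIV_cmult)
  fix v assume v: "v \<in> V"
  show "((\<lambda>t. loc (fam E v) (l v) d (upd X c t)) has_real_derivative
     (if d \<in> coords n (fam E v) then loc (fam E v) (partial d (l v)) c X else 0)) (at (coord_of X c))"
    by (rule local_deriv2[OF C2_l[OF v] fam_subset[OF v] X assms])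
next
  fix v i assume v: "v \<in> noninput V E" "i \<in> {..<n v}"
  have "((\<lambda>t. loc (pa E v) (\<lambda>Z. \<Phi> v Z i) d (upd X c t) - of_bool (d = (v, i))) has_real_derivative
     (if d \<in> coords n (pa E v) then loc (pa E v) (partial d (\<lambda>Z. \<Phi> v Z i)) c X else 0) - 0)
     (at (coord_of X c))"
    using v by (intro DERIV_diff DERIV_const local_deriv2[OF C2_Phi pa_subset X assms]) auto
  then show "((\<lambda>t. loc (pa E v) (\<lambda>Z. \<Phi> v Z i) d (upd X c t) - of_bool (d = (v, i))) has_real_derivative
     (if d \<in> coords n (pa E v) then loc (pa E v) (partial d (\<lambda>Z. \<Phi> v Z i)) c X else 0))
     (at (coord_of X c))" by simp
qed

lemma hess_st:
  assumes c: "c \<in> coords n V" and d: "d \<in> coords n V"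
  shows "hess_L V E n \<Phi> l X \<mu> c d =
    (\<Sum>v\<in>V. st (In_ddl v c d) + (\<Sum>i<n v. st (In_lam (v, i)) * st (In_ddPhi (v, i) c d)))"
proof -
  let ?A = "\<Sum>v\<in>V. if d \<in> coords n (fam E v) then loc (fam E v) (partial d (l v)) c X else 0"
  let ?B = "\<lambda>v. \<Sum>i<n v. \<mu> v i * (if d \<in> coords n (pa E v) then loc (pa E v) (partial d (\<lambda>Z. \<Phi> v Z i)) c X else 0)"
  \<comment> \<open>The formula \<open>dL\<close> is available on states only; openness makes it
    hold near the nominal point, which suffices for a derivative.\<close>
  have ev: "\<forall>\<^sub>F t in nhds (coord_of X c). partial d (Lagrangian V E n \<Phi> l \<mu>) (upd X c t) = dL d (upd X c t)"
    using eventually_upd_in[OF openU X c] by (rule eventually_mono) (auto intro: partial_L d)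
  have "hess_L V E n \<Phi> l X \<mu> c d = deriv (\<lambda>t. dL d (upd X c t)) (coord_of X c)"
    unfolding hess_L_def partial_def[of c] by (rule deriv_cong_ev[OF ev refl])
  also have "\<dots> = ?A + (\<Sum>v\<in>noninput V E. ?B v)"
    by (rule DERIV_imp_deriv[OF dL_deriv[OF c]])
  also have "?A = (\<Sum>v\<in>V. st (In_ddl v c d))"
    by (intro sum.cong) (auto simp: loc_def)
  also have "(\<Sum>v\<in>noninput V E. ?B v) = (\<Sum>v\<in>noninput V E. \<Sum>i<n v. st (In_lam (v, i)) * st (In_ddPhi (v, i) c d))"
    by (intro sum.cong) (auto simp: loc_def coords_def coord_of_def)
  \<comment> \<open>Input vertices may join the sum because their multiplier cells read 0.\<close>
  also have "\<dots> = (\<Sum>v\<in>V. \<Sum>i<n v. st (In_lam (v, i)) * st (In_ddPhi (v, i) c d))"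
    using finV noninput_subset by (intro sum.mono_neutral_left) (auto simp: coords_def)
  finally show ?thesis by (simp add: sum.distrib)
qed

text \<open>Schwarz is applied to each local function in its own coordinates; where a coordinate is
  foreign to it, both input cells read 0.\<close>

lemma hess_sym:
  assumes c: "c \<in> coords n V" and d: "d \<in> coords n V"
  shows "hess_L V E n \<Phi> l X \<mu> c d = hess_L V E n \<Phi> l X \<mu> d c"
proof -
  have sym: "partial c (partial d f) (restrict X A) = partial d (partial c f) (restrict X A)"
    if "C2_on n U A f" "A \<subseteq> V" "c \<in> coords n A" "d \<in> coords n A" for A f
    by (rule C2_on_symmetric[OF _ that(1) restrict_in[OF that(2) X] that(3,4)])
      (use openU that(2) in blast)
  have "st (In_ddl v c d) = st (In_ddl v d c)" if "v \<in> V" for v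
    using sym[OF C2_l[OF that] fam_subset[OF that]] by auto
  moreover have "st (In_ddPhi (v, i) c d) = st (In_ddPhi (v, i) d c)" if "v \<in> V" "i < n v" for v i
    using sym[OF C2_Phi pa_subset, of v i] by (auto simp: coords_def[of n "noninput V E"])
  ultimately show ?thesis
    unfolding hess_st[OF c d] hess_st[OF d c] by (intro sum.cong arg_cong2[where f = "(+)"]) auto
qed

lemma KKT_solvable:
  assumes "QP_attained V E n \<Phi> l X \<mu>"
  shows "\<exists>\<delta> \<nu>. solves_KKT V E n \<Phi> l X \<mu> \<delta> \<nu>"
  using QP_attained_imp_KKT[OF finV hess_sym assms] by blast

end


section \<open>The KKT system on a tree-decomposition\<close>

lemma children_sum:
  fixes B :: "nat \<Rightarrow> real"
  assumes "finite T"
  shows "(\<Sum>t\<in>T. \<Sum>s\<in>{s \<in> T. 0 < s \<and> q s = t}. B s) = (\<Sum>s\<in>{s \<in> T. 0 < s \<and> q s \<in> T}. B s)"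
proof -
  have "(\<Sum>t\<in>T. \<Sum>s\<in>{s \<in> T. 0 < s \<and> q s = t}. B s) = (\<Sum>t\<in>T. \<Sum>s\<in>T. if 0 < s \<and> q s = t then B s else 0)"
    using assms by (intro sum.cong refl sum.inter_filter)
  also have "\<dots> = (\<Sum>s\<in>T. \<Sum>t\<in>T. if 0 < s \<and> q s = t then B s else 0)"
    by (rule sum.swap)
  also have "\<dots> = (\<Sum>s\<in>T. if 0 < s \<and> q s \<in> T then B s else 0)"
  proof (intro sum.cong refl)
    fix s assume "s \<in> T"
    have "(\<Sum>t\<in>T. if 0 < s \<and> q s = t then B s else 0) = (\<Sum>t\<in>T. if q s = t then (if 0 < s then B s else 0) else 0)"
      by (intro sum.cong) auto
    then show "(\<Sum>t\<in>T. if 0 < s \<and> q s = t then B s else 0) = (if 0 < s \<and> q s \<in> T then B s else 0)"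
      using assms by simp
  qed
  finally show ?thesis using assms by (simp add: sum.inter_filter)
qed

text \<open>Each message enters once with sign plus at its receiver and once with sign minus at its
  sender, so summing the local equations cancels all of them.\<close>

lemma messages_sum:
  fixes B g :: "nat \<Rightarrow> real"
  assumes "finite T"
    and "\<And>t. t \<in> T \<Longrightarrow>
      g t + (\<Sum>s\<in>{s \<in> T. 0 < s \<and> q s = t}. B s) - (if 0 < t \<and> q t \<in> T then B t else 0) = 0"
  shows "(\<Sum>t\<in>T. g t) = 0"
proof -
  have "0 = (\<Sum>t\<in>T. g t + (\<Sum>s\<in>{s \<in> T. 0 < s \<and> q s = t}. B s) - (if 0 < t \<and> q t \<in> T then B t else 0))"
    using assms(2) by simp
  also have "\<dots> = (\<Sum>t\<in>T. g t)"
    unfolding sum.distrib sum_subtractf children_sum[OF assms(1)]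
    using assms(1) by (simp add: sum.inter_filter)
  finally show ?thesis by simp
qed

text \<open>Recursion from the leaves: the sum runs over larger indices only, so \<open>B\<close> is
  corrected at one index at a time, downward from \<open>m\<close>.\<close>

lemma upward_recursion:
  fixes g :: "nat \<Rightarrow> real"
  assumes "T \<subseteq> {..<m}"
  shows "\<exists>B. \<forall>t. B t = g t + (\<Sum>s\<in>{s \<in> T. t < s \<and> q s = t}. B s)"
proof -
  have "\<exists>B. \<forall>t. m \<le> t + k \<longrightarrow> B t = g t + (\<Sum>s\<in>{s \<in> T. t < s \<and> q s = t}. B s)" for k
  proof (induction k)
    case 0
    have "(\<Sum>s\<in>{s \<in> T. t < s \<and> q s = t}. g s) = 0" if "m \<le> t" for t
      using assms that by (intro sum.neutral) fastforce
    then show ?case by (intro exI[of _ g]) simp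
  next
    case (Suc k)
    then obtain B where B: "\<forall>t. m \<le> t + k \<longrightarrow> B t = g t + (\<Sum>s\<in>{s \<in> T. t < s \<and> q s = t}. B s)" ..
    show ?case
    proof (cases "m \<le> k")
      case True
      then have "m \<le> t + k" for t by simp
      then show ?thesis using B by (intro exI[of _ B] allI impI) blast
    next
      case False
      define t0 where "t0 = m - Suc k"
      define B' where "B' = B(t0 := g t0 + (\<Sum>s\<in>{s \<in> T. t0 < s \<and> q s = t0}. B s))"
      have "B' t = g t + (\<Sum>s\<in>{s \<in> T. t < s \<and> q s = t}. B' s)" if "m \<le> t + Suc k" for t
      proof -
        have "t0 \<le> t" using that by (simp add: t0_def)
        then have "(\<Sum>s\<in>{s \<in> T. t < s \<and> q s = t}. B' s) = (\<Sum>s\<in>{s \<in> T. t < s \<and> q s = t}. B s)"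
          by (intro sum.cong) (auto simp: B'_def)
        moreover have "t = t0 \<or> m \<le> t + k" using that False by (auto simp: t0_def)
        ultimately show ?thesis
          using B[rule_format, of t] by (cases "t = t0") (auto simp: B'_def)
      qed
      then show ?thesis by (intro exI[of _ B'] allI impI)
    qed
  qed
  from this[of m] show ?thesis by simp
qed

text \<open>The message \<open>B t\<close> is the partial sum of \<open>g\<close> over the descendants of \<open>t\<close>.\<close>

lemma messages_exist:
  fixes g :: "nat \<Rightarrow> real"
  assumes T: "T \<subseteq> {..<m}" and q: "\<And>t. t < m \<Longrightarrow> 0 < t \<Longrightarrow> q t < t"
    and apex: "\<exists>!t. t \<in> T \<and> \<not> (0 < t \<and> q t \<in> T)"
    and g: "(\<Sum>t\<in>T. g t) = 0"
  shows "\<exists>B. \<forall>t\<in>T.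
    g t + (\<Sum>s\<in>{s \<in> T. 0 < s \<and> q s = t}. B s) - (if 0 < t \<and> q t \<in> T then B t else 0) = 0"
proof -
  obtain B where B: "\<forall>t. B t = g t + (\<Sum>s\<in>{s \<in> T. t < s \<and> q s = t}. B s)"
    using upward_recursion[OF T, of g q] ..
  have "{s \<in> T. t < s \<and> q s = t} = {s \<in> T. 0 < s \<and> q s = t}" for t
    using T q by fastforce
  then have B': "B t = g t + (\<Sum>s\<in>{s \<in> T. 0 < s \<and> q s = t}. B s)" for t
    using B[rule_format, of t] by simp
  have fin: "finite T" using T finite_subset by blast
  obtain \<tau> where \<tau>: "\<tau> \<in> T" "\<not> (0 < \<tau> \<and> q \<tau> \<in> T)"
    and uniq: "\<And>t. t \<in> T \<Longrightarrow> \<not> (0 < t \<and> q t \<in> T) \<Longrightarrow> t = \<tau>"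
    using apex by metis
  have set: "{s \<in> T. 0 < s \<and> q s \<in> T} = T - {\<tau>}"
    using \<tau> uniq by blast
  \<comment> \<open>Summing the recursion over \<open>T\<close> counts every message again except
    that of the apex \<tau>, so a zero total means that the apex has nothing to send.\<close>
  have "(\<Sum>t\<in>T. B t) = (\<Sum>t\<in>T. g t) + (\<Sum>t\<in>T. \<Sum>s\<in>{s \<in> T. 0 < s \<and> q s = t}. B s)"
    unfolding sum.distrib[symmetric] by (intro sum.cong refl B')
  also have "\<dots> = (\<Sum>s\<in>T - {\<tau>}. B s)"
    using g by (simp add: children_sum[OF fin] set)
  also have "\<dots> = (\<Sum>t\<in>T. B t) - B \<tau>"
    using fin \<tau>(1) by (simp add: sum_diff1)
  finally have "B \<tau> = 0" by simp
  then have "g t + (\<Sum>s\<in>{s \<in> T. 0 < s \<and> q s = t}. B s) - (if 0 < t \<and> q t \<in> T then B t else 0) = 0"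
    if "t \<in> T" for t
    using B'[of t] uniq[OF that] \<tau> by auto
  then show ?thesis by (intro exI[of _ B] ballI)
qed

text \<open>
  The unknowns are the components of \<open>\<delta>\<close> and \<open>\<lambda>\<close> and, in \<open>VB t c\<close>, the partial sum of the
  stationarity equation of \<open>c\<close> that node \<open>t\<close> passes to its parent \<open>q t\<close>.
\<close>

datatype var = VD coord | VL coord | VB nat coord

instance var :: countable
  by countable_datatype

lemma finite_coords [simp]: "finite A \<Longrightarrow> finite (coords n A)"
  by (simp add: coords_def)

lemma coords_iff: "c \<in> coords n A \<longleftrightarrow> fst c \<in> A \<and> snd c < n (fst c)"
  by (cases c) (auto simp: coords_def)

lemma card_coords_le:
  assumes "finite A" "\<And>v. v \<in> A \<Longrightarrow> n v \<le> N"
  shows "card (coords n A) \<le> card A * N"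
proof -
  have "card (coords n A) = (\<Sum>v\<in>A. n v)" using assms(1) by (simp add: coords_def)
  also have "\<dots> \<le> (\<Sum>v\<in>A. N)" using assms(2) by (intro sum_mono)
  finally show ?thesis by simp
qed

definition slist :: "'a set \<Rightarrow> 'a list" where
  "slist A = (SOME xs. set xs = A \<and> distinct xs)"

lemma slist: "finite A \<Longrightarrow> set (slist A) = A \<and> distinct (slist A)"
  unfolding slist_def by (rule someI_ex) (use finite_distinct_list in blast)

lemma length_slist: "finite A \<Longrightarrow> length (slist A) = card A"
  using slist distinct_card by metis

lemma sum_slist: "finite A \<Longrightarrow> (\<Sum>x\<leftarrow>slist A. f x) = (\<Sum>x\<in>A. f x)" for f :: "'a \<Rightarrow> real"
  using slist[of A] by (simp add: sum_list_distinct_conv_sum_set)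

text \<open>Only combinatorial data are fixed here, so a program built in this locale cannot depend
  on numbers. \<open>w\<close> stands for the width read as at least 1, and \<open>4 * w\<close>
  bounds the doubled bags.\<close>

locale decomposed =
  fixes V E n and N m w :: nat and q :: "nat \<Rightarrow> nat" and D :: "nat \<Rightarrow> nat set"
  assumes V_fin: "finite V" and fam_V: "\<And>v. v \<in> V \<Longrightarrow> fam E v \<subseteq> V"
    and n_le: "\<And>v. v \<in> V \<Longrightarrow> n v \<le> N" and w: "1 \<le> w"
    and q: "\<And>t. t < m \<Longrightarrow> 0 < t \<Longrightarrow> q t < t"
    and two_children: "\<And>t. t < m \<Longrightarrow> card {s. s < m \<and> 0 < s \<and> q s = t} \<le> 2"
    and D_V: "\<And>t. t < m \<Longrightarrow> D t \<subseteq> V" and D_card: "\<And>t. t < m \<Longrightarrow> card (D t) \<le> 4 * w"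
    and cover: "\<And>v. v \<in> V \<Longrightarrow> \<exists>t<m. fam E v \<subseteq> D t"
    and apex: "\<And>v. v \<in> V \<Longrightarrow> \<exists>!t. t < m \<and> v \<in> D t \<and> \<not> (0 < t \<and> v \<in> D (q t))"
begin

text \<open>Every vertex is charged to one bag holding its family, so that its local terms are
  counted exactly once.\<close>

definition node :: "nat \<Rightarrow> nat" where
  "node v = (SOME t. t < m \<and> fam E v \<subseteq> D t)"

definition own :: "nat \<Rightarrow> nat set" where
  "own t = {v \<in> V. node v = t}"

definition children :: "nat \<Rightarrow> nat set" where
  "children t = {s. s < m \<and> 0 < s \<and> q s = t}"

definition mult :: "nat \<Rightarrow> coord set" where
  "mult t = coords n (own t \<inter> noninput V E)"

text \<open>Besides states, a node sees the multipliers of its own vertices, its outgoing messages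
  and those of its at most two children. This makes at most five groups of size at most
  \<open>kappa\<close>.\<close>

definition cluster :: "nat \<Rightarrow> var set" where
  "cluster t = VD ` coords n (D t) \<union> (VL ` mult t \<union>
     (VB t ` coords n (D t) \<union> (\<Union>s\<in>children t. VB s ` coords n (D s))))"

lemma node: "v \<in> V \<Longrightarrow> node v < m \<and> fam E v \<subseteq> D (node v)"
  unfolding node_def by (rule someI_ex) (use cover in blast)

lemma own_D: "t < m \<Longrightarrow> own t \<subseteq> D t"
  using node by (auto simp: own_def fam_def)

lemma D_fin: "t < m \<Longrightarrow> finite (D t)"
  using D_V V_fin finite_subset by blast

lemma own_fin [simp]: "finite (own t)"
  using V_fin by (simp add: own_def)

lemma mult_fin [simp]: "finite (mult t)"
  by (simp add: mult_def)

lemma children_fin [simp]: "finite (children t)"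
  by (simp add: children_def)

lemma children_less: "s \<in> children t \<Longrightarrow> t < s \<and> s < m"
  using q by (auto simp: children_def)

definition kappa :: nat where "kappa = 4 * w * N"

lemma card_D: "t < m \<Longrightarrow> card (coords n (D t)) \<le> kappa"
proof -
  assume t: "t < m"
  have "card (coords n (D t)) \<le> card (D t) * N"
    using D_V[OF t] n_le by (intro card_coords_le D_fin t) auto
  also have "\<dots> \<le> kappa" using D_card[OF t] by (simp add: kappa_def)
  finally show ?thesis .
qed

lemma card_own: "t < m \<Longrightarrow> card (own t) \<le> 4 * w"
  using card_mono[OF D_fin own_D] D_card by (meson order_trans)

lemma card_mult: "t < m \<Longrightarrow> card (mult t) \<le> kappa"
proof -
  assume t: "t < m"
  have "mult t \<subseteq> coords n (D t)" using own_D[OF t] by (auto simp: mult_def coords_def)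
  then show ?thesis using card_mono[of "coords n (D t)" "mult t"] card_D[OF t] D_fin[OF t] by simp
qed

lemma sum_cluster:
  fixes f :: "var \<Rightarrow> real"
  assumes t: "t < m"
  shows "(\<Sum>x\<in>cluster t. f x) = (\<Sum>d\<in>coords n (D t). f (VD d)) + (\<Sum>k\<in>mult t. f (VL k)) +
    (\<Sum>c\<in>coords n (D t). f (VB t c)) + (\<Sum>s\<in>children t. \<Sum>c\<in>coords n (D s). f (VB s c))"
proof -
  have fin: "finite (coords n (D t))" "\<And>s. s \<in> children t \<Longrightarrow> finite (coords n (D s))"
    using D_fin t children_less by auto
  have "(\<Sum>x\<in>(\<Union>s\<in>children t. VB s ` coords n (D s)). f x) =
      (\<Sum>s\<in>children t. \<Sum>x\<in>VB s ` coords n (D s). f x)"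
    using fin by (intro sum.UNION_disjoint) auto
  also have "\<dots> = (\<Sum>s\<in>children t. \<Sum>c\<in>coords n (D s). f (VB s c))"
    by (intro sum.cong refl) (simp add: sum.reindex inj_on_def)
  finally have 1: "(\<Sum>x\<in>(\<Union>s\<in>children t. VB s ` coords n (D s)). f x) =
      (\<Sum>s\<in>children t. \<Sum>c\<in>coords n (D s). f (VB s c))" .
  have disj: "VB t ` coords n (D t) \<inter> (\<Union>s\<in>children t. VB s ` coords n (D s)) = {}"
    using children_less by fastforce
  define P Q R S where "P = VD ` coords n (D t)" and "Q = VL ` mult t"
    and "R = VB t ` coords n (D t)" and "S = (\<Union>s\<in>children t. VB s ` coords n (D s))"
  have finS: "finite P" "finite Q" "finite R" "finite S"
    using fin by (auto simp: P_def Q_def R_def S_def)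
  have disj': "P \<inter> (Q \<union> (R \<union> S)) = {}" "Q \<inter> (R \<union> S) = {}"
    by (auto simp: P_def Q_def R_def S_def)
  have "R \<inter> S = {}" using disj by (simp add: R_def S_def)
  then have "(\<Sum>x\<in>cluster t. f x) = sum f P + (sum f Q + (sum f R + sum f S))"
    unfolding cluster_def P_def[symmetric] Q_def[symmetric] R_def[symmetric] S_def[symmetric]
    using finS disj' by (simp add: sum.union_disjoint)
  then show ?thesis
    using 1 by (simp add: P_def Q_def R_def S_def sum.reindex inj_on_def)
qed

lemma cluster_fin: "t < m \<Longrightarrow> finite (cluster t)"
  using D_fin children_less by (auto simp: cluster_def)

lemma card_cluster:
  assumes t: "t < m"
  shows "card (cluster t) \<le> 5 * kappa"
proof -
  have 1: "card (VD ` coords n (D t)) \<le> kappa" "card (VL ` mult t) \<le> kappa" "card (VB t ` coords n (D t)) \<le> kappa"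
    using card_D[OF t] card_mult[OF t] by (auto simp: card_image inj_on_def)
  have "card (\<Union>s\<in>children t. VB s ` coords n (D s)) \<le> (\<Sum>s\<in>children t. card (VB s ` coords n (D s)))"
    by (rule card_UN_le) simp
  also have "\<dots> \<le> (\<Sum>s\<in>children t. kappa)"
    using card_D children_less by (intro sum_mono) (simp add: card_image inj_on_def)
  also have "\<dots> \<le> 2 * kappa"
    using two_children[OF t] by (simp add: children_def)
  finally have 2: "card (\<Union>s\<in>children t. VB s ` coords n (D s)) \<le> 2 * kappa" .
  have "card (cluster t) \<le> card (VD ` coords n (D t)) + (card (VL ` mult t) +
    (card (VB t ` coords n (D t)) + card (\<Union>s\<in>children t. VB s ` coords n (D s))))"
    unfolding cluster_def by (intro order_trans[OF card_Un_le] add_left_mono) simp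
  then show ?thesis using 1 2 by linarith
qed

text \<open>A message lives at its sender and at its receiver \<open>q s\<close>, the upper of the
  two; the root has no receiver. A multiplier lives at one node only.\<close>

fun top_node :: "var \<Rightarrow> nat" where
  "top_node (VD c) = (THE t. t < m \<and> fst c \<in> D t \<and> \<not> (0 < t \<and> fst c \<in> D (q t)))"
| "top_node (VL k) = node (fst k)"
| "top_node (VB s c) = (if 0 < s then q s else 0)"

lemma top_node:
  assumes t: "t < m" and x: "x \<in> cluster t"
  shows "t = top_node x \<or> 0 < t \<and> x \<in> cluster (q t)"
proof (cases x)
  case (VD c)
  then have c: "c \<in> coords n (D t)" using x by (auto simp: cluster_def)
  then have "fst c \<in> V" using D_V[OF t] by (auto simp: coords_def)
  then show ?thesis
  proof (cases "0 < t \<and> fst c \<in> D (q t)")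
    case True
    then show ?thesis using VD c by (auto simp: cluster_def coords_iff)
  next
    case False
    then have "top_node x = t"
      unfolding VD top_node.simps using c t apex[OF \<open>fst c \<in> V\<close>]
      by (intro the1_equality) (auto simp: coords_iff)
    then show ?thesis by simp
  qed
next
  case (VL k)
  then have "k \<in> mult t" using x by (auto simp: cluster_def)
  then show ?thesis using VL by (auto simp: mult_def own_def coords_iff)
next
  case (VB s c)
  then have "s = t \<and> c \<in> coords n (D t) \<or> s \<in> children t \<and> c \<in> coords n (D s)"
    using x by (auto simp: cluster_def)
  then show ?thesis
    using VB t by (auto simp: cluster_def children_def)
qed

section \<open>Rows of the local system\<close>

definition hess_exp :: "nat \<Rightarrow> coord \<Rightarrow> coord \<Rightarrow> exp" where
  "hess_exp v c d = Bin Add (Var (In_ddl v c d))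
     (esum (map (\<lambda>i. Bin Mul (Var (In_lam (v, i))) (Var (In_ddPhi (v, i) c d))) [0..<n v]))"

definition jac_exp :: "coord \<Rightarrow> coord \<Rightarrow> exp" where
  "jac_exp k d = Bin Sub (Var (In_dPhi k d)) (Cst (of_bool (d = k)))"

text \<open>Incoming messages enter with 1, the outgoing one with -1. At the apex of
  \<open>c\<close> the outgoing message gets coefficient 0, so there the row demands that the
  accumulated sum vanish.\<close>

fun stat_coeff :: "nat \<Rightarrow> coord \<Rightarrow> var \<Rightarrow> exp" where
  "stat_coeff t c (VD d) = esum (map (\<lambda>v. hess_exp v c d) (slist (own t)))"
| "stat_coeff t c (VL k) = jac_exp k c"
| "stat_coeff t c (VB s d) =
     (if d = c then Cst (if s = t then - of_bool (0 < t \<and> fst c \<in> D (q t)) else 1) else Cst 0)"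

definition stat_row :: "nat \<Rightarrow> coord \<Rightarrow> (var \<Rightarrow> exp) \<times> exp" where
  "stat_row t c =
     (stat_coeff t c, Bin Sub (Cst 0) (esum (map (\<lambda>v. Var (In_dl v c)) (slist (own t)))))"

fun constr_coeff :: "coord \<Rightarrow> var \<Rightarrow> exp" where
  "constr_coeff k (VD d) = jac_exp k d"
| "constr_coeff k _ = Cst 0"

definition constr_row :: "coord \<Rightarrow> (var \<Rightarrow> exp) \<times> exp" where
  "constr_row k = (constr_coeff k, Bin Sub (Var (In_X k)) (Var (In_Phi k)))"

definition rows :: "nat \<Rightarrow> ((var \<Rightarrow> exp) \<times> exp) list" where
  "rows t = map (stat_row t) (slist (coords n (D t))) @ map constr_row (slist (mult t))"

lemma length_rows: "t < m \<Longrightarrow> length (rows t) \<le> 2 * kappa"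
  using card_D[of t] card_mult[of t] D_fin[of t] by (simp add: rows_def length_slist)

lemma rows_iff:
  "t < m \<Longrightarrow> r \<in> set (rows t) \<longleftrightarrow>
    (\<exists>c\<in>coords n (D t). r = stat_row t c) \<or> (\<exists>k\<in>mult t. r = constr_row k)"
  using D_fin[of t] by (auto simp: rows_def slist)

text \<open>At most \<open>4 * w\<close> owned vertices contribute a Hessian expression of size at
  most \<open>4 * N + 3\<close> and one addition each; the final 3 also covers the Jacobian
  expressions and the negation on the right-hand side.\<close>

definition ell :: nat where "ell = 4 * w * (4 * N + 4) + 3"

lemma rows_exps:
  assumes t: "t < m" and r: "(a, \<beta>) \<in> set (rows t)"
  shows "input_exp (a x) \<and> esize (a x) \<le> ell" and "input_exp \<beta> \<and> esize \<beta> \<le> ell"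
proof -
  have own: "set (slist (own t)) = own t" "length (slist (own t)) \<le> 4 * w"
    using card_own[OF t] by (simp_all add: slist length_slist)
  have jac: "input_exp (jac_exp k d) \<and> esize (jac_exp k d) \<le> 3" for k d
    by (auto simp: jac_exp_def input_exp_def)
  have hess: "input_exp (hess_exp v c d) \<and> esize (hess_exp v c d) \<le> 4 * N + 3" if "v \<in> own t" for v c d
  proof -
    let ?es = "map (\<lambda>i. Bin Mul (Var (In_lam (v, i))) (Var (In_ddPhi (v, i) c d))) [0..<n v]"
    have "esize (esum ?es) \<le> length ?es * (3 + 1) + 1"
      by (rule esize_esum) auto
    moreover have "n v \<le> N" using n_le that by (simp add: own_def)
    ultimately show ?thesis by (auto simp: hess_exp_def input_exp_def)
  qed
  have hess': "esize (esum (map (\<lambda>v. hess_exp v c d) (slist (own t)))) \<le> ell" for c d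
  proof -
    have "esize (esum (map (\<lambda>v. hess_exp v c d) (slist (own t))))
        \<le> length (map (\<lambda>v. hess_exp v c d) (slist (own t))) * ((4 * N + 3) + 1) + 1"
      using hess[of _ c d] own by (intro esize_esum) auto
    also have "\<dots> \<le> 4 * w * (4 * N + 4) + 1"
      using mult_le_mono1[OF own(2), of "4 * N + 4"] by (simp add: add.commute)
    finally show ?thesis by (simp add: ell_def)
  qed
  have hess'': "input_exp (esum (map (\<lambda>v. hess_exp v c d) (slist (own t))))" for c d
    using hess[of _ c d] own by (auto simp: input_exp_def)
  have dl: "esize (esum (map (\<lambda>v. Var (In_dl v c)) (slist (own t)))) + 2 \<le> ell" for c
  proof -
    have "esize (esum (map (\<lambda>v. Var (In_dl v c)) (slist (own t))))
        \<le> length (map (\<lambda>v. Var (In_dl v c)) (slist (own t))) * (1 + 1) + 1"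
      by (intro esize_esum) auto
    also have "\<dots> \<le> 4 * w * (4 * N + 4) + 1"
      using mult_le_mono[OF own(2), of 2 "4 * N + 4"] by simp
    finally show ?thesis by (simp add: ell_def)
  qed
  have ell: "3 \<le> ell" by (simp add: ell_def)
  have jac': "input_exp (jac_exp k d) \<and> esize (jac_exp k d) \<le> ell" for k d
    using jac[of k d] ell by simp
  have cst: "input_exp (Cst i) \<and> esize (Cst i) \<le> ell" for i
    using ell by (simp add: input_exp_def)
  have stat: "input_exp (stat_coeff t c x) \<and> esize (stat_coeff t c x) \<le> ell" for c
  proof (cases x)
    case (VD d)
    then show ?thesis using hess'[of c d] hess''[of c d] by (simp only: stat_coeff.simps)
  next
    case (VL k)
    then show ?thesis using jac'[of k c] by (simp only: stat_coeff.simps)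
  next
    case (VB s d)
    then show ?thesis using cst by (simp only: stat_coeff.simps split: if_split) blast
  qed
  have con: "input_exp (constr_coeff k x) \<and> esize (constr_coeff k x) \<le> ell" for k
    using jac'[of k] cst[of 0] by (cases x) (simp_all only: constr_coeff.simps)
  show "input_exp (a x) \<and> esize (a x) \<le> ell"
    using r stat con by (auto simp: rows_iff[OF t] stat_row_def constr_row_def)
  show "input_exp \<beta> \<and> esize \<beta> \<le> ell"
    using r dl ell by (auto simp: rows_iff[OF t] stat_row_def constr_row_def input_exp_def)
qed

text \<open>\<open>K\<close> dominates \<open>5 * kappa = 20 * N * w\<close>; the extra
  \<open>w\<close> keeps it positive when \<open>N\<close> is 0.\<close>

lemma node_solver:
  defines "K \<equiv> (20 * N + 1) * w"
  shows "\<exists>as. admissible as \<and> cost as \<le> m * (2 * K\<^sup>2 * (4 * ell + 2) + 154 * K ^ 3) \<and>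
    (\<forall>s. (\<forall>i. s (Work i) = 0) \<longrightarrow>
      (\<exists>u. \<forall>t<m. \<forall>(a, \<beta>)\<in>set (rows t). (\<Sum>x\<in>cluster t. ev s (a x) * u x) = ev s \<beta>) \<longrightarrow>
      (\<forall>t<m. \<forall>(a, \<beta>)\<in>set (rows t). (\<Sum>x\<in>cluster t. ev s (a x) * exec as s (wk (Sol x))) = ev s \<beta>))"
proof (rule sparse_solver)
  show "q t < t" if "t < m" "0 < t" for t using q that .
  show "t = top_node x \<or> 0 < t \<and> x \<in> cluster (q t)" if "t < m" "x \<in> cluster t" for t x
    using top_node that .
  have K: "5 * kappa \<le> K" using w by (simp add: K_def kappa_def algebra_simps)
  show "1 \<le> K" using w by (simp add: K_def)
  show "finite (cluster t) \<and> card (cluster t) \<le> K" if "t < m" for t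
    using cluster_fin card_cluster that K by (meson order_trans)
  show "length (rows t) \<le> K" if "t < m" for t
    using length_rows[OF that] K by simp
  show "input_exp (a x) \<and> esize (a x) \<le> ell" if "t < m" "(a, \<beta>) \<in> set (rows t)" for t a \<beta> x
    using rows_exps(1)[OF that] .
  show "input_exp \<beta> \<and> esize \<beta> \<le> ell" if "t < m" "(a, \<beta>) \<in> set (rows t)" for t a \<beta>
    using rows_exps(2)[OF that] .
qed

end

section \<open>Equivalence of the local system with the KKT system\<close>

locale decomposed_kkt = decomposed V E n N m w q D + kkt_data V E n U \<Phi> l X \<mu>
  for V E n N m w q D U \<Phi> l X \<mu>
begin

definition hess_at :: "nat \<Rightarrow> coord \<Rightarrow> coord \<Rightarrow> real" where
  "hess_at v c d = st (In_ddl v c d) + (\<Sum>i<n v. st (In_lam (v, i)) * st (In_ddPhi (v, i) c d))"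

definition jac :: "coord \<Rightarrow> coord \<Rightarrow> real" where
  "jac k d = st (In_dPhi k d) - of_bool (d = k)"

text \<open>The share of vertex \<open>v\<close> in the stationarity equation of \<open>c\<close>,
  gradient included. It vanishes unless \<open>c\<close> belongs to the family of \<open>v\<close>,
  which places it in the bag of \<open>node v\<close>.\<close>

definition residual :: "(coord \<Rightarrow> real) \<Rightarrow> (coord \<Rightarrow> real) \<Rightarrow> nat \<Rightarrow> coord \<Rightarrow> real" where
  "residual \<delta> \<nu> v c = (\<Sum>d\<in>coords n V. hess_at v c d * \<delta> d)
     + (if v \<in> noninput V E then \<Sum>i<n v. jac (v, i) c * \<nu> (v, i) else 0) + st (In_dl v c)"

lemma coords_pa_fam: "c \<in> coords n (pa E v) \<Longrightarrow> c \<in> coords n (fam E v)"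
  by (auto simp: coords_iff fam_def)

lemma hess_at_zero:
  assumes "c \<notin> coords n (fam E v) \<or> d \<notin> coords n (fam E v)"
  shows "hess_at v c d = 0"
proof -
  have "\<not> (c \<in> coords n (pa E v) \<and> d \<in> coords n (pa E v))"
    using assms coords_pa_fam by blast
  then show ?thesis using assms by (auto simp: hess_at_def)
qed

lemma jac_zero:
  assumes "k \<in> coords n (noninput V E)" "c \<notin> coords n (fam E (fst k))"
  shows "jac k c = 0"
proof -
  have "c \<noteq> k" using assms by (auto simp: coords_iff fam_def)
  moreover have "c \<notin> coords n (pa E (fst k))" using assms(2) coords_pa_fam by blast
  ultimately show ?thesis by (simp add: jac_def)
qed

lemma residual_zero:
  assumes "c \<notin> coords n (fam E v)"
  shows "residual \<delta> \<nu> v c = 0"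
  using assms hess_at_zero jac_zero[of "(v, _)" c]
  by (auto simp: residual_def coords_iff intro!: sum.neutral)

lemma KKT_residual:
  assumes c: "c \<in> coords n V"
  shows "(\<Sum>d\<in>coords n V. hess_L V E n \<Phi> l X \<mu> c d * \<delta> d)
      + (\<Sum>k\<in>coords n (noninput V E). partial c (constr E \<Phi> k) X * \<nu> k) + partial c (fhat V E l) X
    = (\<Sum>v\<in>V. residual \<delta> \<nu> v c)"
proof -
  have "(\<Sum>d\<in>coords n V. hess_L V E n \<Phi> l X \<mu> c d * \<delta> d)
      = (\<Sum>d\<in>coords n V. \<Sum>v\<in>V. hess_at v c d * \<delta> d)"
    using c by (intro sum.cong refl) (simp only: hess_st hess_at_def[symmetric] sum_distrib_right)
  also have "\<dots> = (\<Sum>v\<in>V. \<Sum>d\<in>coords n V. hess_at v c d * \<delta> d)"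
    by (rule sum.swap)
  finally have 1: "(\<Sum>d\<in>coords n V. hess_L V E n \<Phi> l X \<mu> c d * \<delta> d)
      = (\<Sum>v\<in>V. \<Sum>d\<in>coords n V. hess_at v c d * \<delta> d)" .
  have "(\<Sum>k\<in>coords n (noninput V E). partial c (constr E \<Phi> k) X * \<nu> k)
      = (\<Sum>k\<in>coords n (noninput V E). jac k c * \<nu> k)"
    using c by (intro sum.cong refl) (simp only: partial_constr jac_def)
  also have "\<dots> = (\<Sum>v\<in>noninput V E. \<Sum>i<n v. jac (v, i) c * \<nu> (v, i))"
    unfolding coords_def using V_fin noninput_subset
    by (subst sum.Sigma) (auto intro: finite_subset simp: split_def)
  also have "\<dots> = (\<Sum>v\<in>V. if v \<in> noninput V E then \<Sum>i<n v. jac (v, i) c * \<nu> (v, i) else 0)"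
    using V_fin noninput_subset by (intro sum.mono_neutral_cong_left) auto
  finally have 2: "(\<Sum>k\<in>coords n (noninput V E). partial c (constr E \<Phi> k) X * \<nu> k)
      = (\<Sum>v\<in>V. if v \<in> noninput V E then \<Sum>i<n v. jac (v, i) c * \<nu> (v, i) else 0)" .
  show ?thesis
    unfolding 1 2 partial_fhat[OF c] residual_def sum.distrib ..
qed

lemma KKT_iff:
  "solves_KKT V E n \<Phi> l X \<mu> \<delta> \<nu> \<longleftrightarrow>
    (\<forall>c\<in>coords n V. (\<Sum>v\<in>V. residual \<delta> \<nu> v c) = 0) \<and>
    (\<forall>k\<in>coords n (noninput V E). (\<Sum>d\<in>coords n V. jac k d * \<delta> d) = st (In_X k) - st (In_Phi k))"
proof -
  have "(\<Sum>d\<in>coords n V. partial d (constr E \<Phi> k) X * \<delta> d) = (\<Sum>d\<in>coords n V. jac k d * \<delta> d)"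
    if "k \<in> coords n (noninput V E)" for k
    using that by (intro sum.cong refl) (simp only: partial_constr jac_def)
  moreover have "(a + b = - z) \<longleftrightarrow> a + b + z = 0" for a b z :: real by linarith
  ultimately show ?thesis
    unfolding solves_KKT_def using KKT_residual constr_st by simp
qed

definition occurs :: "coord \<Rightarrow> nat set" where
  "occurs c = {t. t < m \<and> c \<in> coords n (D t)}"

text \<open>A vertex whose family contains the vertex of \<open>c\<close> is owned by a node whose
  bag contains it, so restricting to the nodes of \<open>occurs c\<close> loses no term.\<close>

lemma sum_own:
  fixes f :: "nat \<Rightarrow> real"
  assumes "\<And>v. v \<in> V \<Longrightarrow> c \<notin> coords n (fam E v) \<Longrightarrow> f v = 0"
  shows "(\<Sum>t\<in>occurs c. \<Sum>v\<in>own t. f v) = (\<Sum>v\<in>V. f v)"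
proof -
  have "(\<Sum>t\<in>occurs c. \<Sum>v\<in>own t. f v) = (\<Sum>t<m. \<Sum>v\<in>own t. f v)"
  proof (rule sum.mono_neutral_left)
    show "\<forall>t\<in>{..<m} - occurs c. (\<Sum>v\<in>own t. f v) = 0"
    proof
      fix t assume t: "t \<in> {..<m} - occurs c"
      show "(\<Sum>v\<in>own t. f v) = 0"
      proof (rule sum.neutral, rule ballI)
        fix v assume v: "v \<in> own t"
        then have "fam E v \<subseteq> D t" "v \<in> V" using node by (auto simp: own_def)
        then show "f v = 0" using assms[of v] t by (auto simp: occurs_def coords_iff)
      qed
    qed
  qed (auto simp: occurs_def)
  also have "\<dots> = (\<Sum>v\<in>V. f v)"
    unfolding own_def using V_fin node by (intro sum.group) auto
  finally show ?thesis .
qed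

lemma stat_row_iff:
  assumes t: "t < m" and c: "c \<in> coords n (D t)"
  shows "(\<Sum>x\<in>cluster t. ev st (stat_coeff t c x) * u x) = ev st (snd (stat_row t c)) \<longleftrightarrow>
    (\<Sum>v\<in>own t. residual (\<lambda>d. u (VD d)) (\<lambda>k. u (VL k)) v c)
      + (\<Sum>s\<in>{s \<in> occurs c. 0 < s \<and> q s = t}. u (VB s c))
      - (if 0 < t \<and> q t \<in> occurs c then u (VB t c) else 0) = 0"
proof -
  have own_V: "own t \<subseteq> V" by (auto simp: own_def)
  have famD: "fam E v \<subseteq> D t" if "v \<in> own t" for v
    using node that by (auto simp: own_def)
  have "ev st (stat_coeff t c (VD d)) = (\<Sum>v\<in>own t. hess_at v c d)" for d
    by (simp add: o_def sum_slist hess_exp_def hess_at_def interv_sum_list_conv_sum_set_nat atLeast0LessThan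
        del: initial_store.simps)
  then have "(\<Sum>d\<in>coords n (D t). ev st (stat_coeff t c (VD d)) * u (VD d))
      = (\<Sum>d\<in>coords n (D t). \<Sum>v\<in>own t. hess_at v c d * u (VD d))"
    by (simp only: sum_distrib_right)
  also have "\<dots> = (\<Sum>v\<in>own t. \<Sum>d\<in>coords n (D t). hess_at v c d * u (VD d))"
    by (rule sum.swap)
  \<comment> \<open>Columns outside the bag may be added: owned families lie in \<open>D t\<close>,
    so the Hessian terms there vanish.\<close>
  also have "\<dots> = (\<Sum>v\<in>own t. \<Sum>d\<in>coords n V. hess_at v c d * u (VD d))"
  proof (rule sum.cong[OF refl], rule sum.mono_neutral_left)
    fix v assume v: "v \<in> own t"
    show "finite (coords n V)" using V_fin by simp
    show "coords n (D t) \<subseteq> coords n V" using D_V[OF t] by (auto simp: coords_iff)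
    show "\<forall>d\<in>coords n V - coords n (D t). hess_at v c d * u (VD d) = 0"
    proof
      fix d assume "d \<in> coords n V - coords n (D t)"
      then have "d \<notin> coords n (fam E v)" using famD[OF v] by (auto simp: coords_iff)
      then show "hess_at v c d * u (VD d) = 0" by (simp add: hess_at_zero)
    qed
  qed
  finally have 1: "(\<Sum>d\<in>coords n (D t). ev st (stat_coeff t c (VD d)) * u (VD d))
      = (\<Sum>v\<in>own t. \<Sum>d\<in>coords n V. hess_at v c d * u (VD d))" .
  have "(\<Sum>k\<in>mult t. ev st (stat_coeff t c (VL k)) * u (VL k)) = (\<Sum>k\<in>mult t. jac k c * u (VL k))"
    by (intro sum.cong refl) (simp add: jac_exp_def jac_def del: initial_store.simps)
  also have "\<dots> = (\<Sum>v\<in>own t \<inter> noninput V E. \<Sum>i<n v. jac (v, i) c * u (VL (v, i)))"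
    unfolding mult_def coords_def by (subst sum.Sigma) (auto simp: split_def)
  also have "\<dots> = (\<Sum>v\<in>own t. if v \<in> noninput V E then \<Sum>i<n v. jac (v, i) c * u (VL (v, i)) else 0)"
    by (intro sum.mono_neutral_cong_left) auto
  finally have 2: "(\<Sum>k\<in>mult t. ev st (stat_coeff t c (VL k)) * u (VL k)) =
      (\<Sum>v\<in>own t. if v \<in> noninput V E then \<Sum>i<n v. jac (v, i) c * u (VL (v, i)) else 0)" .
  have single: "(\<Sum>d\<in>coords n (D s). ev st (stat_coeff t c (VB s d)) * u (VB s d)) =
      (if c \<in> coords n (D s) then ev st (stat_coeff t c (VB s c)) * u (VB s c) else 0)" if "s < m" for s
  proof -
    have "(\<Sum>d\<in>coords n (D s). ev st (stat_coeff t c (VB s d)) * u (VB s d)) =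
      (\<Sum>d\<in>coords n (D s). if d = c then ev st (stat_coeff t c (VB s c)) * u (VB s c) else 0)"
      by (intro sum.cong refl) auto
    then show ?thesis using D_fin[OF that] by simp
  qed
  have 3: "(\<Sum>d\<in>coords n (D t). ev st (stat_coeff t c (VB t d)) * u (VB t d)) =
      - (if 0 < t \<and> q t \<in> occurs c then u (VB t c) else 0)"
  proof -
    have "0 < t \<Longrightarrow> q t < m" using q[OF t] t by simp
    then have "0 < t \<and> fst c \<in> D (q t) \<longleftrightarrow> 0 < t \<and> q t \<in> occurs c"
      using c by (auto simp: occurs_def coords_iff)
    then show ?thesis using single[OF t] c by simp
  qed
  have "(\<Sum>s\<in>children t. \<Sum>d\<in>coords n (D s). ev st (stat_coeff t c (VB s d)) * u (VB s d))
      = (\<Sum>s\<in>children t. if c \<in> coords n (D s) then u (VB s c) else 0)"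
  proof (rule sum.cong[OF refl])
    fix s assume "s \<in> children t"
    then have "s < m" "s \<noteq> t" using children_less by auto
    then show "(\<Sum>d\<in>coords n (D s). ev st (stat_coeff t c (VB s d)) * u (VB s d)) =
        (if c \<in> coords n (D s) then u (VB s c) else 0)"
      unfolding single[OF \<open>s < m\<close>] by simp
  qed
  also have "\<dots> = (\<Sum>s\<in>{s \<in> children t. c \<in> coords n (D s)}. u (VB s c))"
    by (simp only: sum.inter_filter children_fin)
  also have "{s \<in> children t. c \<in> coords n (D s)} = {s \<in> occurs c. 0 < s \<and> q s = t}"
    by (auto simp: children_def occurs_def)
  finally have 4: "(\<Sum>s\<in>children t. \<Sum>d\<in>coords n (D s). ev st (stat_coeff t c (VB s d)) * u (VB s d))
      = (\<Sum>s\<in>{s \<in> occurs c. 0 < s \<and> q s = t}. u (VB s c))" .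
  have 5: "ev st (snd (stat_row t c)) = - (\<Sum>v\<in>own t. st (In_dl v c))"
    by (simp add: stat_row_def o_def sum_slist del: initial_store.simps)
  show ?thesis
    unfolding sum_cluster[OF t] 1 2 3 4 5 residual_def sum.distrib by linarith
qed

lemma constr_row_eq:
  assumes t: "t < m" and k: "k \<in> mult t"
  shows "(\<Sum>x\<in>cluster t. ev st (constr_coeff k x) * u x) = (\<Sum>d\<in>coords n V. jac k d * u (VD d))"
    and "ev st (snd (constr_row k)) = st (In_X k) - st (In_Phi k)"
proof -
  have k': "k \<in> coords n (noninput V E)" "fam E (fst k) \<subseteq> D t"
    using k node by (auto simp: mult_def own_def coords_iff)
  have "(\<Sum>x\<in>cluster t. ev st (constr_coeff k x) * u x) = (\<Sum>d\<in>coords n (D t). jac k d * u (VD d))"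
    unfolding sum_cluster[OF t] by (simp add: jac_exp_def jac_def del: initial_store.simps)
  also have "\<dots> = (\<Sum>d\<in>coords n V. jac k d * u (VD d))"
  proof (rule sum.mono_neutral_left)
    show "finite (coords n V)" using V_fin by simp
    show "coords n (D t) \<subseteq> coords n V" using D_V[OF t] by (auto simp: coords_iff)
    show "\<forall>d\<in>coords n V - coords n (D t). jac k d * u (VD d) = 0"
    proof
      fix d assume "d \<in> coords n V - coords n (D t)"
      then have "d \<notin> coords n (fam E (fst k))" using k'(2) by (auto simp: coords_iff)
      then show "jac k d * u (VD d) = 0" by (simp add: jac_zero[OF k'(1)])
    qed
  qed
  finally show "(\<Sum>x\<in>cluster t. ev st (constr_coeff k x) * u x) = (\<Sum>d\<in>coords n V. jac k d * u (VD d))" .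
  show "ev st (snd (constr_row k)) = st (In_X k) - st (In_Phi k)"
    by (simp add: constr_row_def del: initial_store.simps)
qed

definition satisfies :: "(var \<Rightarrow> real) \<Rightarrow> bool" where
  "satisfies u \<longleftrightarrow>
    (\<forall>t<m. \<forall>(a, \<beta>)\<in>set (rows t). (\<Sum>x\<in>cluster t. ev st (a x) * u x) = ev st \<beta>)"

lemma satisfies_iff:
  "satisfies u \<longleftrightarrow>
    (\<forall>t<m. \<forall>c\<in>coords n (D t).
      (\<Sum>v\<in>own t. residual (\<lambda>d. u (VD d)) (\<lambda>k. u (VL k)) v c)
      + (\<Sum>s\<in>{s \<in> occurs c. 0 < s \<and> q s = t}. u (VB s c))
      - (if 0 < t \<and> q t \<in> occurs c then u (VB t c) else 0) = 0) \<and>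
    (\<forall>t<m. \<forall>k\<in>mult t. (\<Sum>d\<in>coords n V. jac k d * u (VD d)) = st (In_X k) - st (In_Phi k))"
    (is "_ \<longleftrightarrow> ?S \<and> ?C")
proof -
  have "satisfies u \<longleftrightarrow>
    (\<forall>t<m. \<forall>r\<in>set (rows t). (\<Sum>x\<in>cluster t. ev st (fst r x) * u x) = ev st (snd r))"
    by (auto simp: satisfies_def split_def simp del: initial_store.simps)
  also have "\<dots> \<longleftrightarrow> (\<forall>t<m. (\<forall>c\<in>coords n (D t).
      (\<Sum>x\<in>cluster t. ev st (fst (stat_row t c) x) * u x) = ev st (snd (stat_row t c))) \<and>
      (\<forall>k\<in>mult t. (\<Sum>x\<in>cluster t. ev st (fst (constr_row k) x) * u x) = ev st (snd (constr_row k))))"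
  proof -
    have "(\<forall>r\<in>set (rows t). P r) \<longleftrightarrow>
        (\<forall>c\<in>coords n (D t). P (stat_row t c)) \<and> (\<forall>k\<in>mult t. P (constr_row k))"
      if "t < m" for t P
    proof -
      have "set (rows t) = stat_row t ` coords n (D t) \<union> constr_row ` mult t"
        using D_fin[OF that] by (simp add: rows_def slist)
      then show ?thesis by (simp only: ball_Un ball_simps)
    qed
    then show ?thesis by (intro all_cong)
  qed
  also have "\<dots> \<longleftrightarrow> ?S \<and> ?C"
  proof -
    have fst: "fst (stat_row t c) = stat_coeff t c" "fst (constr_row k) = constr_coeff k" for t c k
      by (simp_all add: stat_row_def constr_row_def)
    show ?thesis
      unfolding fst
      using stat_row_iff[where u = u] constr_row_eq(1)[where u = u] constr_row_eq(2)
      by (simp cong: ball_cong del: initial_store.simps ev.simps) blast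
  qed
  finally show ?thesis .
qed

lemma all_mult: "(\<forall>t<m. \<forall>k\<in>mult t. P k) \<longleftrightarrow> (\<forall>k\<in>coords n (noninput V E). P k)"
proof -
  have "k \<in> mult (node (fst k)) \<and> node (fst k) < m" if "k \<in> coords n (noninput V E)" for k
    using that node noninput_subset by (auto simp: mult_def own_def coords_iff)
  moreover have "k \<in> coords n (noninput V E)" if "k \<in> mult t" for k t
    using that by (auto simp: mult_def coords_iff)
  ultimately show ?thesis by blast
qed

lemma satisfies_imp_KKT:
  assumes "satisfies u"
  shows "solves_KKT V E n \<Phi> l X \<mu> (\<lambda>c. u (VD c)) (\<lambda>k. u (VL k))"
proof -
  have "(\<Sum>v\<in>V. residual (\<lambda>d. u (VD d)) (\<lambda>k. u (VL k)) v c) = 0" if "c \<in> coords n V" for c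
  proof -
    have "(\<Sum>t\<in>occurs c. \<Sum>v\<in>own t. residual (\<lambda>d. u (VD d)) (\<lambda>k. u (VL k)) v c) = 0"
      by (rule messages_sum[where q = q and B = "\<lambda>s. u (VB s c)"])
        (use assms in \<open>auto simp: satisfies_iff occurs_def\<close>)
    then show ?thesis by (simp add: sum_own residual_zero)
  qed
  moreover have "\<forall>k\<in>coords n (noninput V E).
      (\<Sum>d\<in>coords n V. jac k d * u (VD d)) = st (In_X k) - st (In_Phi k)"
    using assms unfolding satisfies_iff all_mult by (rule conjunct2)
  ultimately show ?thesis
    unfolding KKT_iff by (intro conjI ballI) simp_all
qed

text \<open>The messages of different coordinates do not interact, so they are found one coordinate
  at a time, along the subtree where it occurs, and assembled into one assignment.\<close>

lemma KKT_imp_satisfies: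
  assumes "solves_KKT V E n \<Phi> l X \<mu> \<delta> \<nu>"
  shows "\<exists>u. satisfies u"
proof -
  define P where "P c B \<longleftrightarrow> (\<forall>t\<in>occurs c. (\<Sum>v\<in>own t. residual \<delta> \<nu> v c)
      + (\<Sum>s\<in>{s \<in> occurs c. 0 < s \<and> q s = t}. B s) - (if 0 < t \<and> q t \<in> occurs c then B t else 0) = 0)"
    for c and B :: "nat \<Rightarrow> real"
  have "\<exists>B. P c B" if c: "c \<in> coords n V" for c
    unfolding P_def
  proof (rule messages_exist)
    show "occurs c \<subseteq> {..<m}" by (auto simp: occurs_def)
    show "q t < t" if "t < m" "0 < t" for t using q that .
    \<comment> \<open>All coordinates of a vertex occur at the same nodes, so the apex of the vertex
      serves each of them.\<close>
    have "t \<in> occurs c \<and> \<not> (0 < t \<and> q t \<in> occurs c) \<longleftrightarrow>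
        t < m \<and> fst c \<in> D t \<and> \<not> (0 < t \<and> fst c \<in> D (q t))" for t
      using c q[of t] by (auto simp: occurs_def coords_iff)
    then show "\<exists>!t. t \<in> occurs c \<and> \<not> (0 < t \<and> q t \<in> occurs c)"
      using apex[of "fst c"] c by (simp add: coords_iff)
    have "(\<Sum>t\<in>occurs c. \<Sum>v\<in>own t. residual \<delta> \<nu> v c) = (\<Sum>v\<in>V. residual \<delta> \<nu> v c)"
      by (rule sum_own) (rule residual_zero)
    then show "(\<Sum>t\<in>occurs c. \<Sum>v\<in>own t. residual \<delta> \<nu> v c) = 0"
      using assms c by (simp add: KKT_iff)
  qed
  then obtain B where PB: "\<forall>c\<in>coords n V. P c (B c)"
    using bchoice[of "coords n V" P] by blast
  have B: "(\<Sum>v\<in>own t. residual \<delta> \<nu> v c) + (\<Sum>s\<in>{s \<in> occurs c. 0 < s \<and> q s = t}. B c s)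
      - (if 0 < t \<and> q t \<in> occurs c then B c t else 0) = 0"
    if "c \<in> coords n V" "t \<in> occurs c" for c t
    using bspec[OF PB that(1)] that(2) unfolding P_def by (rule bspec)
  define u where "u = (\<lambda>x. case x of VD d \<Rightarrow> \<delta> d | VL k \<Rightarrow> \<nu> k | VB s c \<Rightarrow> B c s)"
  have "c \<in> coords n V \<and> t \<in> occurs c" if "t < m" "c \<in> coords n (D t)" for t c
    using that D_V[of t] by (auto simp: occurs_def coords_iff)
  moreover have "u (VD d) = \<delta> d" "u (VL k) = \<nu> k" "u (VB s c) = B c s" for d k s c
    by (simp_all add: u_def)
  ultimately have "satisfies u"
    unfolding satisfies_iff all_mult using assms[unfolded KKT_iff] B by (simp only:) blast
  then show ?thesis by (rule exI[of satisfies u])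
qed

end

section \<open>Assembly of the solver\<close>

lemma solves_KKT_cong:
  assumes "solves_KKT V E n \<Phi> l X \<mu> \<delta> \<nu>"
    and "\<And>c. c \<in> coords n V \<Longrightarrow> \<delta>' c = \<delta> c" "\<And>k. k \<in> coords n (noninput V E) \<Longrightarrow> \<nu>' k = \<nu> k"
  shows "solves_KKT V E n \<Phi> l X \<mu> \<delta>' \<nu>'"
  using assms unfolding solves_KKT_def by (simp cong: sum.cong)

text \<open>Each summand is a cost with the powers of \<open>w\<close> factored out:
  \<open>4 * ell + 2\<close> is at most \<open>(64 * N + 78) * w\<close>, and 12 counts six
  instructions for copying out a state coordinate and six for a multiplier.\<close>

definition kkt_const :: "nat \<Rightarrow> nat" where
  "kkt_const N = 2 * (20 * N + 1)\<^sup>2 * (64 * N + 78) + 154 * (20 * N + 1) ^ 3 + 12 * (20 * N + 1)"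

text \<open>The order of quantifiers matters: one program serves all numerical data. Appending the
  copies to the output cells adds O(m w) instructions.\<close>

lemma (in decomposed) kkt_program:
  "\<exists>p. \<forall>U \<Phi> l X \<mu>. computational_structure V E n U \<Phi> l \<longrightarrow> X \<in> Pi\<^sub>E V U \<longrightarrow>
     QP_attained V E n \<Phi> l X \<mu> \<longrightarrow>
     solves_KKT_within p (kkt_const N * m * w ^ 3) V E n \<Phi> l X \<mu>"
proof -
  define K where "K = (20 * N + 1) * w"
  obtain as where as: "admissible as" "cost as \<le> m * (2 * K\<^sup>2 * (4 * ell + 2) + 154 * K ^ 3)"
    and sol: "\<And>s. \<forall>i. s (Work i) = 0 \<Longrightarrow>
      \<exists>u. \<forall>t<m. \<forall>(a, \<beta>)\<in>set (rows t). (\<Sum>x\<in>cluster t. ev s (a x) * u x) = ev s \<beta> \<Longrightarrow>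
      \<forall>t<m. \<forall>(a, \<beta>)\<in>set (rows t). (\<Sum>x\<in>cluster t. ev s (a x) * exec as s (wk (Sol x))) = ev s \<beta>"
    using node_solver unfolding K_def by blast
  define O1 where "O1 = map (\<lambda>c. (Out_delta c, wv (Sol (VD c)))) (slist (coords n V))"
  define O2 where "O2 = map (\<lambda>k. (Out_lam k, wv (Sol (VL k)))) (slist (coords n (noninput V E)))"
  have NI: "noninput V E \<subseteq> V" by (auto simp: noninput_def)
  have fin: "finite (coords n V)" "finite (coords n (noninput V E))"
    using V_fin finite_subset[OF NI] by simp_all
  have out_temps: "Out_delta c \<notin> temps" "Out_lam c \<notin> temps" for c
    by (auto simp: temps_def tmp_def)
  have adm: "admissible (as @ O1 @ O2)"
    using as(1) out_temps by (auto simp: O1_def O2_def admissible_def)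
  have "card (coords n V) \<le> m * K"
  proof -
    have "coords n V \<subseteq> (\<Union>t<m. coords n (D t))"
    proof
      fix c assume "c \<in> coords n V"
      then show "c \<in> (\<Union>t<m. coords n (D t))"
        using node[of "fst c"] by (auto simp: coords_iff fam_def)
    qed
    then have "card (coords n V) \<le> card (\<Union>t<m. coords n (D t))"
      using D_fin by (intro card_mono) auto
    also have "\<dots> \<le> (\<Sum>t<m. card (coords n (D t)))" by (rule card_UN_le) simp
    also have "\<dots> \<le> (\<Sum>t<m. K)"
    proof (rule sum_mono)
      fix t assume "t \<in> {..<m}"
      then have "card (coords n (D t)) \<le> kappa" using card_D by simp
      also have "\<dots> \<le> K" by (simp add: kappa_def K_def algebra_simps)
      finally show "card (coords n (D t)) \<le> K" .
    qed
    finally show ?thesis by simp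
  qed
  moreover have "card (coords n (noninput V E)) \<le> card (coords n V)"
    using NI fin by (intro card_mono) (auto simp: coords_iff)
  moreover have "cost O1 \<le> length O1 * (4 * 1 + 2)"
    by (rule cost_le) (auto simp: O1_def)
  moreover have "cost O2 \<le> length O2 * (4 * 1 + 2)"
    by (rule cost_le) (auto simp: O2_def)
  ultimately have "cost (O1 @ O2) \<le> 12 * (m * K)"
    using fin by (simp add: O1_def O2_def length_slist)
  then have "cost (as @ O1 @ O2) \<le> m * (2 * K\<^sup>2 * (4 * ell + 2) + 154 * K ^ 3 + 12 * K)"
    using as(2) by (simp add: algebra_simps)
  also have "\<dots> \<le> m * (kkt_const N * w ^ 3)"
  proof (rule mult_left_mono)
    have "4 * ell + 2 \<le> (64 * N + 78) * w"
      using w by (simp add: ell_def algebra_simps)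
    then have "2 * K\<^sup>2 * (4 * ell + 2) \<le> 2 * K\<^sup>2 * ((64 * N + 78) * w)"
      by (rule mult_left_mono) simp
    moreover have "w \<le> w ^ 3" using w by (intro self_le_power) auto
    then have "12 * K \<le> 12 * (20 * N + 1) * w ^ 3"
      unfolding K_def mult.assoc[symmetric] by (rule mult_left_mono) simp
    moreover have "kkt_const N * w ^ 3 =
        2 * K\<^sup>2 * ((64 * N + 78) * w) + 154 * K ^ 3 + 12 * (20 * N + 1) * w ^ 3"
      unfolding kkt_const_def K_def power_mult_distrib
      by (simp add: algebra_simps power2_eq_square power3_eq_cube)
    ultimately show "2 * K\<^sup>2 * (4 * ell + 2) + 154 * K ^ 3 + 12 * K \<le> kkt_const N * w ^ 3"
      by linarith
  qed simp
  finally have cost: "cost (as @ O1 @ O2) \<le> kkt_const N * m * w ^ 3"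
    by (simp only: mult_ac)
  have "solves_KKT_within (compile_list (as @ O1 @ O2)) (kkt_const N * m * w ^ 3) V E n \<Phi> l X \<mu>"
    if cs: "computational_structure V E n U \<Phi> l" and X: "X \<in> Pi\<^sub>E V U"
      and QP: "QP_attained V E n \<Phi> l X \<mu>" for U \<Phi> l X \<mu>
  proof -
    \<comment> \<open>The numerical data enter only here, after the program has been fixed.\<close>
    interpret decomposed_kkt V E n N m w q D U \<Phi> l X \<mu>
      using cs X by unfold_locales
    obtain \<delta> \<nu> where "solves_KKT V E n \<Phi> l X \<mu> \<delta> \<nu>" using KKT_solvable[OF QP] by blast
    then obtain u0 where "satisfies u0" using KKT_imp_satisfies by blast
    moreover define u where "u x = exec as st (wk (Sol x))" for x :: var
    ultimately have "satisfies u"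
      using sol[of st] unfolding satisfies_def by (simp only: initial_store.simps) blast
    then have kkt: "solves_KKT V E n \<Phi> l X \<mu> (\<lambda>c. u (VD c)) (\<lambda>k. u (VL k))"
      by (rule satisfies_imp_KKT)
    obtain s' t where run: "run (compile_list (as @ O1 @ O2)) st = Some (s', t)" "t \<le> cost (as @ O1 @ O2)"
      and s': "\<forall>c. c \<notin> temps \<longrightarrow> s' c = exec (as @ O1 @ O2) st c"
      using run_compile_list[OF adm, of st st] by blast
    have 1: "s' (Out_delta c) = u (VD c)" if "c \<in> coords n V" for c
    proof -
      have "exec O1 (exec as st) (Out_delta c) = ev (exec as st) (wv (Sol (VD c)))"
        unfolding O1_def
        by (rule exec_par) (use fin that in \<open>auto simp: slist inj_on_def wk_def\<close>)
      moreover have "exec O2 s (Out_delta c) = s (Out_delta c)" for s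
        by (intro exec_other) (auto simp: O2_def)
      ultimately show ?thesis using s' out_temps by (simp add: u_def)
    qed
    have 2: "s' (Out_lam k) = u (VL k)" if "k \<in> coords n (noninput V E)" for k
    proof -
      have "exec O2 s (Out_lam k) = ev s (wv (Sol (VL k)))" for s
        unfolding O2_def
        by (rule exec_par) (use fin that in \<open>auto simp: slist inj_on_def wk_def\<close>)
      moreover have "exec O1 s (wk a) = s (wk a)" for s and a :: "var slot"
        by (intro exec_other) (auto simp: O1_def wk_def)
      ultimately show ?thesis using s' out_temps by (simp add: u_def)
    qed
    have "solves_KKT V E n \<Phi> l X \<mu> (\<lambda>c. s' (Out_delta c)) (\<lambda>k. s' (Out_lam k))"
      using solves_KKT_cong[OF kkt 1 2] .
    then show ?thesis
      unfolding solves_KKT_within_def using run cost by (meson order_trans)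
  qed
  then show ?thesis by blast
qed

lemma decomposed_exists:
  assumes cs: "computational_structure V E n U \<Phi> l" and n: "\<forall>v\<in>V. n v \<le> N"
    and td: "tree_decomposition V (hyperedges V E) I F bag"
  shows "\<exists>q D. decomposed V E n N (card I) (max 1 (width I bag)) q D"
proof -
  have fin: "finite V" and E: "E \<subseteq> V \<times> V"
    using cs by (auto simp: computational_structure_def)
  obtain q D where *: "\<forall>t<card I. 0 < t \<longrightarrow> q t < t"
    "\<forall>t<card I. card {s. s < card I \<and> 0 < s \<and> q s = t} \<le> 2"
    "\<forall>t<card I. D t \<subseteq> V \<and> card (D t) \<le> 2 * (width I bag + 1)"
    "\<forall>e\<in>hyperedges V E. \<exists>t<card I. e \<subseteq> D t"
    "\<forall>u\<in>V. \<exists>!t. t < card I \<and> u \<in> D t \<and> \<not> (0 < t \<and> u \<in> D (q t))"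
    using binary_tree_decomposition[OF td fin] by (elim exE conjE)
  have "decomposed V E n N (card I) (max 1 (width I bag)) q D"
  proof
    show "fam E v \<subseteq> V" if "v \<in> V" for v using E that by (auto simp: fam_def pa_def)
    show "card (D t) \<le> 4 * max 1 (width I bag)" if "t < card I" for t
    proof -
      have "card (D t) \<le> 2 * (width I bag + 1)" using *(3) that by blast
      \<comment> \<open>Origin of the factor 4: the bags were doubled, and
        \<open>width I bag + 1\<close> is at most twice the width read as at least 1.\<close>
      also have "\<dots> \<le> 4 * max 1 (width I bag)" by (simp add: max_def)
      finally show ?thesis .
    qed
    show "\<exists>t<card I. fam E v \<subseteq> D t" if "v \<in> V" for v
      using *(4) that unfolding hyperedges_def by blast
  qed (use fin n * in \<open>simp_all\<close>)
  then show ?thesis by blast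
qed

theorem theorem2:
  fixes N :: nat
  shows "\<exists>(C :: nat) (alg :: solver).
    \<forall>V E n U \<Phi> l X \<mu> I F bag.
      computational_structure V E n U \<Phi> l \<longrightarrow>
      (\<forall>v\<in>V. n v \<le> N) \<longrightarrow>
      X \<in> Pi\<^sub>E V U \<longrightarrow>
      QP_attained V E n \<Phi> l X \<mu> \<longrightarrow>
      tree_decomposition V (hyperedges V E) I F bag \<longrightarrow>
      width I bag = treewidth V (hyperedges V E) \<longrightarrow>
      solves_KKT_within (alg V E n I F bag)
        (C * card I * max 1 (treewidth V (hyperedges V E)) ^ 3) V E n \<Phi> l X \<mu>"
proof -
  define good where "good V E n I bag p \<longleftrightarrow>
    (\<forall>U \<Phi> l X \<mu>. computational_structure V E n U \<Phi> l \<longrightarrow> X \<in> Pi\<^sub>E V U \<longrightarrow>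
      QP_attained V E n \<Phi> l X \<mu> \<longrightarrow>
      solves_KKT_within p (kkt_const N * card I * max 1 (width I bag) ^ 3) V E n \<Phi> l X \<mu>)"
    for V E n and I :: "nat set" and bag :: "nat \<Rightarrow> nat set" and p
  \<comment> \<open>Choice is legitimate because \<open>good\<close> quantifies over all numerical
    data: the chosen program depends on the graph, the dimensions and the decomposition
    alone.\<close>
  define alg :: solver where "alg V E n I F bag = (SOME p. good V E n I bag p)" for V E n I F bag
  have good: "good V E n I bag (alg V E n I F bag)"
    if cs: "computational_structure V E n U \<Phi> l" and n: "\<forall>v\<in>V. n v \<le> N"
      and td: "tree_decomposition V (hyperedges V E) I F bag" for V E n U \<Phi> l I F bag
  proof -
    obtain q D where "decomposed V E n N (card I) (max 1 (width I bag)) q D"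
      using decomposed_exists[OF cs n td] by blast
    then have "\<exists>p. good V E n I bag p"
      unfolding good_def by (rule decomposed.kkt_program)
    then show ?thesis unfolding alg_def by (rule someI_ex)
  qed
  show ?thesis
  proof (intro exI[of _ "kkt_const N"] exI[of _ alg] allI impI)
    fix V E n U \<Phi> l X \<mu> F bag and I :: "nat set"
    assume cs: "computational_structure V E n U \<Phi> l" and n: "\<forall>v\<in>V. n v \<le> N"
      and "X \<in> Pi\<^sub>E V U" "QP_attained V E n \<Phi> l X \<mu>"
      and td: "tree_decomposition V (hyperedges V E) I F bag"
      and "width I bag = treewidth V (hyperedges V E)"
    then show "solves_KKT_within (alg V E n I F bag)
        (kkt_const N * card I * max 1 (treewidth V (hyperedges V E)) ^ 3) V E n \<Phi> l X \<mu>"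
      using good[OF cs n td] unfolding good_def by metis
  qed
qed

end
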